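(* Let $T=\sum_{k=0}^N Q_k(z)D^k$, where $Q_N(z)\not\equiv 0$, be a non-degenerate hyperbolicity preserving differential operator with nonnegative Fuchs index $r$, and suppose that $n\in\mathbb{N}$ is such that there is no $\theta\in\mathbb{R}$ with $Q_0(\theta)=\cdots=Q_n(\theta)=0$. Then: (1) If $f_1,f_2$ are monic polynomials for which $(v,f_1)$ and $(v,f_2)$ are both solutions of the eigen-problem for $T$ (that is, $v,f_1,f_2\in\mathbb{C}[z]$, $T(f_1)=vf_1$ and $T(f_2)=vf_2$), then $f_1=f_2$. (2) For all $S\subseteq[n+r]$ of cardinality $r$ there is a unique pair $(v,f)$ of hyperbolic polynomials with zero pattern $(S,[n+r]\setminus S)$ such that $T(f)=vf$, with $f$ monic of degree $n$. These are all the pairs $(v,f)\in\mathbb{C}[z]\times\mathbb{C}[z]$ such that $T(f)=vf$ with $f$ monic of degree $n$. Hence there are exactly $\binom{n+r}{r}$ pairs of polynomials $(v,f)$ such that $T(f)=vf$, with $f$ monic of degree $n$. (3) For the pairs $(v,f)$ in (2), $v$ and $f$ are co-prime and their zeros lie in the convex hull of the zeros of $Q_e$, where $e=\min(n,N)$. (4) If there is no $\theta\in\mathbb{R}$ such that $Q_1(\theta)=\cdots=Q_n(\theta)=0$, then for the pairs $(v,f)$ in (2), $v$ and $f$ have simple zeros which all lie in the interior of the convex hull of the zeros of $Q_e$, where $e=\min(n,N)$.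
   Context: $D=d/dz$, $\mathbb{N}=\{0,1,2,\dots\}$, $[m]=\{1,\dots,m\}$, the coefficients $Q_k$ are polynomials in $\mathbb{R}[z]$, and $Q_k\equiv 0$ for $k>N$. The eigen-problem for a linear operator $T:\mathbb{C}[z]\to\mathbb{C}[z]$ is to describe all pairs $(v,f)\in\mathbb{C}[z]\times\mathbb{C}[z]$, with $f\not\equiv 0$, such that $T(f)=vf$; in such a pair $v$ is called a (generalized) Van Vleck polynomial and $f$ a (generalized) Stieltjes polynomial for $T$. A polynomial in $\mathbb{R}[z]$ is hyperbolic if all its zeros are real (nonzero constants are hyperbolic). A linear operator $T:\mathbb{R}[z]\to\mathbb{R}[z]$ preserves hyperbolicity if $T(f)$ is hyperbolic or identically zero whenever $f$ is hyperbolic; a differential operator with real polynomial coefficients is also regarded as acting on $\mathbb{C}[z]$. The Fuchs index of $T=\sum_{k=0}^N Q_kD^k$ (with $Q_N\not\equiv 0$) is $r=\max_k(\deg Q_k-k)$, the maximum being over those $k$ with $Q_k\not\equiv 0$; $T$ is non-degenerate if $\deg Q_N=N+r$. The coefficients $Q_k$ of a hyperbolicity preserver are hyperbolic or zero, so the convex hull of the zeros of $Q_e$ is a closed interval of $\mathbb{R}$. Zero pattern: let $v$ and $f$ be hyperbolic polynomials of degrees $r$ and $n$ respectively, let $\alpha_1\le\cdots\le\alpha_{n+r}$ be the zeros of $vf$ (with multiplicity), and let $A,B$ be disjoint sets with $A\cup B=[n+r]$, $|A|=r$, $|B|=n$. The pair $(v,f)$ has zero pattern $(A,B)$ if the zeros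 of $v$ are $\{\alpha_i:i\in A\}$ and the zeros of $f$ are $\{\alpha_i:i\in B\}$, as multisets (with multiplicity).
   Formalization: N ≥ 1 is assumed (for N = 0, T is multiplication by a nonzero constant and (1) fails), and (1) is asserted only for v ≢ 0 (for v = 0 it can fail: T(f) = ((z³−z)f'')' kills both z and z+1). *)

theory Defs
  imports "HOL-Analysis.Analysis" "HOL-Computational_Algebra.Computational_Algebra"
begin

abbreviation cpoly :: "real poly \<Rightarrow> complex poly" where
  "cpoly \<equiv> map_poly complex_of_real"

text \<open>
  Hyperbolic polynomials are nonzero by convention; the zero polynomial is mentioned
  separately where it is allowed.
\<close>

definition hyperbolic :: "real poly \<Rightarrow> bool" where
  "hyperbolic p \<longleftrightarrow> p \<noteq> 0 \<and> (\<forall>z. poly (cpoly p) z = 0 \<longrightarrow> z \<in> \<real>)"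

definition diff_op :: "nat \<Rightarrow> (nat \<Rightarrow> 'a :: idom poly) \<Rightarrow> 'a poly \<Rightarrow> 'a poly" where
  "diff_op N Q f = (\<Sum>k\<le>N. Q k * (pderiv ^^ k) f)"

definition cdiff_op :: "nat \<Rightarrow> (nat \<Rightarrow> real poly) \<Rightarrow> complex poly \<Rightarrow> complex poly" where
  "cdiff_op N Q = diff_op N (\<lambda>k. cpoly (Q k))"

definition preserves_hyperbolicity :: "(real poly \<Rightarrow> real poly) \<Rightarrow> bool" where
  "preserves_hyperbolicity T \<longleftrightarrow> (\<forall>f. hyperbolic f \<longrightarrow> hyperbolic (T f) \<or> T f = 0)"

text \<open>Meaningful only if some \<^term>\<open>Q k\<close> with \<^term>\<open>k \<le> N\<close> is nonzero.\<close>

definition fuchs_index :: "nat \<Rightarrow> (nat \<Rightarrow> real poly) \<Rightarrow> int" where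
  "fuchs_index N Q = Max {int (degree (Q k)) - int k | k. k \<le> N \<and> Q k \<noteq> 0}"

definition non_degenerate :: "nat \<Rightarrow> (nat \<Rightarrow> real poly) \<Rightarrow> bool" where
  "non_degenerate N Q \<longleftrightarrow> int (degree (Q N)) = int N + fuchs_index N Q"

definition eigenpair :: "('a :: idom poly \<Rightarrow> 'a poly) \<Rightarrow> 'a poly \<Rightarrow> 'a poly \<Rightarrow> bool" where
  "eigenpair T v f \<longleftrightarrow> f \<noteq> 0 \<and> T f = v * f"

definition monic :: "'a :: idom poly \<Rightarrow> bool" where
  "monic f \<longleftrightarrow> lead_coeff f = 1"

text \<open>
  \<^term>\<open>\<alpha>\<close> lists the zeros of \<^term>\<open>v * f\<close> in increasing order with multiplicity. Positions
  are numbered from 1, so the \<open>i\<close>-th zero is \<^term>\<open>\<alpha> ! (i - 1)\<close>.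
\<close>

definition zero_pattern ::
    "real poly \<Rightarrow> real poly \<Rightarrow> nat set \<Rightarrow> nat set \<Rightarrow> bool" where
  "zero_pattern v f A B \<longleftrightarrow>
     hyperbolic v \<and> hyperbolic f \<and>
     A \<inter> B = {} \<and> A \<union> B = {1..degree f + degree v} \<and>
     card A = degree v \<and> card B = degree f \<and>
     (let \<alpha> = sorted_list_of_multiset (proots (v * f))
      in proots v = image_mset (\<lambda>i. \<alpha> ! (i - 1)) (mset_set A) \<and>
         proots f = image_mset (\<lambda>i. \<alpha> ! (i - 1)) (mset_set B))"

definition real_zeros :: "real poly \<Rightarrow> real set" where
  "real_zeros p = {x. poly p x = 0}"

definition complex_zeros :: "complex poly \<Rightarrow> complex set" where
  "complex_zeros p = {z. poly p z = 0}"

end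

(*
For a hyperbolic f of degree n the zeros of T f depend monotonically on the zeros of f: moving one
zero of f to the right moves no zero of T f to the left. The sum of the zeros of T f is an affine
function of the sum of the zeros of f with slope c in [0,1). Hence, for a fixed set of positions,
the map sending the zeros of f to the zeros of T f at these positions is an l1-contraction; its
fixed points are the solutions of T f = v f with the prescribed zero pattern, so there is exactly
one for each pattern.

That there are no other solutions is seen at a highest nonreal zero x of f. The polynomial
w |-> sum_k Q_k(x) w^k has its zeros in the open upper half-plane or at 0 (a limit of the
preservation property applied to (1 + w x/m)^m), so T f vanishes at x to an order smaller than f.
The same symbol at real points controls common and multiple zeros. It also shows that consecutive
Q_k interlace, which gives the degrees and signs of the Q_k and the location of the zeros.
*)

theory Submission
  imports Defs "HOL-Complex_Analysis.Complex_Analysis"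
begin

section \<open>Hyperbolic polynomials\<close>

text \<open>For n > 0 the slope c is \<open>lam (n - 1) / lam n\<close>, where \<open>lam m\<close>
  is the factor by which \<open>T\<close> multiplies the coefficient of x^m. It lies in [0,1)
  because all nonzero \<open>top_coeff k\<close> have the same sign, but this sign pattern is itself
  read off from the symbol. The circle is broken by growth: \<open>lam\<close> is a polynomial in
  \<open>m\<close> of degree \<open>N\<close>, so for large \<open>m\<close> its sign is that of
  \<open>top_coeff N\<close> whatever the other coefficients are, and the limit that locates the
  zeros of the symbol uses large powers only. The l1 distance fits because for comparable vectors it
  is the difference of the sums, which Vieta's formula controls exactly. Coprimality and simplicity
  come from moving zeros of f one at a time. Each move changes the multiplicity of a point as a zero
  of \<open>T f\<close> by at most one, so a surplus multiplicity survives until the factor left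
  behind no longer vanishes at that point. Freezing the coefficients of \<open>T\<close> there
  leaves a constant coefficient operator, for which such a surplus is impossible.\<close>

lemma coeff_cpoly [simp]: "coeff (cpoly p) n = of_real (coeff p n)"
  by (simp add: coeff_map_poly)

lemma degree_cpoly [simp]: "degree (cpoly p) = degree p"
  by (simp add: degree_map_poly)

lemma cpoly_eq_iff [simp]: "cpoly p = cpoly q \<longleftrightarrow> p = q"
  by (simp add: poly_eq_iff)

lemma cpoly_eq_0_iff [simp]: "cpoly p = 0 \<longleftrightarrow> p = 0"
  by (simp add: poly_eq_iff)

lemma cpoly_add: "cpoly (p + q) = cpoly p + cpoly q"
  by (simp add: poly_eq_iff)

lemma cpoly_diff: "cpoly (p - q) = cpoly p - cpoly q"
  by (simp add: poly_eq_iff)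

lemma cpoly_smult: "cpoly (smult c p) = smult (of_real c) (cpoly p)"
  by (simp add: poly_eq_iff)

lemma cpoly_mult: "cpoly (p * q) = cpoly p * cpoly q"
  by (simp add: poly_eq_iff coeff_mult)

lemma cpoly_power: "cpoly (p ^ n) = cpoly p ^ n"
  by (induction n) (simp_all add: cpoly_mult)

lemma cpoly_sum: "cpoly (\<Sum>x\<in>A. f x) = (\<Sum>x\<in>A. cpoly (f x))"
  by (induction A rule: infinite_finite_induct) (simp_all add: cpoly_add)

lemma cpoly_pCons [simp]: "cpoly (pCons a p) = pCons (of_real a) (cpoly p)"
  by (simp add: map_poly_pCons)

lemma cpoly_pderiv: "cpoly (pderiv p) = pderiv (cpoly p)"
  by (simp add: poly_eq_iff coeff_pderiv)

lemma cpoly_higher_pderiv: "cpoly ((pderiv ^^ k) p) = (pderiv ^^ k) (cpoly p)"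
  by (induction k) (simp_all add: cpoly_pderiv)

lemma poly_cpoly_of_real [simp]: "poly (cpoly p) (of_real x) = of_real (poly p x)"
  by (induction p) auto

lemma cnj_poly_cpoly: "cnj (poly (cpoly p) z) = poly (cpoly p) (cnj z)"
  by (rule poly_cnj_real) simp

text \<open>Real division with remainder is also a division over the complex numbers, and a multiple
  of \<open>cpoly p\<close> of smaller degree is zero. So multiplicities at real points do not
  depend on the field.\<close>

lemma cpoly_dvd_iff: "cpoly p dvd cpoly q \<longleftrightarrow> p dvd q"
proof
  assume "cpoly p dvd cpoly q"
  show "p dvd q"
  proof (cases "p = 0")
    case True
    with \<open>cpoly p dvd cpoly q\<close> show ?thesis by simp
  next
    case False
    have "cpoly q = cpoly (q div p) * cpoly p + cpoly (q mod p)"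
      by (simp flip: cpoly_mult cpoly_add)
    with \<open>cpoly p dvd cpoly q\<close> have "cpoly p dvd cpoly (q mod p)"
      by (metis dvd_add_right_iff dvd_triv_right)
    moreover have "degree (q mod p) < degree p \<or> q mod p = 0"
      using degree_mod_less[OF False] by blast
    ultimately have "q mod p = 0"
      by (metis degree_cpoly cpoly_eq_0_iff dvd_imp_degree_le not_less)
    thus ?thesis by auto
  qed
next
  assume "p dvd q"
  thus "cpoly p dvd cpoly q" by (auto simp: cpoly_mult)
qed

lemma order_cpoly: "p \<noteq> 0 \<Longrightarrow> order (of_real x) (cpoly p) = order x p"
proof -
  assume p: "p \<noteq> 0"
  have "[:- complex_of_real x, 1:] ^ n dvd cpoly p \<longleftrightarrow> [:- x, 1:] ^ n dvd p" for n
    using cpoly_dvd_iff[of "[:-x,1:] ^ n" p] by (simp add: cpoly_power)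
  with p show ?thesis
    by (metis order_divides cpoly_eq_0_iff dual_order.antisym order_refl)
qed

lemma hyperbolic_nonzero: "hyperbolic p \<Longrightarrow> p \<noteq> 0"
  by (simp add: hyperbolic_def)

lemma hyperbolic_rootD: "hyperbolic p \<Longrightarrow> poly (cpoly p) z = 0 \<Longrightarrow> Im z = 0"
  by (auto simp: hyperbolic_def complex_is_Real_iff)

text \<open>Nonreal zeros of a real polynomial come in conjugate pairs, so one half-plane is
  enough.\<close>

lemma hyperbolicI: "p \<noteq> 0 \<Longrightarrow> (\<And>z. Im z > 0 \<Longrightarrow> poly (cpoly p) z \<noteq> 0) \<Longrightarrow> hyperbolic p"
proof -
  assume p: "p \<noteq> 0" and nz: "\<And>z. Im z > 0 \<Longrightarrow> poly (cpoly p) z \<noteq> 0"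
  have "z \<in> \<real>" if "poly (cpoly p) z = 0" for z
    using nz[of z] nz[of "cnj z"] that cnj_poly_cpoly[of p z]
    by (cases "Im z" "0 :: real" rule: linorder_cases) (auto simp: complex_is_Real_iff)
  with p show ?thesis by (auto simp: hyperbolic_def)
qed

lemma hyperbolic_mult_iff: "hyperbolic (p * q) \<longleftrightarrow> hyperbolic p \<and> hyperbolic q"
  by (auto simp: hyperbolic_def cpoly_mult)

lemma hyperbolic_linear [simp]: "hyperbolic [:-a, 1:]"
  unfolding hyperbolic_def complex_is_Real_iff by (auto simp: complex_eq_iff)

lemma hyperbolic_1 [simp]: "hyperbolic 1"
  by (simp add: hyperbolic_def)

lemma hyperbolic_smult: "c \<noteq> 0 \<Longrightarrow> hyperbolic (smult c p) \<longleftrightarrow> hyperbolic p"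
  by (auto simp: hyperbolic_def cpoly_smult)

lemma hyperbolic_power: "hyperbolic p \<Longrightarrow> hyperbolic (p ^ n)"
  by (induction n) (auto simp: hyperbolic_mult_iff)

lemma hyperbolic_prod: "(\<And>x. x \<in> A \<Longrightarrow> hyperbolic (f x)) \<Longrightarrow> hyperbolic (\<Prod>x\<in>A. f x)"
  by (induction A rule: infinite_finite_induct) (auto simp: hyperbolic_mult_iff)

lemma hyperbolic_prod_mset: "hyperbolic (\<Prod>x\<in>#A. [:-x, 1:])"
  by (induction A) (auto simp: hyperbolic_mult_iff simp del: mult_pCons_left)

lemma proots_cpoly:
  assumes "hyperbolic p"
  shows "proots (cpoly p) = image_mset of_real (proots p)"
proof (rule multiset_eqI)
  fix z :: complex
  have p: "p \<noteq> 0" using assms by (rule hyperbolic_nonzero)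
  show "count (proots (cpoly p)) z = count (image_mset of_real (proots p)) z"
  proof (cases "z \<in> \<real>")
    case True
    then obtain x where x: "z = of_real x" by (auto elim: Reals_cases)
    have "count (image_mset complex_of_real A) (of_real x) = count A x" for A
      by (induction A) auto
    with p x show ?thesis by (simp add: order_cpoly)
  next
    case False
    hence "poly (cpoly p) z \<noteq> 0" using assms by (auto simp: hyperbolic_def)
    hence "order z (cpoly p) = 0" by (simp add: order_0I)
    moreover have "z \<notin># image_mset complex_of_real (proots p)" using False by auto
    hence "count (image_mset complex_of_real (proots p)) z = 0"
      by (metis count_eq_zero_iff)
    ultimately show ?thesis using p by simp
  qed
qed

lemma size_proots_hyperbolic: "hyperbolic p \<Longrightarrow> size (proots p) = degree p"
  by (metis proots_cpoly size_image_mset size_proots_complex degree_cpoly)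

lemma hyperbolic_decompose: "hyperbolic p \<Longrightarrow> p = smult (lead_coeff p) (\<Prod>x\<in>#proots p. [:-x, 1:])"
proof -
  assume p: "hyperbolic p"
  have cp: "cpoly (\<Prod>x\<in>#A. [:-x, 1:]) = (\<Prod>x\<in>#image_mset of_real A. [:-x, 1:])" for A :: "real multiset"
    by (induction A) (simp_all add: cpoly_mult del: mult_pCons_left)
  have "cpoly p = smult (lead_coeff (cpoly p)) (\<Prod>x\<in>#proots (cpoly p). [:-x, 1:])"
    by (rule complex_poly_decompose_multiset [symmetric])
  also have "\<dots> = cpoly (smult (lead_coeff p) (\<Prod>x\<in>#proots p. [:-x, 1:]))"
    unfolding cpoly_smult cp proots_cpoly[OF p] by simp
  finally show ?thesis by (simp only: cpoly_eq_iff)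
qed

lemma proots_prod_linear [simp]: "proots (\<Prod>x\<in>#A. [:-x, 1:]) = (A :: 'a :: idom multiset)"
proof (induction A)
  case (add x A)
  have "(\<Prod>x\<in>#A. [:-x, 1:]) \<noteq> (0 :: 'a poly)" by (auto simp: prod_mset_zero_iff)
  with add show ?case by (simp add: proots_mult del: mult_pCons_left)
qed simp

lemma degree_prod_linear [simp]: "degree (\<Prod>x\<in>#A. [:-x, 1:] :: 'a :: idom poly) = size A"
  and lead_coeff_prod_linear [simp]: "lead_coeff (\<Prod>x\<in>#A. [:-x, 1:] :: 'a :: idom poly) = 1"
  and prod_linear_nonzero [simp]: "(\<Prod>x\<in>#A. [:-x, 1:] :: 'a :: idom poly) \<noteq> 0"
proof -
  have *: "degree (\<Prod>x\<in>#A. [:-x, 1:] :: 'a :: idom poly) = size A \<and>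
     lead_coeff (\<Prod>x\<in>#A. [:-x, 1:] :: 'a :: idom poly) = 1 \<and> (\<Prod>x\<in>#A. [:-x, 1:] :: 'a :: idom poly) \<noteq> 0"
  proof (induction A)
    case (add x A)
    hence l: "lead_coeff (\<Prod>x\<in>#A. [:-x, 1:] :: 'a poly) = 1" by blast
    have "lead_coeff ([:-x, 1:] * (\<Prod>x\<in>#A. [:-x, 1:]) :: 'a poly) = 1"
      unfolding lead_coeff_mult l by simp
    with add show ?case by (simp add: degree_mult_eq del: mult_pCons_left)
  qed auto
  thus "degree (\<Prod>x\<in>#A. [:-x, 1:] :: 'a :: idom poly) = size A"
    "lead_coeff (\<Prod>x\<in>#A. [:-x, 1:] :: 'a :: idom poly) = 1" "(\<Prod>x\<in>#A. [:-x, 1:] :: 'a :: idom poly) \<noteq> 0"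
    by auto
qed

lemma coeff_prod_linear_second:
  assumes "size A = Suc n"
  shows "coeff (\<Prod>x\<in>#A. [:-x, 1:] :: 'a :: idom poly) n = - \<Sum>\<^sub># A"
  using assms
proof (induction A arbitrary: n)
  case (add x A)
  show ?case
  proof (cases n)
    case 0
    with add.prems have "A = {#}" by simp
    with 0 show ?thesis by simp
  next
    case (Suc m)
    with add.prems have sz: "size A = Suc m" by simp
    have "coeff (\<Prod>x\<in>#A. [:-x, 1:] :: 'a poly) (Suc m) = 1"
      using lead_coeff_prod_linear[of A] by (simp add: sz)
    with add.IH[OF sz] Suc show ?thesis by simp
  qed
qed simp

lemma poly_prod_linear: "poly (\<Prod>x\<in>#A. [:-x, 1:]) z = (\<Prod>x\<in>#A. z - (x :: 'a :: idom))"
  by (induction A) (simp_all add: algebra_simps)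

lemma sum_proots_coeff:
  fixes p :: "complex poly"
  assumes "degree p = Suc n"
  shows "coeff p n = - lead_coeff p * \<Sum>\<^sub># (proots p)"
proof -
  have "coeff p n = lead_coeff p * coeff (\<Prod>x\<in>#proots p. [:-x, 1:]) n"
    by (subst (1) complex_poly_decompose_multiset [of p, symmetric]) simp
  also have "coeff (\<Prod>x\<in>#proots p. [:-x, 1:]) n = - \<Sum>\<^sub># (proots p)"
    by (rule coeff_prod_linear_second) (simp add: assms size_proots_complex)
  finally show ?thesis by simp
qed

text \<open>The factorisation into linear factors is real. This brings complex solutions back to
  real polynomials.\<close>

lemma real_rooted_complex_poly:
  fixes p :: "complex poly"
  assumes "lead_coeff p \<in> \<real>" "\<And>z. poly p z = 0 \<Longrightarrow> Im z = 0"
  obtains q where "p = cpoly q"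
proof -
  obtain c where c: "lead_coeff p = of_real c" using assms(1) by (auto elim: Reals_cases)
  have "\<exists>q. (\<Prod>x\<in>#A. [:-x, 1:]) = cpoly q" if "\<forall>z\<in>#A. Im z = 0" for A :: "complex multiset"
    using that
  proof (induction A)
    case empty
    show ?case by (rule exI[of _ 1]) simp
  next
    case (add z A)
    then obtain q where q: "(\<Prod>x\<in>#A. [:-x, 1:]) = cpoly q" by auto
    have "of_real (Re z) = z" using add.prems by (simp add: complex_eq_iff)
    hence "(\<Prod>x\<in>#add_mset z A. [:-x, 1:]) = cpoly ([:-Re z, 1:] * q)"
      unfolding cpoly_mult by (simp add: q)
    thus ?case by blast
  qed
  moreover have "\<forall>z\<in>#proots p. Im z = 0" using assms(2) by (cases "p = 0") auto
  ultimately obtain q where "(\<Prod>x\<in>#proots p. [:-x, 1:]) = cpoly q" by blast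
  hence "p = cpoly (smult c q)"
    using complex_poly_decompose_multiset[of p] c by (simp add: cpoly_smult)
  thus ?thesis by (rule that)
qed

section \<open>Root counts and interlacing\<close>

text \<open>The argument, with values in (0, pi), of a point of the open upper half-plane. It is
  written through the cotangent so that continuity and the limits at the real axis are those of
  \<open>arctan\<close>.\<close>

definition ang :: "complex \<Rightarrow> real" where
  "ang z = pi / 2 - arctan (Re z / Im z)"

text \<open>A continuous branch of the argument of the product of the factors \<open>z - a\<close>;
  being a sum, it is not reduced modulo 2 pi.\<close>

definition angs :: "real multiset \<Rightarrow> complex \<Rightarrow> real" where
  "angs A z = (\<Sum>a\<in>#A. ang (z - of_real a))"

lemma cis_ang: "Im z > 0 \<Longrightarrow> of_real (cmod z) * cis (ang z) = z"
  using Arg2pi_eq[of z] by (simp add: ang_def Arg2pi_arctan_upperhalf cis_conv_exp)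

lemma continuous_on_angs: "continuous_on {z. Im z > 0} (angs A)"
proof (induction A)
  case empty
  show ?case by (simp add: angs_def)
next
  case (add a A)
  have "continuous_on {z. Im z > 0} (\<lambda>z. ang (z - of_real a))"
    unfolding ang_def by (intro continuous_intros) auto
  with add have "continuous_on {z. Im z > 0} (\<lambda>z. ang (z - of_real a) + angs A z)"
    by (intro continuous_intros)
  thus ?case by (simp add: angs_def)
qed

lemma prod_eq_cis_angs:
  assumes "Im z > 0"
  shows "\<exists>c>0. (\<Prod>a\<in>#A. z - complex_of_real a) = of_real c * cis (angs A z)"
proof (induction A)
  case empty
  show ?case by (rule exI[of _ 1]) (simp add: angs_def)
next
  case (add a A)
  then obtain c where c: "c > 0" "(\<Prod>a\<in>#A. z - complex_of_real a) = of_real c * cis (angs A z)"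
    by blast
  have "Im (z - of_real a) > 0" using assms by simp
  note a = cis_ang[OF this]
  have "cis (angs (add_mset a A) z) = cis (ang (z - of_real a)) * cis (angs A z)"
    by (simp add: angs_def cis_mult)
  hence "(\<Prod>a\<in>#add_mset a A. z - complex_of_real a)
    = of_real (cmod (z - of_real a) * c) * cis (angs (add_mset a A) z)"
    using c(2) by (simp add: mult_ac) (metis a mult.commute mult.left_commute)
  moreover have "cmod (z - of_real a) * c > 0" using c assms by (auto simp: complex_eq_iff)
  ultimately show ?case by blast
qed

lemma ang_tendsto:
  assumes "x \<noteq> a"
  shows "((\<lambda>e. ang (Complex x e - of_real a)) \<longlongrightarrow> (if x < a then pi else 0)) (at_right 0)"
proof (cases "x < a")
  case True
  have "LIM e at_right (0::real). (x - a) * inverse e :> at_bot"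
    by (rule filterlim_tendsto_neg_mult_at_bot[OF tendsto_const _ filterlim_inverse_at_top_right])
      (use True in simp)
  hence "((\<lambda>e. arctan ((x - a) * inverse e)) \<longlongrightarrow> - (pi/2)) (at_right 0)"
    by (rule filterlim_compose[OF tendsto_arctan_at_bot])
  hence "((\<lambda>e. pi / 2 - arctan ((x - a) * inverse e)) \<longlongrightarrow> pi/2 - (-(pi/2))) (at_right 0)"
    by (intro tendsto_intros)
  with True show ?thesis by (simp add: ang_def field_simps)
next
  case False
  have "LIM e at_right (0::real). (x - a) * inverse e :> at_top"
    by (rule filterlim_tendsto_pos_mult_at_top[OF tendsto_const _ filterlim_inverse_at_top_right])
      (use False assms in simp)
  hence "((\<lambda>e. arctan ((x - a) * inverse e)) \<longlongrightarrow> pi/2) (at_right 0)"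
    by (rule filterlim_compose[OF tendsto_arctan_at_top])
  hence "((\<lambda>e. pi / 2 - arctan ((x - a) * inverse e)) \<longlongrightarrow> pi/2 - pi/2) (at_right 0)"
    by (intro tendsto_intros)
  with False show ?thesis by (simp add: ang_def field_simps)
qed

lemma angs_tendsto:
  assumes "x \<notin># A"
  shows "((\<lambda>e. angs A (Complex x e)) \<longlongrightarrow> pi * real (size {#a \<in># A. x < a#})) (at_right 0)"
  using assms
proof (induction A)
  case empty
  show ?case by (simp add: angs_def)
next
  case (add a A)
  have "((\<lambda>e. ang (Complex x e - of_real a) + angs A (Complex x e)) \<longlongrightarrow>
      (if x < a then pi else 0) + pi * real (size {#a \<in># A. x < a#})) (at_right 0)"
    using add by (intro tendsto_add ang_tendsto) auto
  thus ?case by (simp add: angs_def algebra_simps split: if_splits)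
qed

text \<open>By \<open>angs_tendsto\<close>, pi times this count is the boundary value at
  \<open>x\<close> of the continuous argument \<open>angs (proots p)\<close>, for \<open>x\<close>
  off the zeros.\<close>

definition rcount :: "real poly \<Rightarrow> real \<Rightarrow> nat" where
  "rcount p x = size {#a \<in># proots p. x < a#}"

lemma rcount_eq_0_iff: "p \<noteq> 0 \<Longrightarrow> rcount p x = 0 \<longleftrightarrow> (\<forall>a. poly p a = 0 \<longrightarrow> a \<le> x)"
  unfolding rcount_def size_eq_0_iff_empty filter_mset_eq_conv by (auto simp: not_less)

lemma rcount_le_degree: "rcount p x \<le> degree p"
  unfolding rcount_def
  using size_filter_mset_lesseq[of "\<lambda>a. x < a" "proots p"] size_proots_le[of p] by linarith

lemma rcount_eq_degree_iff:
  assumes "hyperbolic p"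
  shows "rcount p x = degree p \<longleftrightarrow> (\<forall>a. poly p a = 0 \<longrightarrow> x < a)"
proof -
  have "rcount p x = degree p \<longleftrightarrow> size {#a \<in># proots p. x < a#} = size (proots p)"
    by (simp add: rcount_def size_proots_hyperbolic[OF assms])
  also have "\<dots> \<longleftrightarrow> {#a \<in># proots p. x < a#} = proots p"
    by (metis multiset_filter_subset subset_mset.less_le mset_subset_size nat_neq_iff)
  also have "\<dots> \<longleftrightarrow> (\<forall>a. poly p a = 0 \<longrightarrow> x < a)"
    using hyperbolic_nonzero[OF assms] by (auto simp: filter_mset_eq_conv)
  finally show ?thesis .
qed

text \<open>Counting the zeros strictly to the right is right-continuous, so a small step to the
  right avoids all zeros and keeps both counts.\<close>

lemma rcount_right:
  assumes "p \<noteq> 0" "q \<noteq> 0"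
  obtains y where "x < y" "y \<notin># proots p" "y \<notin># proots q"
    "rcount p y = rcount p x" "rcount q y = rcount q x"
proof -
  define R where "R = {a. poly (p * q) a = 0 \<and> x < a}"
  have fin: "finite R" unfolding R_def using poly_roots_finite[of "p * q"] assms
    by (auto intro: finite_subset[of _ "{a. poly (p * q) a = 0}"])
  obtain y where y: "x < y" "\<forall>a\<in>R. y < a"
  proof (cases "R = {}")
    case True
    thus ?thesis using that[of "x + 1"] by simp
  next
    case False
    hence "Min R \<in> R" using fin by simp
    hence "x < Min R" by (simp add: R_def)
    then obtain y where "x < y" "y < Min R" using dense by blast
    thus ?thesis using that[of y] fin False by auto
  qed
  have eq: "(y < a) = (x < a)" if "poly p a = 0 \<or> poly q a = 0" for a
    using y that by (auto simp: R_def)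
  have "rcount p y = rcount p x" "rcount q y = rcount q x"
    unfolding rcount_def using assms eq
    by (auto intro!: arg_cong[where f = size] filter_mset_cong)
  moreover have "y \<notin># proots p" "y \<notin># proots q" using y assms by (auto simp: R_def)
  ultimately show ?thesis using that y by blast
qed

text \<open>A small step to the left of \<open>x\<close> adds to the count exactly the zeros at
  \<open>x\<close>.\<close>

lemma rcount_left:
  assumes "p \<noteq> 0" "q \<noteq> 0"
  obtains y where "rcount p y = rcount p x + order x p" "rcount q y = rcount q x + order x q"
proof -
  define R where "R = {a. poly (p * q) a = 0 \<and> a < x}"
  have fin: "finite R" unfolding R_def using poly_roots_finite[of "p * q"] assms
    by (auto intro: finite_subset[of _ "{a. poly (p * q) a = 0}"])
  obtain y where y: "y < x" "\<forall>a\<in>R. a < y"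
  proof (cases "R = {}")
    case True
    thus ?thesis using that[of "x - 1"] by simp
  next
    case False
    hence "Max R \<in> R" using fin by simp
    hence "Max R < x" by (simp add: R_def)
    then obtain y where "y < x" "Max R < y" using dense by blast
    thus ?thesis using that[of y] fin False by auto
  qed
  have eq: "(y < a) = (x < a \<or> a = x)" if "poly p a = 0 \<or> poly q a = 0" for a
    using y that by (auto simp: R_def)
  have *: "rcount s y = rcount s x + order x s" if s: "s \<noteq> 0" "\<And>a. poly s a = 0 \<Longrightarrow> poly p a = 0 \<or> poly q a = 0" for s
  proof -
    have "{#a \<in># proots s. y < a#} = {#a \<in># proots s. x < a#} + {#a \<in># proots s. a = x#}"
      by (rule multiset_eqI) (use s eq in \<open>auto simp: order_root\<close>)
    thus ?thesis using s by (simp add: rcount_def filter_eq_replicate_mset)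
  qed
  show ?thesis by (rule that[of y]) (use * assms in auto)
qed

lemma poly_cpoly_hyperbolic:
  assumes "hyperbolic p"
  shows "poly (cpoly p) z = of_real (lead_coeff p) * (\<Prod>a\<in>#proots p. z - of_real a)"
proof -
  have "poly (cpoly p) z = of_real (lead_coeff p) * (\<Prod>x\<in>#proots (cpoly p). z - x)"
    by (subst complex_poly_decompose_multiset [of "cpoly p", symmetric])
       (simp add: poly_prod_linear)
  thus ?thesis by (simp add: proots_cpoly[OF assms] image_mset.compositionality o_def)
qed

text \<open>The argument of \<open>q/p\<close> is continuous on the upper half-plane and avoids the multiples
  of \<open>\<pi>\<close>, while its boundary value at \<open>x\<close> is \<open>\<pi>\<close> times the difference of the root counts.\<close>

lemma rcount_interlace:
  assumes p: "hyperbolic p" and q: "hyperbolic q"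
    and nz: "\<And>z. Im z > 0 \<Longrightarrow> Im (poly (cpoly q) z * cnj (poly (cpoly p) z)) \<noteq> 0"
  obtains k :: int where "\<And>x. k \<le> int (rcount q x) - int (rcount p x)"
    "\<And>x. int (rcount q x) - int (rcount p x) \<le> k + 1"
    "\<And>z. k = 0 \<Longrightarrow> Im z > 0 \<Longrightarrow>
       lead_coeff p * lead_coeff q * Im (poly (cpoly q) z * cnj (poly (cpoly p) z)) > 0"
proof -
  define U where "U = {z. Im z > 0}"
  define \<Theta> where "\<Theta> z = angs (proots q) z - angs (proots p) z" for z
  \<comment> \<open>The upper half-plane is connected and \<open>\<Theta>\<close> misses every
    multiple of pi, so the strip found at the sample point \<i> is valid everywhere.\<close>
  define k where "k = \<lfloor>\<Theta> \<i> / pi\<rfloor>"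
  have nonzero: "p \<noteq> 0" "q \<noteq> 0" using p q by (auto dest: hyperbolic_nonzero)
  have polar: "\<exists>c>0. Im (poly (cpoly q) z * cnj (poly (cpoly p) z)) =
      lead_coeff p * lead_coeff q * (c * sin (\<Theta> z))" if im: "Im z > 0" for z
  proof -
    obtain c where c: "c > 0" "(\<Prod>a\<in>#proots p. z - complex_of_real a) = of_real c * cis (angs (proots p) z)"
      using prod_eq_cis_angs[OF im] by blast
    obtain d where d: "d > 0" "(\<Prod>a\<in>#proots q. z - complex_of_real a) = of_real d * cis (angs (proots q) z)"
      using prod_eq_cis_angs[OF im] by blast
    have "poly (cpoly q) z * cnj (poly (cpoly p) z) =
        of_real (lead_coeff p * lead_coeff q * (c * d)) * (cis (angs (proots q) z) * cis (- angs (proots p) z))"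
      unfolding poly_cpoly_hyperbolic[OF p] poly_cpoly_hyperbolic[OF q] c(2) d(2) by (simp add: cis_cnj)
    also have "cis (angs (proots q) z) * cis (- angs (proots p) z) = cis (\<Theta> z)"
      by (simp add: cis_mult \<Theta>_def)
    finally have "Im (poly (cpoly q) z * cnj (poly (cpoly p) z)) = lead_coeff p * lead_coeff q * (c * d) * sin (\<Theta> z)"
      by (simp add: Im_complex_of_real)
    with c d show ?thesis by (intro exI[of _ "c * d"]) (auto simp: mult_ac)
  qed
  have avoid: "\<Theta> z \<noteq> of_int j * pi" if "Im z > 0" for z j
  proof
    assume "\<Theta> z = of_int j * pi"
    hence "sin (\<Theta> z) = 0" by (simp add: sin_zero_iff_int2)
    with polar[OF that] nz[OF that] show False by auto
  qed
  have "continuous_on U \<Theta>"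
    unfolding U_def \<Theta>_def by (intro continuous_intros continuous_on_angs)
  moreover have "connected U" unfolding U_def
    by (intro convex_connected convex_halfspace_Im_gt)
  ultimately have conn: "connected (\<Theta> ` U)" by (rule connected_continuous_image)
  have range: "of_int k * pi < \<Theta> z \<and> \<Theta> z < of_int (k + 1) * pi" if z: "Im z > 0" for z
  proof (rule ccontr)
    assume neg: "\<not> (of_int k * pi < \<Theta> z \<and> \<Theta> z < of_int (k + 1) * pi)"
    have "\<i> \<in> U" "z \<in> U" using z by (auto simp: U_def)
    have i: "of_int k * pi \<le> \<Theta> \<i>" "\<Theta> \<i> \<le> of_int (k + 1) * pi"
      unfolding k_def using pi_gt_zero
      by (simp_all flip: pos_le_divide_eq pos_divide_le_eq)
    have "\<exists>j. of_int j * pi \<in> \<Theta> ` U"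
    proof (cases "\<Theta> z \<le> of_int k * pi")
      case True
      have "{\<Theta> z..\<Theta> \<i>} \<subseteq> \<Theta> ` U"
        using conn \<open>\<i> \<in> U\<close> \<open>z \<in> U\<close> by (intro connected_contains_Icc) auto
      moreover have "of_int k * pi \<in> {\<Theta> z..\<Theta> \<i>}" using True i by auto
      ultimately show ?thesis by blast
    next
      case False
      have "{\<Theta> \<i>..\<Theta> z} \<subseteq> \<Theta> ` U"
        using conn \<open>\<i> \<in> U\<close> \<open>z \<in> U\<close> by (intro connected_contains_Icc) auto
      moreover have "of_int (k + 1) * pi \<in> {\<Theta> \<i>..\<Theta> z}" using False neg i by auto
      ultimately show ?thesis by blast
    qed
    with avoid show False unfolding U_def by (metis imageE mem_Collect_eq)
  qed
  have bd: "k \<le> int (rcount q x) - int (rcount p x) \<and> int (rcount q x) - int (rcount p x) \<le> k + 1"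
    if x: "x \<notin># proots p" "x \<notin># proots q" for x
  proof -
    let ?L = "pi * real (rcount q x) - pi * real (rcount p x)"
    have lim: "((\<lambda>e. \<Theta> (Complex x e)) \<longlongrightarrow> ?L) (at_right 0)"
      unfolding \<Theta>_def rcount_def using x by (intro tendsto_diff angs_tendsto)
    have ev: "eventually (\<lambda>e. of_int k * pi \<le> \<Theta> (Complex x e)) (at_right 0)"
      "eventually (\<lambda>e. \<Theta> (Complex x e) \<le> of_int (k + 1) * pi) (at_right 0)"
      using range[THEN conjunct1, THEN less_imp_le] range[THEN conjunct2, THEN less_imp_le]
      by (auto simp: eventually_at_right_field intro!: exI[of _ 1])
    have "of_int k * pi \<le> ?L" by (rule tendsto_lowerbound[OF lim ev(1)]) simp
    moreover have "?L \<le> of_int (k + 1) * pi" by (rule tendsto_upperbound[OF lim ev(2)]) simp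
    moreover have "?L = of_int (int (rcount q x) - int (rcount p x)) * pi" by (simp add: algebra_simps)
    ultimately show ?thesis
      using pi_gt_zero by (simp only: mult_le_cancel_right_pos of_int_le_iff)
  qed
  have bd': "k \<le> int (rcount q x) - int (rcount p x) \<and> int (rcount q x) - int (rcount p x) \<le> k + 1" for x
  proof -
    obtain y where "y \<notin># proots p" "y \<notin># proots q" "rcount p y = rcount p x" "rcount q y = rcount q x"
      using rcount_right[OF nonzero] by metis
    with bd[of y] show ?thesis by simp
  qed
  have sign: "lead_coeff p * lead_coeff q * Im (poly (cpoly q) z * cnj (poly (cpoly p) z)) > 0"
    if k0: "k = 0" and im: "Im z > 0" for z
  proof -
    obtain c where c: "c > 0" "Im (poly (cpoly q) z * cnj (poly (cpoly p) z)) =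
      lead_coeff p * lead_coeff q * (c * sin (\<Theta> z))" using polar[OF im] by blast
    have "sin (\<Theta> z) > 0" using range[OF im] k0 by (intro sin_gt_zero) auto
    moreover have "lead_coeff p * lead_coeff q \<noteq> 0" using nonzero by simp
    hence "(lead_coeff p * lead_coeff q) * (lead_coeff p * lead_coeff q) > 0"
      using not_real_square_gt_zero by blast
    ultimately show ?thesis using c by (simp add: mult.assoc[symmetric])
  qed
  show ?thesis by (rule that[of k]) (use bd' sign in auto)
qed

text \<open>The difference of the root counts takes only the values \<open>k\<close> and
  \<open>k + 1\<close>, and on passing \<open>x\<close> from right to left it changes by the
  difference of the two multiplicities.\<close>

lemma order_interlace:
  assumes p: "hyperbolic p" and q: "hyperbolic q"
    and nz: "\<And>z. Im z > 0 \<Longrightarrow> Im (poly (cpoly q) z * cnj (poly (cpoly p) z)) \<noteq> 0"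
  shows "order x p \<le> order x q + 1"
proof -
  obtain k :: int where k: "\<And>x. k \<le> int (rcount q x) - int (rcount p x)"
    "\<And>x. int (rcount q x) - int (rcount p x) \<le> k + 1"
    using rcount_interlace[OF assms] by metis
  have "p \<noteq> 0" "q \<noteq> 0" using p q by (auto dest: hyperbolic_nonzero)
  then obtain y where "rcount p y = rcount p x + order x p" "rcount q y = rcount q x + order x q"
    by (rule rcount_left)
  with k[of x] k[of y] show ?thesis by linarith
qed

section \<open>Sorted lists of zeros\<close>

definition rts :: "real poly \<Rightarrow> real list" where
  "rts p = sorted_list_of_multiset (proots p)"

lemma sorted_rts [simp]: "sorted (rts p)"
  by (simp add: rts_def)

lemma mset_rts [simp]: "mset (rts p) = proots p"
  by (simp add: rts_def)

lemma length_rts: "hyperbolic p \<Longrightarrow> length (rts p) = degree p"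
  by (metis mset_rts size_mset size_proots_hyperbolic)

lemma set_rts: "p \<noteq> 0 \<Longrightarrow> set (rts p) = {x. poly p x = 0}"
  by (metis mset_rts set_mset_mset set_count_proots)

lemma sum_list_rts: "sum_list (rts p) = \<Sum>\<^sub># (proots p)"
  by (metis mset_rts sum_mset_sum_list)

lemma rcount_rts: "rcount p x = length (filter (\<lambda>a. x < a) (rts p))"
  unfolding rcount_def by (metis mset_filter mset_rts size_mset)

text \<open>If the \<open>i\<close>-th zero \<open>x\<close> of \<open>q\<close> were smaller than
  that of \<open>p\<close>, at least \<open>length (rts p) - i\<close> zeros of \<open>p\<close>
  would exceed \<open>x\<close>, but at most one fewer of \<open>q\<close>.\<close>

lemma rts_mono_of_rcount:
  assumes "length (rts p) = length (rts q)" "\<And>x. rcount p x \<le> rcount q x" "i < length (rts p)"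
  shows "rts p ! i \<le> rts q ! i"
proof (rule ccontr)
  define x where "x = rts q ! i"
  assume "\<not> ?thesis"
  hence less: "x < rts p ! i" by (simp add: x_def)
  have "length (rts p) - i \<le> length (filter (\<lambda>a. x < a) (rts p))"
  proof -
    have "x < drop i (rts p) ! j" if "j < length (rts p) - i" for j
    proof -
      have "rts p ! i \<le> rts p ! (i + j)"
        using that by (intro sorted_nth_mono) auto
      with less that assms(3) show ?thesis by simp
    qed
    hence "\<forall>a\<in>set (drop i (rts p)). x < a" by (auto simp: in_set_conv_nth)
    hence "filter (\<lambda>a. x < a) (drop i (rts p)) = drop i (rts p)" by simp
    hence "filter (\<lambda>a. x < a) (rts p) = filter (\<lambda>a. x < a) (take i (rts p)) @ drop i (rts p)"
      by (metis append_take_drop_id filter_append)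
    thus ?thesis by simp
  qed
  moreover have "length (filter (\<lambda>a. x < a) (rts q)) \<le> length (rts q) - Suc i"
  proof -
    have "\<forall>a\<in>set (take (Suc i) (rts q)). \<not> x < a"
      using assms(1,3) sorted_rts[of q]
      by (auto simp: in_set_conv_nth x_def not_less intro!: sorted_nth_mono)
    hence "filter (\<lambda>a. x < a) (take (Suc i) (rts q)) = []" by (simp add: filter_empty_conv)
    hence "filter (\<lambda>a. x < a) (rts q) = filter (\<lambda>a. x < a) (drop (Suc i) (rts q))"
      by (metis append_take_drop_id filter_append append_Nil)
    thus ?thesis by (metis length_drop length_filter_le)
  qed
  ultimately show False using assms(1,3) assms(2)[of x] by (simp add: rcount_rts)
qed

text \<open>Beyond all zeros both counts are 0, so \<open>k\<close> is 0 or -1: the zeros of one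
  polynomial dominate those of the other. Interlacing leaves the direction open; the sums decide
  it.\<close>

lemma rts_compare:
  assumes p: "hyperbolic p" and q: "hyperbolic q" and deg: "degree p = degree q"
    and nz: "\<And>z. Im z > 0 \<Longrightarrow> Im (poly (cpoly q) z * cnj (poly (cpoly p) z)) \<noteq> 0"
    and sum: "sum_list (rts p) \<le> sum_list (rts q)" and i: "i < degree p"
  shows "rts p ! i \<le> rts q ! i"
proof -
  obtain k :: int where k: "\<And>x. k \<le> int (rcount q x) - int (rcount p x)"
    "\<And>x. int (rcount q x) - int (rcount p x) \<le> k + 1"
    using rcount_interlace[OF p q nz] by metis
  have nonzero: "p \<noteq> 0" "q \<noteq> 0" using p q by (auto dest: hyperbolic_nonzero)
  have len: "length (rts p) = degree p" "length (rts q) = degree p"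
    using p q deg by (simp_all add: length_rts)
  have "finite {a. poly (p * q) a = 0}" using nonzero by (intro poly_roots_finite) simp
  then obtain b where b: "\<And>a. poly (p * q) a = 0 \<Longrightarrow> a \<le> b"
    by (metis (mono_tags) bdd_above_finite bdd_above_def mem_Collect_eq)
  have "rcount p b = 0" "rcount q b = 0"
    using b nonzero by (auto simp: rcount_eq_0_iff)
  with k[of b] have "k \<le> 0" "0 \<le> k + 1" by auto
  then consider "k = 0" | "k = -1" by linarith
  thus ?thesis
  proof cases
    case 1
    hence "rcount p x \<le> rcount q x" for x using k(1)[of x] by simp
    thus ?thesis using len i by (intro rts_mono_of_rcount) auto
  next
    case 2
    hence "rcount q x \<le> rcount p x" for x using k(2)[of x] by simp
    hence le: "rts q ! j \<le> rts p ! j" if "j < degree p" for j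
      using len that by (intro rts_mono_of_rcount) auto
    \<comment> \<open>The termwise order is opposite to the order of the sums, so all terms
      agree.\<close>
    have "(\<Sum>j<degree p. rts p ! j) \<le> (\<Sum>j<degree p. rts q ! j)"
      using sum len by (simp add: sum_list_sum_nth atLeast0LessThan)
    with le have "\<forall>j\<in>{..<degree p}. rts p ! j = rts q ! j"
      by (smt (verit) finite_lessThan i lessThan_iff sum_mono sum_strict_mono_ex1)
    with i show ?thesis by simp
  qed
qed

section \<open>The operator and the sum of the zeros\<close>

lemma coeff_mult_of_degree_le:
  fixes p q :: "'a :: comm_semiring_0 poly"
  assumes "degree p \<le> a" "degree q \<le> b"
  shows "coeff (p * q) (a + b) = coeff p a * coeff q b"
proof -
  have "coeff (p * q) (a + b) = (\<Sum>i\<le>a + b. coeff p i * coeff q (a + b - i))"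
    by (rule coeff_mult)
  also have "\<dots> = (\<Sum>i\<in>{a}. coeff p i * coeff q (a + b - i))"
  proof (rule sum.mono_neutral_right)
    show "\<forall>i\<in>{..a + b} - {a}. coeff p i * coeff q (a + b - i) = 0"
    proof
      fix i assume "i \<in> {..a + b} - {a}"
      hence "i > a \<or> a + b - i > b" by auto
      thus "coeff p i * coeff q (a + b - i) = 0"
        using assms by (auto simp: coeff_eq_0)
    qed
  qed auto
  finally show ?thesis by simp
qed

lemma coeff_higher_pderiv_binomial:
  "coeff ((pderiv ^^ k) f) j = of_nat (fact k * ((j + k) choose k)) * coeff f (j + k)"
proof -
  have "fact j * pochhammer (Suc j) k = (fact (j + k) :: nat)"
    using pochhammer_product[of j "j + k" "1 :: nat"] by (simp add: pochhammer_fact)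
  also have "\<dots> = fact j * (fact k * ((j + k) choose k))"
    using binomial_fact_lemma[of k "j + k"] by (simp add: mult_ac)
  finally have "pochhammer (Suc j) k = fact k * ((j + k) choose k)" by simp
  thus ?thesis by (simp only: coeff_higher_pderiv pochhammer_of_nat)
qed

lemma higher_pderiv_eq_0: "degree f < k \<Longrightarrow> (pderiv ^^ k) f = 0"
  by (simp add: poly_eq_iff coeff_higher_pderiv coeff_eq_0)

lemma diff_op_add: "diff_op N Q (f + g) = diff_op N Q f + diff_op N Q g"
  by (simp add: diff_op_def higher_pderiv_add algebra_simps sum.distrib)

lemma diff_op_smult: "diff_op N Q (smult c f) = smult c (diff_op N Q f)"
  by (simp add: diff_op_def higher_pderiv_smult poly_eq_iff coeff_sum sum_distrib_left)

lemma diff_op_0 [simp]: "diff_op N Q 0 = 0"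
  by (simp add: diff_op_def)

lemma diff_op_diff: "diff_op N Q (f - g) = diff_op N Q f - diff_op N Q g"
  using diff_op_add[of N Q f "smult (-1) g"] by (simp only: diff_op_smult) simp

lemma cdiff_op_cpoly: "cdiff_op N Q (cpoly f) = cpoly (diff_op N Q f)"
  by (simp add: cdiff_op_def diff_op_def cpoly_sum cpoly_mult cpoly_higher_pderiv)

lemma coeff_diff_op:
  assumes Q: "\<And>k. k \<le> N \<Longrightarrow> degree (Q k) \<le> k + r" and f: "degree f \<le> m"
  shows "coeff (diff_op N Q f) (m + r) =
    (\<Sum>k\<le>N. coeff (Q k) (k + r) * of_nat (fact k * (m choose k))) * coeff f m"
    and "degree (diff_op N Q f) \<le> m + r"
proof -
  have 1: "coeff (Q k * (pderiv ^^ k) f) (m + r) = coeff (Q k) (k + r) * of_nat (fact k * (m choose k)) * coeff f m"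
    and 2: "degree (Q k * (pderiv ^^ k) f) \<le> m + r" if k: "k \<le> N" for k
  proof -
    show "coeff (Q k * (pderiv ^^ k) f) (m + r) = coeff (Q k) (k + r) * of_nat (fact k * (m choose k)) * coeff f m"
    proof (cases "k \<le> m")
      case True
      have "degree ((pderiv ^^ k) f) \<le> m - k"
        using f by (intro degree_le) (auto simp: coeff_higher_pderiv coeff_eq_0)
      from coeff_mult_of_degree_le[OF Q[OF k] this] True show ?thesis
        by (simp add: coeff_higher_pderiv_binomial ac_simps)
    next
      case False
      hence "(pderiv ^^ k) f = 0" using f by (intro higher_pderiv_eq_0) auto
      with False show ?thesis by (simp add: binomial_eq_0)
    qed
    show "degree (Q k * (pderiv ^^ k) f) \<le> m + r"
    proof (cases "k \<le> m")
      case True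
      have "degree ((pderiv ^^ k) f) \<le> m - k"
        using f by (intro degree_le) (auto simp: coeff_higher_pderiv coeff_eq_0)
      thus ?thesis using Q[OF k] degree_mult_le[of "Q k" "(pderiv ^^ k) f"] True by linarith
    next
      case False
      hence "(pderiv ^^ k) f = 0" using f by (intro higher_pderiv_eq_0) auto
      thus ?thesis by simp
    qed
  qed
  show "coeff (diff_op N Q f) (m + r) =
    (\<Sum>k\<le>N. coeff (Q k) (k + r) * of_nat (fact k * (m choose k))) * coeff f m"
    unfolding diff_op_def coeff_sum sum_distrib_right by (intro sum.cong refl 1) simp
  show "degree (diff_op N Q f) \<le> m + r"
    unfolding diff_op_def by (intro degree_sum_le 2) auto
qed

text \<open>The Fuchs index \<open>r\<close> and non-degeneracy are recorded as a bound on all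
  degrees that is attained at \<open>N\<close>. Whether the bound is attained at smaller indices is
  settled only in \<open>degree_Q\<close>.\<close>

locale hyperbolic_operator =
  fixes N r :: nat and Q :: "nat \<Rightarrow> real poly"
  assumes N_pos: "N \<ge> 1"
    and preserves: "preserves_hyperbolicity (diff_op N Q)"
    and degree_Q_le: "k \<le> N \<Longrightarrow> degree (Q k) \<le> k + r"
    and Q_N_nonzero: "Q N \<noteq> 0"
    and degree_Q_N: "degree (Q N) = N + r"
begin

abbreviation T where "T \<equiv> diff_op N Q"
abbreviation cT where "cT \<equiv> cdiff_op N Q"

text \<open>Taken at the maximal possible degree, so it is 0 when the degree of \<open>Q k\<close>
  is smaller.\<close>

definition top_coeff :: "nat \<Rightarrow> real" where
  "top_coeff k = coeff (Q k) (k + r)"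

text \<open>The k-th derivative of x^m has the coefficient \<open>fact k * (m choose k)\<close>, so
  \<open>lam m\<close> is the coefficient of x^(m+r) in the image of x^m.\<close>

definition lam :: "nat \<Rightarrow> real" where
  "lam m = (\<Sum>k\<le>N. top_coeff k * real (fact k * (m choose k)))"

text \<open>The constant term of the affine law for the sum of the zeros; the sign and the division
  by \<open>lam\<close> come from Vieta's formula.\<close>

definition shift :: "nat \<Rightarrow> real" where
  "shift m = - coeff (T (monom 1 (Suc m))) (m + r) / lam (Suc m)"

lemma T_hyperbolic: "hyperbolic f \<Longrightarrow> T f \<noteq> 0 \<Longrightarrow> hyperbolic (T f)"
  using preserves by (auto simp: preserves_hyperbolicity_def)

lemma top_N_nonzero: "top_coeff N \<noteq> 0"
  unfolding top_coeff_def using Q_N_nonzero by (simp flip: degree_Q_N)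

lemma degree_T_le: "degree f \<le> m \<Longrightarrow> degree (T f) \<le> m + r"
  and coeff_T: "degree f \<le> m \<Longrightarrow> coeff (T f) (m + r) = lam m * coeff f m"
  using coeff_diff_op[of N Q r f m] degree_Q_le by (simp_all add: lam_def top_coeff_def)

lemma degree_cT_le: "degree f \<le> m \<Longrightarrow> degree (cT f) \<le> m + r"
  and coeff_cT: "degree f \<le> m \<Longrightarrow> coeff (cT f) (m + r) = of_real (lam m) * coeff f m"
  using coeff_diff_op[of N "\<lambda>k. cpoly (Q k)" r f m] degree_Q_le
  by (simp_all add: lam_def top_coeff_def cdiff_op_def)

lemma degree_T: "f \<noteq> 0 \<Longrightarrow> lam (degree f) \<noteq> 0 \<Longrightarrow> degree (T f) = degree f + r"
  and lead_coeff_T: "f \<noteq> 0 \<Longrightarrow> lam (degree f) \<noteq> 0 \<Longrightarrow> lead_coeff (T f) = lam (degree f) * lead_coeff f"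
proof -
  assume f: "f \<noteq> 0" "lam (degree f) \<noteq> 0"
  hence "coeff (T f) (degree f + r) \<noteq> 0" by (simp add: coeff_T)
  thus d: "degree (T f) = degree f + r"
    using degree_T_le[OF order_refl, of f] by (intro antisym le_degree)
  show "lead_coeff (T f) = lam (degree f) * lead_coeff f"
    unfolding d by (rule coeff_T) simp
qed

lemma degree_cT: "f \<noteq> 0 \<Longrightarrow> lam (degree f) \<noteq> 0 \<Longrightarrow> degree (cT f) = degree f + r"
  and lead_coeff_cT: "f \<noteq> 0 \<Longrightarrow> lam (degree f) \<noteq> 0 \<Longrightarrow> lead_coeff (cT f) = of_real (lam (degree f)) * lead_coeff f"
proof -
  assume f: "f \<noteq> 0" "lam (degree f) \<noteq> 0"
  hence "coeff (cT f) (degree f + r) \<noteq> 0" by (simp add: coeff_cT)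
  thus d: "degree (cT f) = degree f + r"
    using degree_cT_le[OF order_refl, of f] by (intro antisym le_degree)
  show "lead_coeff (cT f) = of_real (lam (degree f)) * lead_coeff f"
    unfolding d by (rule coeff_cT) simp
qed

lemma T_nonzero: "f \<noteq> 0 \<Longrightarrow> lam (degree f) \<noteq> 0 \<Longrightarrow> T f \<noteq> 0"
  using lead_coeff_T[of f] by auto

lemma cT_nonzero: "f \<noteq> 0 \<Longrightarrow> lam (degree f) \<noteq> 0 \<Longrightarrow> cT f \<noteq> 0"
  using lead_coeff_cT[of f] by auto

text \<open>Vieta's formula uses the two top coefficients of the image, which depend only on the two
  top coefficients of \<open>f\<close>: the monomial yields \<open>shift\<close>, and the rest, of
  degree at most \<open>m\<close>, yields the slope.\<close>

lemma sum_proots_cT: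
  fixes f :: "complex poly"
  assumes f: "lead_coeff f = 1" "degree f = Suc m" and lam: "lam (Suc m) \<noteq> 0"
  shows "\<Sum>\<^sub># (proots (cT f)) = of_real (lam m / lam (Suc m)) * \<Sum>\<^sub># (proots f) + of_real (shift m)"
proof -
  define g where "g = f - cpoly (monom 1 (Suc m))"
  have f0: "f \<noteq> 0" using f by auto
  have "degree g \<le> m"
  proof (rule degree_le, safe)
    fix i assume "m < i"
    show "coeff g i = 0"
    proof (cases "i = Suc m")
      case True
      thus ?thesis using f by (simp add: g_def)
    next
      case False
      with \<open>m < i\<close> show ?thesis using f by (simp add: g_def coeff_eq_0)
    qed
  qed
  hence "coeff (cT g) (m + r) = of_real (lam m) * coeff f m"
    by (subst coeff_cT) (auto simp: g_def)
  moreover have "cT f = cpoly (T (monom 1 (Suc m))) + cT g"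
    unfolding cdiff_op_cpoly[symmetric] unfolding cdiff_op_def diff_op_add[symmetric]
    by (simp add: g_def)
  ultimately have 1: "coeff (cT f) (m + r) = - of_real (shift m * lam (Suc m)) + of_real (lam m) * coeff f m"
    using lam by (simp add: shift_def)
  have "degree (cT f) = Suc (m + r)" using degree_cT[OF f0] lam f by simp
  from sum_proots_coeff[OF this]
  have "coeff (cT f) (m + r) = - of_real (lam (Suc m)) * \<Sum>\<^sub># (proots (cT f))"
    using lead_coeff_cT[OF f0] lam f by simp
  moreover have "coeff f m = - \<Sum>\<^sub># (proots f)"
    using sum_proots_coeff[OF f(2)] f by simp
  ultimately have "of_real (lam (Suc m)) * \<Sum>\<^sub># (proots (cT f)) =
      of_real (lam m) * \<Sum>\<^sub># (proots f) + of_real (lam (Suc m)) * of_real (shift m)"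
    using 1 by (simp add: algebra_simps)
  thus ?thesis using lam by (simp add: field_simps)
qed

lemma sum_proots_T:
  assumes f: "hyperbolic f" "lead_coeff f = 1" "degree f = Suc m" and lam: "lam (Suc m) \<noteq> 0"
  shows "\<Sum>\<^sub># (proots (T f)) = lam m / lam (Suc m) * \<Sum>\<^sub># (proots f) + shift m"
proof -
  have "T f \<noteq> 0" using f lam by (intro T_nonzero) (auto dest: hyperbolic_nonzero)
  hence Tf: "hyperbolic (T f)" using f by (intro T_hyperbolic)
  have of_real_sum: "\<Sum>\<^sub># (image_mset complex_of_real A) = of_real (\<Sum>\<^sub># A)" for A
    by (induction A) auto
  have "\<Sum>\<^sub># (proots (cT (cpoly f))) = of_real (lam m / lam (Suc m)) * \<Sum>\<^sub># (proots (cpoly f)) + of_real (shift m)"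
    by (rule sum_proots_cT) (use f lam in auto)
  hence "complex_of_real (\<Sum>\<^sub># (proots (T f))) =
      of_real (lam m / lam (Suc m) * \<Sum>\<^sub># (proots f) + shift m)"
    unfolding cdiff_op_cpoly proots_cpoly[OF f(1)] proots_cpoly[OF Tf] of_real_sum by simp
  thus ?thesis by (simp only: of_real_eq_iff)
qed

text \<open>As a function of \<open>m\<close>, \<open>lam\<close> is a combination of falling
  factorials, hence a polynomial of degree \<open>N\<close> with leading coefficient
  \<open>top_coeff N\<close>. No sign of a lower coefficient is known at this stage.\<close>

lemma lam_eventually_pos: "\<exists>m0. \<forall>m\<ge>m0. top_coeff N * lam m > 0"
proof -
  define ff :: "nat \<Rightarrow> real poly" where "ff k = (\<Prod>i<k. [:- real i, 1:])" for k
  have deg: "degree (ff k) = k" "lead_coeff (ff k) = 1" for k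
    unfolding ff_def lead_coeff_prod by (simp_all add: degree_prod_sum_eq)
  have val: "poly (ff k) (real m) = real (fact k * (m choose k))" for k m
    by (simp add: ff_def poly_prod binomial_gbinomial gbinomial_prod_rev atLeast0LessThan)
  define L where "L = (\<Sum>k\<le>N. smult (top_coeff k) (ff k))"
  have "degree L \<le> N" unfolding L_def
    by (intro degree_sum_le) (auto simp: deg intro: order_trans[OF degree_smult_le])
  moreover have c: "coeff L N = top_coeff N"
  proof -
    have "coeff (ff N) N = 1" using deg(2)[of N] by (simp only: deg(1))
    hence "coeff L N = (\<Sum>k\<le>N. if k = N then top_coeff N else 0)"
      unfolding L_def coeff_sum using deg(1) by (intro sum.cong refl) (auto simp: coeff_eq_0)
    thus ?thesis by simp
  qed
  ultimately have dL: "degree L = N" using top_N_nonzero by (metis antisym le_degree)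
  have "lead_coeff (smult (top_coeff N) L) > 0"
    using top_N_nonzero dL c by (auto simp: zero_less_mult_iff linorder_neq_iff)
  then obtain b where b: "\<forall>x\<ge>b. lead_coeff (smult (top_coeff N) L) \<le> poly (smult (top_coeff N) L) x"
    using poly_pinfty_gt_lc by blast
  have "poly L (real m) = lam m" for m
    unfolding L_def lam_def poly_sum poly_smult val ..
  hence "top_coeff N * lam m > 0" if "real m \<ge> b" for m
    using b that \<open>lead_coeff (smult (top_coeff N) L) > 0\<close> by (metis less_le_trans poly_smult)
  thus ?thesis by (intro exI[of _ "nat \<lceil>b\<rceil>"]) (auto simp: nat_ceiling_le_eq)
qed


text \<open>All real combinations of the real and imaginary parts of \<open>(x - y)\<^sup>m\<close> are hyperbolic, and
  \<open>T\<close> keeps them so. Hence the zeros of the image of \<open>(x - y)\<^sup>m\<close> lie on one side of the real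
  axis, and the sum of the zeros tells which one.\<close>

lemma cT_linear_power_nonzero:
  assumes y: "Im y \<le> 0" and lam: "lam j / lam (Suc j) > 0" and z: "Im z > 0"
  shows "poly (cT ([:-y, 1:] ^ Suc j)) z \<noteq> 0"
proof (cases "Im y = 0")
  case True
  hence "[:-y, 1:] = cpoly [:-Re y, 1:]" by (simp add: complex_eq_iff)
  hence eq: "cT ([:-y, 1:] ^ Suc j) = cpoly (T ([:-Re y, 1:] ^ Suc j))"
    by (simp only: cdiff_op_cpoly flip: cpoly_power)
  have "hyperbolic (T ([:-Re y, 1:] ^ Suc j))"
    by (intro T_hyperbolic hyperbolic_power T_nonzero) (use lam in \<open>auto simp: degree_power_eq simp del: power_Suc\<close>)
  with eq z hyperbolic_rootD show ?thesis by fastforce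
next
  case False
  with y have y: "Im y < 0" by simp
  define f where "f = [:-y, 1:] ^ Suc j"
  define g h where "g = map_poly Re f" and "h = map_poly Im f"
  define G H C where "G = T g" and "H = T h" and "C = cT f"
  define m where "m = Suc j"
  have f: "lead_coeff f = 1" "degree f = m"
    unfolding f_def m_def lead_coeff_power by (simp_all add: degree_power_eq del: power_Suc)
  have lam0: "lam m \<noteq> 0" using lam by (auto simp: m_def)
  have f0: "f \<noteq> 0" using f by auto
  have "C \<noteq> 0" unfolding C_def using f0 lam0 f by (intro cT_nonzero) auto
  have fgh: "f = cpoly g + smult \<i> (cpoly h)"
    by (simp add: poly_eq_iff g_def h_def coeff_map_poly complex_eq_iff)
  have "C = cpoly G + smult \<i> (cpoly H)"
    unfolding C_def G_def H_def cdiff_op_cpoly[symmetric] unfolding cdiff_op_def diff_op_smult[symmetric]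
      diff_op_add[symmetric] by (simp add: fgh)
  hence C: "poly C z = poly (cpoly G) z + \<i> * poly (cpoly H) z" for z by simp
  \<comment> \<open>At a zero \<open>z\<close> of the combination the moduli of \<open>f\<close> at
    \<open>z\<close> and \<open>cnj z\<close> agree. Both points are then equally far from the
    nonreal \<open>y\<close>, so \<open>z\<close> is real.\<close>
  have combo: "hyperbolic (smult \<alpha> g + smult \<beta> h) \<or> smult \<alpha> g + smult \<beta> h = 0"
    if ab: "\<alpha> \<noteq> 0 \<or> \<beta> \<noteq> 0" for \<alpha> \<beta>
  proof -
    have "Im z = 0" if "poly (cpoly (smult \<alpha> g + smult \<beta> h)) z = 0" for z
    proof -
      have fz: "poly f z = poly (cpoly g) z + \<i> * poly (cpoly h) z"
        "cnj (poly f (cnj z)) = poly (cpoly g) z - \<i> * poly (cpoly h) z"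
        by (simp_all add: fgh cnj_poly_cpoly)
      have "(of_real \<alpha> - \<i> * of_real \<beta>) * poly f z + (of_real \<alpha> + \<i> * of_real \<beta>) * cnj (poly f (cnj z))
          = 2 * (of_real \<alpha> * poly (cpoly g) z + of_real \<beta> * poly (cpoly h) z)"
        unfolding fz by (simp add: algebra_simps)
      also have "\<dots> = 0" using that by (simp add: cpoly_add cpoly_smult)
      finally have "(of_real \<alpha> - \<i> * of_real \<beta>) * poly f z = - ((of_real \<alpha> + \<i> * of_real \<beta>) * cnj (poly f (cnj z)))"
        by (simp add: eq_neg_iff_add_eq_0)
      hence "cmod ((of_real \<alpha> - \<i> * of_real \<beta>) * poly f z) = cmod ((of_real \<alpha> + \<i> * of_real \<beta>) * cnj (poly f (cnj z)))"
        by simp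
      moreover have "cmod (of_real \<alpha> - \<i> * of_real \<beta>) = cmod (of_real \<alpha> + \<i> * of_real \<beta>)"
        by (simp add: cmod_def)
      moreover have "cmod (of_real \<alpha> + \<i> * of_real \<beta>) \<noteq> 0"
        using ab by (simp add: complex_eq_iff)
      ultimately have "cmod (poly f z) = cmod (poly f (cnj z))" by (simp add: norm_mult)
      hence "cmod (z - y) ^ Suc j = cmod (cnj z - y) ^ Suc j"
        by (simp add: f_def norm_power poly_power del: power_Suc)
      hence "cmod (z - y) = cmod (cnj z - y)" by (rule power_eq_imp_eq_base) auto
      hence "(cmod (z - y))\<^sup>2 = (cmod (cnj z - y))\<^sup>2" by simp
      hence "Im z * Im y = 0"
        unfolding cmod_power2 by (simp add: power2_eq_square algebra_simps)
      with y show ?thesis by simp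
    qed
    thus ?thesis by (auto simp: hyperbolic_def complex_is_Real_iff)
  qed
  have combo': "smult \<alpha> G + smult \<beta> H = 0"
    if ab: "\<alpha> \<noteq> 0 \<or> \<beta> \<noteq> 0" and z: "Im z \<noteq> 0" "of_real \<alpha> * poly (cpoly G) z + of_real \<beta> * poly (cpoly H) z = 0" for \<alpha> \<beta> z
  proof (rule ccontr)
    assume neq: "\<not> ?thesis"
    have eq: "smult \<alpha> G + smult \<beta> H = T (smult \<alpha> g + smult \<beta> h)"
      by (simp add: G_def H_def diff_op_add diff_op_smult)
    hence "hyperbolic (smult \<alpha> G + smult \<beta> H)"
      using neq combo[OF ab] by (metis T_hyperbolic diff_op_0)
    with z show False using hyperbolic_rootD[of "smult \<alpha> G + smult \<beta> H" z]
      by (simp add: cpoly_add cpoly_smult)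
  qed
  \<comment> \<open>If \<open>G\<close> and \<open>H\<close> are linearly dependent,
    \<open>C\<close> is a constant multiple of one hyperbolic polynomial and has no nonreal
    zero.\<close>
  have no_two: False if lin: "smult \<alpha> G + smult \<beta> H = 0" "\<alpha> \<noteq> 0 \<or> \<beta> \<noteq> 0" and z: "Im z > 0" "poly C z = 0" for \<alpha> \<beta> z
  proof -
    have G0: "hyperbolic G \<or> G = 0" "hyperbolic H \<or> H = 0"
      using combo[of 1 0] combo[of 0 1] T_hyperbolic by (auto simp: G_def H_def)
    show False
    proof (cases "\<alpha> = 0")
      case True
      hence "H = 0" using lin by simp
      hence "poly (cpoly G) z = 0" "G \<noteq> 0" using z \<open>C \<noteq> 0\<close> C by (auto simp: \<open>C = cpoly G + smult \<i> (cpoly H)\<close>)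
      with G0 z show False using hyperbolic_rootD[of G z] by simp
    next
      case False
      have "poly (cpoly (smult \<alpha> G + smult \<beta> H)) w = 0" for w using lin by simp
      hence "of_real \<alpha> * poly (cpoly G) w = - of_real \<beta> * poly (cpoly H) w" for w
        by (simp add: cpoly_add cpoly_smult eq_neg_iff_add_eq_0)
      with False have Gw: "poly (cpoly G) w = of_real (- \<beta> / \<alpha>) * poly (cpoly H) w" for w
        by (simp add: field_simps)
      hence "poly C w = (of_real (- \<beta> / \<alpha>) + \<i>) * poly (cpoly H) w" for w
        by (simp only: C) (simp add: algebra_simps)
      moreover have "of_real (- \<beta> / \<alpha>) + \<i> \<noteq> 0" by (simp add: complex_eq_iff)
      moreover have "H \<noteq> 0" using calculation \<open>C \<noteq> 0\<close> poly_all_0_iff_0[of C] by auto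
      ultimately have "poly (cpoly H) z = 0" "H \<noteq> 0" using z(2) by auto
      with G0 z show False using hyperbolic_rootD[of H z] by simp
    qed
  qed
  show ?thesis
  proof
    assume "poly (cT ([:- y, 1:] ^ Suc j)) z = 0"
    hence Cz: "poly C z = 0" by (simp add: C_def f_def)
    have upper: "Im w \<ge> 0" if w: "poly C w = 0" for w
    proof (rule ccontr)
      assume "\<not> Im w \<ge> 0"
      hence Imw: "Im (cnj w) > 0" by simp
      \<comment> \<open>Where \<open>H\<close> does not vanish, \<open>\<phi>\<close> has the sign
        of the imaginary part of \<open>G / H\<close>. Zeros of \<open>C\<close> in both half-planes
        give it opposite weak signs in the upper one, hence a zero \<open>u\<close>, where some real
        combination of \<open>G\<close> and \<open>H\<close> vanishes; by \<open>combo'\<close> it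
        vanishes identically.\<close>
      define \<phi> where "\<phi> u = Im (poly (cpoly G) u * cnj (poly (cpoly H) u))" for u
      have "poly (cpoly G) z = - (\<i> * poly (cpoly H) z)" using Cz C by (simp add: eq_neg_iff_add_eq_0)
      hence 1: "\<phi> z \<le> 0" by (simp add: \<phi>_def)
      have "cnj (poly C w) = 0" using w by simp
      hence "poly (cpoly G) (cnj w) = \<i> * poly (cpoly H) (cnj w)" by (simp add: C cnj_poly_cpoly)
      hence 2: "\<phi> (cnj w) \<ge> 0" by (simp add: \<phi>_def)
      have "continuous_on {u. Im u > 0} \<phi>" unfolding \<phi>_def by (intro continuous_intros)
      moreover have "connected {u. Im u > 0}" by (intro convex_connected convex_halfspace_Im_gt)
      ultimately have "connected (\<phi> ` {u. Im u > 0})" by (rule connected_continuous_image)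
      hence "{\<phi> z..\<phi> (cnj w)} \<subseteq> \<phi> ` {u. Im u > 0}"
        using Imw \<open>Im z > 0\<close> by (intro connected_contains_Icc) auto
      with 1 2 obtain u where u: "Im u > 0" "\<phi> u = 0" by force
      show False
      proof (cases "poly (cpoly H) u = 0")
        case True
        hence "smult 0 G + smult 1 H = 0" using u by (intro combo'[of _ _ u]) auto
        from no_two[OF this _ \<open>Im z > 0\<close> Cz] show False by simp
      next
        case False
        define t where "t = poly (cpoly G) u / poly (cpoly H) u"
        have "poly (cpoly G) u * cnj (poly (cpoly H) u) = t * of_real ((cmod (poly (cpoly H) u))\<^sup>2)"
          unfolding complex_norm_square t_def using False by simp
        hence "Im t = 0" using u(2) False by (simp add: \<phi>_def)
        hence "t = of_real (Re t)" by (simp add: complex_eq_iff)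
        hence "of_real 1 * poly (cpoly G) u + of_real (- Re t) * poly (cpoly H) u = 0"
          using False by (simp add: t_def field_simps)
        hence "smult 1 G + smult (- Re t) H = 0" using u by (intro combo'[of _ _ u]) auto
        from no_two[OF this _ \<open>Im z > 0\<close> Cz] show False by simp
      qed
    qed
    \<comment> \<open>With all zeros on the upper side the sum has nonnegative imaginary part. The
      affine law makes it negative, since \<open>shift\<close> is real and the slope
      positive.\<close>
    have "Im (\<Sum>\<^sub># A) \<ge> 0" if "\<forall>w\<in>#A. Im w \<ge> 0" for A
      using that by (induction A) auto
    hence "0 \<le> Im (\<Sum>\<^sub># (proots C))" using upper \<open>C \<noteq> 0\<close> by auto
    also have "\<dots> = lam j / lam (Suc j) * Im (\<Sum>\<^sub># (proots f))"
      unfolding C_def by (subst sum_proots_cT[of f j]) (use f lam0 in \<open>auto simp: m_def\<close>)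
    also have "Im (\<Sum>\<^sub># (proots f)) = real (Suc j) * Im y"
    proof -
      have "\<Sum>\<^sub># (repeat_mset i {#y#}) = of_nat i * y" for i
        by (induction i) (auto simp: algebra_simps)
      thus ?thesis unfolding f_def proots_power by (simp add: algebra_simps)
    qed
    finally have "0 \<le> lam j / lam (Suc j) * (real (Suc j) * Im y)" .
    moreover have "lam j / lam (Suc j) * (real (Suc j) * Im y) < 0"
      using lam y by (intro mult_pos_neg) (auto simp: mult_pos_neg)
    ultimately show False by linarith
  qed
qed

end

section \<open>The symbol\<close>

definition coeff_tendsto :: "(nat \<Rightarrow> complex poly) \<Rightarrow> complex poly \<Rightarrow> bool" where
  "coeff_tendsto P p \<longleftrightarrow> (\<forall>i. (\<lambda>n. coeff (P n) i) \<longlonglongrightarrow> coeff p i)"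

lemma coeff_tendsto_const [intro]: "coeff_tendsto (\<lambda>_. p) p"
  by (simp add: coeff_tendsto_def)

lemma coeff_tendsto_mult:
  "coeff_tendsto P p \<Longrightarrow> coeff_tendsto R q \<Longrightarrow> coeff_tendsto (\<lambda>n. P n * R n) (p * q)"
  unfolding coeff_tendsto_def coeff_mult by (intro allI tendsto_sum tendsto_mult) blast+

lemma coeff_tendsto_power: "coeff_tendsto P p \<Longrightarrow> coeff_tendsto (\<lambda>n. P n ^ k) (p ^ k)"
  by (induction k) (auto intro: coeff_tendsto_mult)

lemma coeff_tendsto_smult: "c \<longlonglongrightarrow> d \<Longrightarrow> coeff_tendsto P p \<Longrightarrow> coeff_tendsto (\<lambda>n. smult (c n) (P n)) (smult d p)"
  unfolding coeff_tendsto_def coeff_smult by (intro allI tendsto_mult) blast+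

lemma coeff_tendsto_sum:
  "(\<And>x. x \<in> A \<Longrightarrow> coeff_tendsto (\<lambda>n. P n x) (p x)) \<Longrightarrow> coeff_tendsto (\<lambda>n. \<Sum>x\<in>A. P n x) (\<Sum>x\<in>A. p x)"
  unfolding coeff_tendsto_def coeff_sum by (intro allI tendsto_sum) blast

lemma coeff_tendsto_pCons:
  "c \<longlonglongrightarrow> d \<Longrightarrow> coeff_tendsto P p \<Longrightarrow> coeff_tendsto (\<lambda>n. pCons (c n) (P n)) (pCons d p)"
  by (auto simp: coeff_tendsto_def coeff_pCons split: nat.splits)

text \<open>With bounded degrees, coefficientwise convergence is uniform on compact sets, so
  Hurwitz's theorem applies. That theorem is about nonconstant limits; a constant limit is handled
  directly.\<close>

lemma hurwitz_poly:
  assumes S: "open S" "connected S" and P: "coeff_tendsto P p" and deg: "\<And>n. degree (P n) \<le> d"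
    and nz: "\<And>n z. z \<in> S \<Longrightarrow> poly (P n) z \<noteq> 0" and p: "p \<noteq> 0" and z: "z \<in> S"
  shows "poly p z \<noteq> 0"
proof (cases "poly p constant_on S")
  case True
  then obtain c where c: "\<And>w. w \<in> S \<Longrightarrow> poly p w = c" by (auto simp: constant_on_def)
  have "infinite S" using S(1) z finite_imp_not_open[of S] by auto
  have "p - [:c:] = 0"
  proof (rule ccontr)
    assume "p - [:c:] \<noteq> 0"
    hence "finite {w. poly (p - [:c:]) w = 0}" by (rule poly_roots_finite)
    moreover have "S \<subseteq> {w. poly (p - [:c:]) w = 0}" using c by auto
    ultimately show False using \<open>infinite S\<close> finite_subset by blast
  qed
  with p c z show ?thesis by auto
next
  case False
  have degp: "degree p \<le> d"
  proof (rule degree_le, safe)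
    fix i assume "d < i"
    hence "coeff (P n) i = 0" for n using deg[of n] by (simp add: coeff_eq_0)
    moreover have "(\<lambda>n. coeff (P n) i) \<longlonglongrightarrow> coeff p i" using P by (simp add: coeff_tendsto_def)
    ultimately show "coeff p i = 0" by (simp add: LIMSEQ_const_iff)
  qed
  have eval: "poly q w = (\<Sum>i\<le>d. coeff q i * w ^ i)" if "degree q \<le> d" for q :: "complex poly" and w
    unfolding poly_altdef using that
    by (intro sum.mono_neutral_left) (auto simp: coeff_eq_0)
  show ?thesis
  proof (rule Hurwitz_no_zeros[of S "\<lambda>n. poly (P n)" "poly p"])
    fix K :: "complex set" assume K: "compact K" "K \<subseteq> S"
    then obtain B where B: "\<And>w. w \<in> K \<Longrightarrow> norm w \<le> B"
      using compact_imp_bounded bounded_iff by metis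
    have lim: "(\<lambda>n. \<Sum>i\<le>d. norm (coeff (P n) i - coeff p i) * B ^ i) \<longlonglongrightarrow> (\<Sum>i\<le>d. 0 * B ^ i)"
      using P unfolding coeff_tendsto_def
      by (intro tendsto_sum tendsto_mult tendsto_const) (simp add: LIM_zero_iff tendsto_norm_zero_iff)
    show "uniform_limit K (\<lambda>n. poly (P n)) (poly p) sequentially"
    proof (rule uniform_limitI)
      fix e :: real assume "e > 0"
      hence "eventually (\<lambda>n. (\<Sum>i\<le>d. norm (coeff (P n) i - coeff p i) * B ^ i) < e) sequentially"
        using lim by (intro order_tendstoD) auto
      thus "\<forall>\<^sub>F n in sequentially. \<forall>x\<in>K. dist (poly (P n) x) (poly p x) < e"
      proof (rule eventually_mono, safe)
        fix n x assume n: "(\<Sum>i\<le>d. norm (coeff (P n) i - coeff p i) * B ^ i) < e" and x: "x \<in> K"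
        have "dist (poly (P n) x) (poly p x) = norm (\<Sum>i\<le>d. (coeff (P n) i - coeff p i) * x ^ i)"
          unfolding dist_norm eval[OF deg] eval[OF degp] by (simp add: sum_subtractf algebra_simps)
        also have "\<dots> \<le> (\<Sum>i\<le>d. norm (coeff (P n) i - coeff p i) * B ^ i)"
          by (intro order_trans[OF norm_sum] sum_mono)
             (auto simp: norm_mult norm_power intro!: mult_left_mono power_mono B x)
        finally show "dist (poly (P n) x) (poly p x) < e" using n by simp
      qed
    qed
  qed (use S False nz z in \<open>auto intro!: holomorphic_intros\<close>)
qed

lemma higher_pderiv_linear_power:
  fixes c :: "'a :: {idom, ring_char_0}"
  shows "(pderiv ^^ k) ([:1, c:] ^ m) = smult (of_nat (fact k * (m choose k)) * c ^ k) ([:1, c:] ^ (m - k))"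
proof (cases "k \<le> m")
  case True
  thus ?thesis
  proof (induction k)
    case (Suc k)
    have "Suc (m - Suc k) = m - k" using Suc.prems by simp
    hence "pderiv ([:1, c:] ^ (m - k)) = smult (of_nat (m - k) * c) ([:1, c:] ^ (m - Suc k))"
      using pderiv_power_Suc[of "[:1, c:]" "m - Suc k"] by (simp add: pderiv_pCons ac_simps smult_add_left)
    moreover have "(m - k) * (fact k * (m choose k)) = fact (Suc k) * (m choose Suc k)"
    proof -
      have "Suc k * (m choose Suc k) = (m - k) * (m choose k)"
        using Suc.prems by (metis binomial_absorb_comp binomial_absorption mult.commute Suc_le_D binomial_fact_lemma)
      hence "(m - k) * (fact k * (m choose k)) = fact k * (Suc k * (m choose Suc k))"
        by (metis mult.left_commute)
      thus ?thesis by (simp add: algebra_simps)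
    qed
    hence "of_nat (m - k) * (of_nat (fact k * (m choose k)) :: 'a) = of_nat (fact (Suc k) * (m choose Suc k))"
      by (metis of_nat_mult)
    ultimately show ?case using Suc
      by (simp add: pderiv_smult ac_simps del: fact_Suc of_nat_mult)
  qed simp
next
  case False
  have "degree ([:1, c:] ^ m) \<le> m" using degree_power_le[of "[:1, c:]" m] by (cases "c = 0") auto
  with False show ?thesis by (simp add: higher_pderiv_eq_0 binomial_eq_0)
qed

text \<open>Hence the factor produced by differentiating (1 + w x/m)^m k times tends to w^k.\<close>

lemma fact_binomial_over_power_tendsto:
  "(\<lambda>m. real (fact k * (m choose k)) / real m ^ k) \<longlonglongrightarrow> 1"
proof -
  have "(\<lambda>m. \<Prod>i<k. 1 - real i * inverse (real m)) \<longlonglongrightarrow> (\<Prod>i<k. 1 - real i * 0)"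
    by (intro tendsto_intros lim_inverse_n)
  moreover have "eventually (\<lambda>m. (\<Prod>i<k. 1 - real i * inverse (real m)) = real (fact k * (m choose k)) / real m ^ k) sequentially"
    using eventually_gt_at_top[of 0]
  proof eventually_elim
    case (elim m)
    have "real (fact k * (m choose k)) = (\<Prod>i<k. real m - real i)"
      by (simp add: binomial_gbinomial gbinomial_prod_rev atLeast0LessThan)
    also have "\<dots> / real m ^ k = (\<Prod>i<k. (real m - real i) / real m)"
      by (simp add: prod_dividef)
    also have "\<dots> = (\<Prod>i<k. 1 - real i * inverse (real m))"
      using elim by (intro prod.cong) (auto simp: field_simps)
    finally show ?case ..
  qed
  ultimately show ?thesis by (simp add: tendsto_cong)
qed

context hyperbolic_operator
begin

text \<open>The coefficients of \<open>T\<close> frozen at \<open>\<xi>\<close>, with the derivative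
  replaced by a variable.\<close>

definition symb :: "complex \<Rightarrow> complex poly" where
  "symb \<xi> = (\<Sum>k\<le>N. monom (poly (cpoly (Q k)) \<xi>) k)"

lemma coeff_symb: "coeff (symb \<xi>) k = (if k \<le> N then poly (cpoly (Q k)) \<xi> else 0)"
  by (simp add: symb_def coeff_sum)

lemma degree_symb_le: "degree (symb \<xi>) \<le> N"
  by (rule degree_le) (auto simp: coeff_symb)

lemma poly_symb: "poly (symb \<xi>) w = (\<Sum>k\<le>N. poly (cpoly (Q k)) \<xi> * w ^ k)"
  by (simp add: symb_def poly_sum poly_monom)

text \<open>The zero -m/w of (1 + w x/m)^m lies in the closed lower half-plane, so the image has no
  zeros in the upper one. Cancelling m - N linear factors from the image bounds the degrees, so that
  Hurwitz's theorem can be applied.\<close>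

lemma symb_root_upper:
  assumes \<xi>: "Im \<xi> > 0" and w: "w \<noteq> 0" "Im w \<le> 0"
  shows "poly (symb \<xi>) w \<noteq> 0"
proof -
  obtain m0 where m0: "\<And>m. m \<ge> m0 \<Longrightarrow> top_coeff N * lam m > 0" using lam_eventually_pos by blast
  \<comment> \<open>Beyond \<open>m0\<close> consecutive values of \<open>lam\<close> have the same
    sign, and beyond \<open>N\<close> the power of the linear factor can be split off.\<close>
  define M where "M n = Suc (n + m0 + N)" for n
  define c where "c n = w / of_nat (M n)" for n
  define P where "P n = (\<Sum>k\<le>N. smult (of_real (real (fact k * (M n choose k)) / real (M n) ^ k) * w ^ k)
      (cpoly (Q k) * [:1, c n:] ^ (N - k)))" for n
  define p where "p = (\<Sum>k\<le>N. smult (of_real 1 * w ^ k) (cpoly (Q k) * [:1, 0:] ^ (N - k)))"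
  have M: "filterlim M at_top sequentially"
    by (rule filterlim_subseq) (simp add: strict_mono_def M_def)
  have "(\<lambda>n. of_nat (M n) :: complex) = (\<lambda>n. of_nat n) \<circ> M" by auto
  have clim: "c \<longlonglongrightarrow> 0"
    unfolding c_def
    using filterlim_compose[OF lim_inverse_n[where 'a = complex] M]
    by (auto simp: divide_inverse intro!: tendsto_mult_right_zero)
  have "coeff_tendsto P p" unfolding P_def p_def
    by (intro coeff_tendsto_sum coeff_tendsto_smult coeff_tendsto_mult coeff_tendsto_const
        coeff_tendsto_power coeff_tendsto_pCons clim tendsto_intros
        filterlim_compose[OF fact_binomial_over_power_tendsto M])
  moreover have "degree (P n) \<le> N + r" for n
  proof -
    have "degree (smult x (cpoly (Q k) * [:1, c n:] ^ (N - k))) \<le> N + r" if "k \<le> N" for k x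
    proof -
      have "degree ([:1, c n:] ^ (N - k)) \<le> N - k"
        using degree_power_le[of "[:1, c n:]" "N - k"] by (cases "c n = 0") auto
      thus ?thesis using degree_Q_le[OF that] that degree_smult_le[of x "cpoly (Q k) * [:1, c n:] ^ (N - k)"]
         degree_mult_le[of "cpoly (Q k)" "[:1, c n:] ^ (N - k)"] by simp
    qed
    thus ?thesis unfolding P_def by (intro degree_sum_le) (auto simp del: degree_smult_eq)
  qed
  moreover have "poly (P n) z \<noteq> 0" if z: "Im z > 0" for n z
  proof -
    define y where "y = - of_nat (M n) / w"
    define j where "j = n + m0 + N"
    have Mj: "M n = Suc j" by (simp add: M_def j_def)
    have "of_nat (M n) \<noteq> (0 :: complex)" by (simp add: Mj del: of_nat_Suc)
    hence cy: "[:1, c n:] = smult (c n) [:-y, 1:]" "c n \<noteq> 0"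
      using w(1) by (simp_all add: c_def y_def)
    have "Im y = real (M n) * Im w / (cmod w)\<^sup>2"
      by (simp add: y_def Im_divide cmod_power2 algebra_simps)
    hence y: "Im y \<le> 0" using w by (simp add: mult_nonneg_nonpos divide_nonpos_nonneg)
    have "top_coeff N * lam j > 0" "top_coeff N * lam (Suc j) > 0" by (rule m0; simp add: j_def)+
    hence "lam j / lam (Suc j) > 0" by (auto simp: zero_less_mult_iff zero_less_divide_iff)
    from cT_linear_power_nonzero[OF y this z]
    have "poly (cT ([:1, c n:] ^ M n)) z \<noteq> 0"
      using cy(2) unfolding cy(1) smult_power Mj cdiff_op_def diff_op_smult poly_smult by simp
    also have "cT ([:1, c n:] ^ M n) = [:1, c n:] ^ (M n - N) * P n"
    proof -
      have "cpoly (Q k) * (pderiv ^^ k) ([:1, c n:] ^ M n) = [:1, c n:] ^ (M n - N) *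
        smult (of_real (real (fact k * (M n choose k)) / real (M n) ^ k) * w ^ k)
          (cpoly (Q k) * [:1, c n:] ^ (N - k))" if "k \<le> N" for k
      proof -
        have "M n - k = (M n - N) + (N - k)" using that by (simp add: M_def)
        hence pw: "[:1, c n:] ^ (M n - k) = [:1, c n:] ^ (M n - N) * [:1, c n:] ^ (N - k)"
          by (simp only: power_add)
        have "of_nat (fact k * (M n choose k)) * c n ^ k =
            of_real (real (fact k * (M n choose k)) / real (M n) ^ k) * w ^ k"
          by (simp add: c_def power_divide)
        thus ?thesis unfolding higher_pderiv_linear_power pw
          by (simp only: mult_smult_left mult_smult_right mult.left_commute)
      qed
      thus ?thesis unfolding cdiff_op_def diff_op_def P_def sum_distrib_left by (intro sum.cong) auto
    qed
    finally show ?thesis by auto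
  qed
  moreover have p_eq: "p = (\<Sum>k\<le>N. smult (w ^ k) (cpoly (Q k)))"
    by (simp add: p_def flip: one_pCons)
  \<comment> \<open>Only \<open>Q N\<close> reaches the degree \<open>N + r\<close>.\<close>
  moreover have "p \<noteq> 0"
  proof -
    have "coeff p (N + r) = (\<Sum>k\<le>N. if k = N then w ^ N * of_real (top_coeff N) else 0)"
      unfolding p_eq coeff_sum
    proof (intro sum.cong refl)
      fix k assume "k \<in> {..N}"
      thus "coeff (smult (w ^ k) (cpoly (Q k))) (N + r) = (if k = N then w ^ N * of_real (top_coeff N) else 0)"
        using degree_Q_le[of k] by (auto simp: top_coeff_def intro!: coeff_eq_0)
    qed
    thus ?thesis using w(1) top_N_nonzero by auto
  qed
  ultimately have "poly p \<xi> \<noteq> 0"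
    using \<xi> by (intro hurwitz_poly[of "{z. Im z > 0}" P p "N + r"])
      (auto simp: open_halfspace_Im_gt intro!: convex_connected convex_halfspace_Im_gt)
  thus ?thesis by (simp add: p_eq poly_symb poly_sum mult.commute)
qed

definition rsymb :: "real \<Rightarrow> real poly" where
  "rsymb \<theta> = (\<Sum>k\<le>N. monom (poly (Q k) \<theta>) k)"

lemma coeff_rsymb: "coeff (rsymb \<theta>) k = (if k \<le> N then poly (Q k) \<theta> else 0)"
  by (simp add: rsymb_def coeff_sum)

lemma cpoly_rsymb: "cpoly (rsymb \<theta>) = symb (of_real \<theta>)"
  by (simp add: poly_eq_iff coeff_rsymb coeff_symb)

text \<open>The point \<open>\<theta>\<close> is approached from the upper half-plane, where the
  symbols have no zeros in the lower half-plane. The limit inherits this, and its real coefficients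
  give the other half-plane.\<close>

lemma hyperbolic_rsymb:
  assumes "rsymb \<theta> \<noteq> 0"
  shows "hyperbolic (rsymb \<theta>)"
proof (rule hyperbolicI[OF assms])
  fix z :: complex assume z: "Im z > 0"
  define P where "P n = symb (Complex \<theta> (inverse (real (Suc n))))" for n
  have lim: "(\<lambda>n. Complex \<theta> (inverse (real (Suc n)))) \<longlonglongrightarrow> of_real \<theta>"
    using tendsto_Complex[OF tendsto_const LIMSEQ_inverse_real_of_nat, of \<theta>]
    by (simp add: complex_of_real_def)
  have "(\<lambda>n. poly q (Complex \<theta> (inverse (real (Suc n))))) \<longlonglongrightarrow> poly q (of_real \<theta>)" for q
    using lim by (rule isCont_tendsto_compose[OF poly_isCont])
  hence 1: "coeff_tendsto P (symb (of_real \<theta>))"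
    unfolding coeff_tendsto_def P_def coeff_symb by (auto simp del: of_nat_Suc poly_cpoly_of_real)
  have 2: "degree (P n) \<le> N" for n unfolding P_def by (rule degree_symb_le)
  have 3: "poly (P n) w \<noteq> 0" if "w \<in> {w. Im w < 0}" for n w
    unfolding P_def using that by (intro symb_root_upper) auto
  have 4: "symb (of_real \<theta>) \<noteq> 0" using assms by (simp flip: cpoly_rsymb)
  have "open {w. Im w < 0}" "connected {w. Im w < 0}"
    by (auto simp: open_halfspace_Im_lt intro: convex_connected convex_halfspace_Im_lt)
  from hurwitz_poly[OF this 1 2 3 4, of "cnj z"] z
  have "poly (symb (of_real \<theta>)) (cnj z) \<noteq> 0" by simp
  hence "poly (cpoly (rsymb \<theta>)) (cnj z) \<noteq> 0" by (simp only: cpoly_rsymb not_False_eq_True)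
  thus "poly (cpoly (rsymb \<theta>)) z \<noteq> 0" using cnj_poly_cpoly[of "rsymb \<theta>" z] by auto
qed

end

section \<open>Degrees, signs and interlacing of the coefficients\<close>

lemma logderiv:
  fixes p :: "complex poly"
  assumes "poly p z \<noteq> 0"
  shows "poly (pderiv p) z = poly p z * (\<Sum>a\<in>#proots p. 1 / (z - a))"
proof -
  have *: "poly (pderiv (\<Prod>a\<in>#A. [:-a, 1:])) z = poly (\<Prod>a\<in>#A. [:-a, 1:]) z * (\<Sum>a\<in>#A. 1 / (z - a))"
    if "z \<notin># A" for A
    using that
  proof (induction A)
    case (add a A)
    hence "z - a \<noteq> 0" by auto
    define P where "P = (\<Prod>a\<in>#A. [:-a, 1:])"
    define s where "s = (\<Sum>a\<in>#A. 1 / (z - a))"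
    have IH: "poly (pderiv P) z = poly P z * s" using add by (simp add: P_def s_def)
    have "poly (pderiv ([:-a, 1:] * P)) z = (z - a) * poly (pderiv P) z + poly P z"
      unfolding pderiv_mult by (simp add: pderiv_pCons algebra_simps)
    also have "\<dots> = (z - a) * poly P z * (1 / (z - a) + s)"
      unfolding IH using \<open>z - a \<noteq> 0\<close> by (simp add: distrib_left)
    also have "\<dots> = poly ([:-a, 1:] * P) z * (1 / (z - a) + s)" by (simp add: algebra_simps)
    finally show ?case by (simp only: P_def s_def image_mset_add_mset prod_mset.add_mset sum_mset.add_mset)
  qed simp
  have "z \<notin># proots p" using assms by (cases "p = 0") auto
  from *[OF this] have "poly (pderiv (smult (lead_coeff p) (\<Prod>a\<in>#proots p. [:-a, 1:]))) z =
    poly (smult (lead_coeff p) (\<Prod>a\<in>#proots p. [:-a, 1:])) z * (\<Sum>a\<in>#proots p. 1 / (z - a))"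
    by (simp add: pderiv_smult)
  thus ?thesis by (simp only: complex_poly_decompose_multiset)
qed

lemma sum_mset_Im_nonneg: "(\<And>a. a \<in># A \<Longrightarrow> Im (f a) \<ge> 0) \<Longrightarrow> Im (\<Sum>a\<in>#A. f a) \<ge> 0"
  by (induction A) auto

lemma sum_mset_Im_nonneg_eq_0:
  assumes "\<And>a. a \<in># A \<Longrightarrow> Im (f a) \<ge> 0" "Im (\<Sum>a\<in>#A. f a) = 0" "a \<in># A"
  shows "Im (f a) = 0"
  using assms
proof (induction A)
  case (add b A)
  have "Im (\<Sum>a\<in>#A. f a) \<ge> 0" using add.prems(1) by (intro sum_mset_Im_nonneg) auto
  moreover have "Im (f b) \<ge> 0" using add.prems by simp
  ultimately have "Im (f b) = 0" "Im (\<Sum>a\<in>#A. f a) = 0" using add.prems(2) by auto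
  thus ?case using add by (cases "a = b") auto
qed simp

lemma sum_mset_Im_pos:
  assumes "\<And>a. a \<in># A \<Longrightarrow> Im (f a) > 0" "A \<noteq> {#}"
  shows "Im (\<Sum>a\<in>#A. f a) > 0"
proof -
  have "Im (\<Sum>a\<in>#A. f a) \<ge> 0" using assms(1) by (intro sum_mset_Im_nonneg) (auto intro: less_imp_le)
  moreover obtain a where "a \<in># A" using assms(2) by blast
  ultimately show ?thesis
    using sum_mset_Im_nonneg_eq_0[of A f a] assms(1) by (metis less_eq_real_def less_irrefl)
qed

lemma Im_inverse_diff: "Im (1 / (z - a)) = (Im a - Im z) / (cmod (z - a))\<^sup>2"
  by (simp add: Im_divide cmod_power2)

text \<open>Polynomials with zeros in the open upper half-plane or at the origin: the class is closed
  under differentiation, which gives the sign of the ratio of consecutive coefficients.\<close>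

lemma upper_zeros_pderiv:
  fixes p :: "complex poly"
  assumes p: "\<And>z. poly p z = 0 \<Longrightarrow> z = 0 \<or> Im z > 0" and "pderiv p \<noteq> 0" and z: "poly (pderiv p) z = 0"
  shows "z = 0 \<or> Im z > 0"
proof (rule ccontr)
  assume neg: "\<not> ?thesis"
  hence pz: "poly p z \<noteq> 0" using p by blast
  hence p0: "p \<noteq> 0" by auto
  \<comment> \<open>As in the Gauss-Lucas theorem: with \<open>z\<close> outside the class every
    term has nonnegative imaginary part, so all imaginary parts vanish and every zero of
    \<open>p\<close> lies at height \<open>Im z\<close>. As \<open>Im z \<le> 0\<close>, all zeros
    are 0, and then the sum is a nonzero multiple of 1/z.\<close>
  have "(\<Sum>a\<in>#proots p. 1 / (z - a)) = 0" using logderiv[OF pz] pz z by simp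
  moreover have "Im (1 / (z - a)) \<ge> 0" if "a \<in># proots p" for a
  proof -
    have "Im a \<ge> 0" using p[of a] that p0 by auto
    with neg show ?thesis unfolding Im_inverse_diff by (intro divide_nonneg_nonneg) auto
  qed
  ultimately have im: "Im (1 / (z - a)) = 0" if "a \<in># proots p" for a
    using sum_mset_Im_nonneg_eq_0[of "proots p" "\<lambda>a. 1 / (z - a)" a] that by simp
  have zero: "a = 0" if a: "a \<in># proots p" for a
  proof -
    have "z \<noteq> a" using pz a p0 by auto
    hence "Im a = Im z" using im[OF a] unfolding Im_inverse_diff by simp
    thus ?thesis using p[of a] a p0 neg by auto
  qed
  have "size (proots p) > 0"
    using assms(2) by (auto simp: size_proots_complex pderiv_eq_0_iff)
  then obtain n where n: "proots p = replicate_mset (Suc n) 0"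
    using zero by (metis set_mset_subset_singletonD gr0_implies_Suc subsetI singletonI size_replicate_mset)
  have "(\<Sum>a\<in>#replicate_mset j 0. 1 / (z - a)) = of_nat j / z" for j
    by (induction j) (auto simp: add_divide_distrib)
  with n \<open>(\<Sum>a\<in>#proots p. 1 / (z - a)) = 0\<close> have "of_nat (Suc n) / z = 0" by metis
  with neg show False by (simp del: of_nat_Suc)
qed

text \<open>The logarithmic derivative of the k-th derivative at 0 is a positive multiple of the
  ratio of the two coefficients. It is also the sum of -1/a over zeros a, which all lie in the open
  upper half-plane since 0 is not among them.\<close>

lemma upper_zeros_coeff:
  fixes p :: "complex poly"
  assumes p: "\<And>z. poly p z = 0 \<Longrightarrow> z = 0 \<or> Im z > 0" and k: "coeff p k \<noteq> 0" "k < degree p"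
  shows "Im (coeff p (Suc k) * cnj (coeff p k)) > 0"
proof -
  have upper: "z = 0 \<or> Im z > 0" if "j < degree p" "poly ((pderiv ^^ j) p) z = 0" for j z
    using that
  proof (induction j arbitrary: z)
    case (Suc j)
    have "degree ((pderiv ^^ Suc j) p) > 0" using Suc.prems by (simp only: degree_higher_pderiv)
    hence "pderiv ((pderiv ^^ j) p) \<noteq> 0" by auto
    moreover have "w = 0 \<or> Im w > 0" if "poly ((pderiv ^^ j) p) w = 0" for w
      using Suc.IH[of w] Suc.prems(1) that by simp
    moreover have "poly (pderiv ((pderiv ^^ j) p)) z = 0" using Suc.prems(2) by simp
    ultimately show ?case using upper_zeros_pderiv by blast
  qed (use p in auto)
  define q where "q = (pderiv ^^ k) p"
  have q0: "poly q 0 = of_nat (fact k) * coeff p k"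
    by (simp add: q_def poly_0_coeff_0 coeff_higher_pderiv_binomial)
  have "poly (pderiv q) 0 = coeff ((pderiv ^^ Suc k) p) 0" by (simp add: q_def poly_0_coeff_0)
  also have "\<dots> = of_nat (fact (Suc k)) * coeff p (Suc k)"
    unfolding coeff_higher_pderiv_binomial by simp
  finally have q1: "poly (pderiv q) 0 = of_nat (fact (Suc k)) * coeff p (Suc k)" .
  have q00: "poly q 0 \<noteq> 0" using k q0 by simp
  have "Im (\<Sum>a\<in>#proots q. 1 / (0 - a)) > 0"
  proof (rule sum_mset_Im_pos)
    have "degree q > 0" using k by (simp add: q_def degree_higher_pderiv)
    thus "proots q \<noteq> {#}" using size_proots_complex[of q] by auto
    fix a assume "a \<in># proots q"
    hence a: "poly q a = 0" using q00 by (cases "q = 0") auto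
    with q00 have "a \<noteq> 0" by auto
    moreover have "a = 0 \<or> Im a > 0" using upper[of k a] k a by (simp add: q_def)
    ultimately show "Im (1 / (0 - a)) > 0" unfolding Im_inverse_diff by simp
  qed
  hence "0 < Im (\<Sum>a\<in>#proots q. 1 / (0 - a)) * (cmod (poly q 0))\<^sup>2" using q00 by simp
  also have "\<dots> = Im (poly (pderiv q) 0 * cnj (poly q 0))"
    unfolding logderiv[OF q00]
    by (simp add: mult.commute[of _ "cnj (poly q 0)"] mult.assoc[symmetric] mult.commute[of "cnj (poly q 0)" "poly q 0"]
        complex_norm_square[symmetric] del: of_real_power)
  also have "\<dots> = real (fact (Suc k)) * real (fact k) * Im (coeff p (Suc k) * cnj (coeff p k))"
    unfolding q0 q1 by (simp add: algebra_simps del: fact_Suc)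
  finally show ?thesis by (rule zero_less_mult_pos) (simp del: fact_Suc)
qed

context hyperbolic_operator
begin

text \<open>Reverse the symbol: c^N times its value at 1/c is nonzero when 1/c is on the negative
  imaginary axis, and only \<open>Q N\<close> survives as c tends to 0.\<close>

lemma Q_N_upper_nonzero:
  assumes "Im \<xi> > 0"
  shows "poly (cpoly (Q N)) \<xi> \<noteq> 0"
proof -
  define c where "c n = \<i> * of_real (inverse (real (Suc n)))" for n
  define P where "P n = (\<Sum>k\<le>N. smult (c n ^ (N - k)) (cpoly (Q k)))" for n
  have c: "c \<longlonglongrightarrow> \<i> * of_real 0" unfolding c_def
    by (intro tendsto_intros LIMSEQ_inverse_real_of_nat)
  have 1: "coeff_tendsto P (\<Sum>k\<le>N. smult (0 ^ (N - k)) (cpoly (Q k)))"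
    unfolding P_def using c by (intro coeff_tendsto_sum coeff_tendsto_smult coeff_tendsto_const tendsto_power) auto
  have "(\<Sum>k\<le>N. smult (0 ^ (N - k)) (cpoly (Q k))) = (\<Sum>k\<in>{N}. smult (0 ^ (N - k)) (cpoly (Q k)))"
    by (intro sum.mono_neutral_right) auto
  with 1 have 1: "coeff_tendsto P (cpoly (Q N))" by simp
  have 2: "degree (P n) \<le> N + r" for n
    unfolding P_def
    by (intro degree_sum_le) (auto intro!: order_trans[OF degree_smult_le] order_trans[OF degree_Q_le] simp del: degree_smult_eq)
  have 3: "poly (P n) z \<noteq> 0" if "z \<in> {z. Im z > 0}" for n z
  proof -
    have c0: "c n \<noteq> 0" by (simp add: c_def del: of_nat_Suc)
    have "Im (inverse (c n)) \<le> 0" by (simp add: c_def)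
    hence "poly (symb z) (inverse (c n)) \<noteq> 0" using that c0 by (intro symb_root_upper) auto
    moreover have "c n ^ N * poly (symb z) (inverse (c n)) = poly (P n) z"
    proof -
      have "c n ^ N * inverse (c n) ^ k = c n ^ (N - k)" if "k \<le> N" for k
      proof -
        have "c n ^ N = c n ^ (N - k) * c n ^ k" using that by (simp flip: power_add)
        thus ?thesis using c0 by (simp add: power_inverse)
      qed
      hence "(\<Sum>k\<le>N. poly (cpoly (Q k)) z * (c n ^ N * inverse (c n) ^ k)) =
          (\<Sum>k\<le>N. poly (cpoly (Q k)) z * c n ^ (N - k))" by simp
      thus ?thesis by (simp add: poly_symb P_def poly_sum sum_distrib_left mult.left_commute mult.commute)
    qed
    ultimately show ?thesis using c0 by auto
  qed
  have "open {z. Im z > 0}" "connected {z. Im z > 0}"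
    by (auto simp: open_halfspace_Im_gt intro: convex_connected convex_halfspace_Im_gt)
  from hurwitz_poly[OF this 1 2 3, of \<xi>] assms Q_N_nonzero show ?thesis by simp
qed

text \<open>Polynomials of degree below \<open>M\<close> are annihilated by
  \<open>T\<close>.\<close>

definition M :: nat where "M = (LEAST k. Q k \<noteq> 0)"

lemma Q_M_nonzero: "Q M \<noteq> 0"
  unfolding M_def by (rule LeastI, rule Q_N_nonzero)

lemma Q_below_M: "k < M \<Longrightarrow> Q k = 0"
  unfolding M_def using not_less_Least by blast

lemma M_le_N: "M \<le> N"
  unfolding M_def by (rule Least_le, rule Q_N_nonzero)

text \<open>Up to a factor this is the image of x^M: lower derivatives meet zero coefficients and
  higher ones vanish.\<close>

lemma hyperbolic_Q_M: "hyperbolic (Q M)"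
proof -
  have "Q k * (pderiv ^^ k) (monom 1 M) = (if k = M then smult (fact M) (Q M) else 0)" for k
  proof (cases k M rule: linorder_cases)
    case equal
    have "(pderiv ^^ M) (monom (1 :: real) M) = [:fact M:]"
      by (rule poly_eqI) (auto simp: coeff_higher_pderiv_binomial coeff_pCons split: nat.splits)
    with equal show ?thesis by simp
  qed (auto simp: Q_below_M higher_pderiv_eq_0 degree_monom_eq)
  hence "T (monom 1 M) = smult (fact M) (Q M)" using M_le_N by (simp add: diff_op_def)
  moreover have "hyperbolic (monom 1 M)"
    by (auto simp: hyperbolic_def map_poly_monom poly_monom monom_eq_0_iff)
  ultimately show ?thesis using T_hyperbolic[of "monom 1 M"] Q_M_nonzero by (simp add: hyperbolic_smult)
qed

text \<open>These are the coefficients of the symbol at \<open>\<xi>\<close>, so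
  \<open>upper_zeros_coeff\<close> applies: a nonzero coefficient forces the next one to be nonzero.
  The induction starts at \<open>Q M\<close>.\<close>

lemma Q_ratio_upper:
  assumes \<xi>: "Im \<xi> > 0" and k: "M \<le> k"
  shows "k \<le> N \<Longrightarrow> poly (cpoly (Q k)) \<xi> \<noteq> 0"
    and "k < N \<Longrightarrow> Im (poly (cpoly (Q (Suc k))) \<xi> * cnj (poly (cpoly (Q k)) \<xi>)) > 0"
proof -
  have deg: "degree (symb \<xi>) = N"
    using Q_N_upper_nonzero[OF \<xi>] degree_symb_le by (intro antisym le_degree) (auto simp: coeff_symb)
  have upper: "z = 0 \<or> Im z > 0" if "poly (symb \<xi>) z = 0" for z
    using symb_root_upper[OF \<xi>, of z] that by force
  have ratio: "Im (poly (cpoly (Q (Suc k))) \<xi> * cnj (poly (cpoly (Q k)) \<xi>)) > 0"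
    if "k < N" "poly (cpoly (Q k)) \<xi> \<noteq> 0" for k
    using upper_zeros_coeff[of "symb \<xi>" k, OF upper] that deg by (simp add: coeff_symb)
  have nz: "k \<le> N \<longrightarrow> poly (cpoly (Q k)) \<xi> \<noteq> 0" using k
  proof (induction k rule: dec_induct)
    case base
    show ?case using hyperbolic_rootD[OF hyperbolic_Q_M, of \<xi>] \<xi> by auto
  next
    case (step n)
    thus ?case using ratio[of n] by fastforce
  qed
  show "k \<le> N \<Longrightarrow> poly (cpoly (Q k)) \<xi> \<noteq> 0" using nz by blast
  show "k < N \<Longrightarrow> Im (poly (cpoly (Q (Suc k))) \<xi> * cnj (poly (cpoly (Q k)) \<xi>)) > 0"
    using ratio nz by simp
qed

lemma Q_eq_0_iff: "k \<le> N \<Longrightarrow> Q k = 0 \<longleftrightarrow> k < M"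
  using Q_ratio_upper(1)[of \<i> k] Q_below_M[of k] by (cases "k < M") auto

lemma hyperbolic_Q: "M \<le> k \<Longrightarrow> k \<le> N \<Longrightarrow> hyperbolic (Q k)"
  using Q_ratio_upper(1) Q_eq_0_iff[of k] by (intro hyperbolicI) auto

text \<open>The interlacing index \<open>i\<close> is at most 0 by counting to the right of all
  zeros. To the left of all zeros the counts are the degrees, and the degree bound leaves only
  \<open>i = 0\<close>. Degree, sign and counts all follow from this.\<close>

lemma Q_step:
  assumes k: "M \<le> k" "k < N" and deg: "degree (Q (Suc k)) = Suc k + r"
  shows "degree (Q k) = k + r" "lead_coeff (Q k) * lead_coeff (Q (Suc k)) > 0"
    "rcount (Q k) x \<le> rcount (Q (Suc k)) x" "rcount (Q (Suc k)) x \<le> Suc (rcount (Q k) x)"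
proof -
  have hyp: "hyperbolic (Q k)" "hyperbolic (Q (Suc k))" using k by (auto intro: hyperbolic_Q)
  hence nonzero: "Q k \<noteq> 0" "Q (Suc k) \<noteq> 0" by (auto dest: hyperbolic_nonzero)
  have nz: "Im (poly (cpoly (Q (Suc k))) z * cnj (poly (cpoly (Q k)) z)) > 0" if "Im z > 0" for z
    using Q_ratio_upper(2)[OF that] k by simp
  obtain i :: int where i: "\<And>x. i \<le> int (rcount (Q (Suc k)) x) - int (rcount (Q k) x)"
    "\<And>x. int (rcount (Q (Suc k)) x) - int (rcount (Q k) x) \<le> i + 1"
    "\<And>z. i = 0 \<Longrightarrow> Im z > 0 \<Longrightarrow>
       lead_coeff (Q k) * lead_coeff (Q (Suc k)) * Im (poly (cpoly (Q (Suc k))) z * cnj (poly (cpoly (Q k)) z)) > 0"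
    using rcount_interlace[OF hyp] nz by (metis less_irrefl)
  have fin: "finite {a. poly (Q k * Q (Suc k)) a = 0}" using nonzero by (intro poly_roots_finite) simp
  obtain b where b: "\<And>a. poly (Q k * Q (Suc k)) a = 0 \<Longrightarrow> a \<le> b"
    using bdd_above_finite[OF fin] by (auto simp: bdd_above_def)
  obtain c where c: "\<And>a. poly (Q k * Q (Suc k)) a = 0 \<Longrightarrow> c \<le> a"
    using bdd_below_finite[OF fin] by (auto simp: bdd_below_def)
  have "rcount (Q k) b = 0" "rcount (Q (Suc k)) b = 0"
    using b nonzero by (auto simp: rcount_eq_0_iff)
  with i(1,2)[of b] have "i \<le> 0" "0 \<le> i + 1" by auto
  have "\<forall>a. poly (Q k) a = 0 \<longrightarrow> c - 1 < a" "\<forall>a. poly (Q (Suc k)) a = 0 \<longrightarrow> c - 1 < a"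
    using c by (force simp: less_le_trans)+
  hence "rcount (Q k) (c - 1) = degree (Q k)" "rcount (Q (Suc k)) (c - 1) = degree (Q (Suc k))"
    using hyp by (simp_all add: rcount_eq_degree_iff)
  with i(1,2)[of "c - 1"] have "int (degree (Q (Suc k))) - int (degree (Q k)) \<le> i + 1" by simp
  with deg degree_Q_le[of k] k \<open>i \<le> 0\<close> have "i = 0" and d: "degree (Q k) = k + r" by auto
  show "degree (Q k) = k + r" by (rule d)
  show "lead_coeff (Q k) * lead_coeff (Q (Suc k)) > 0"
    using i(3)[OF \<open>i = 0\<close>, of \<i>] nz[of \<i>] by (simp add: zero_less_mult_iff)
  show "rcount (Q k) x \<le> rcount (Q (Suc k)) x" "rcount (Q (Suc k)) x \<le> Suc (rcount (Q k) x)"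
    using i(1,2)[of x] \<open>i = 0\<close> by auto
qed

text \<open>Downward induction from \<open>N\<close>, the only index whose degree is given.\<close>

lemma degree_Q:
  assumes "M \<le> k" "k \<le> N"
  shows "degree (Q k) = k + r"
  using assms(2,1)
proof (induction k rule: inc_induct)
  case base
  show ?case by (rule degree_Q_N)
next
  case (step n)
  hence "degree (Q (Suc n)) = Suc n + r" by simp
  with step show ?case using Q_step(1)[of n] by simp
qed

lemma top_eq: "M \<le> k \<Longrightarrow> k \<le> N \<Longrightarrow> top_coeff k = lead_coeff (Q k)"
  by (simp add: top_coeff_def degree_Q)

lemma top_sign:
  assumes "M \<le> k" "k \<le> N"
  shows "top_coeff N * top_coeff k > 0"
  using assms(2,1)
proof (induction k rule: inc_induct)
  case base
  show ?case using top_N_nonzero not_real_square_gt_zero by blast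
next
  case (step n)
  have "top_coeff n * top_coeff (Suc n) > 0"
    using Q_step(2)[of n] degree_Q[of "Suc n"] step by (simp add: top_eq)
  with step.IH step.prems show ?case by (auto simp: zero_less_mult_iff)
qed

lemma rcount_Q_mono:
  assumes "M \<le> k" "k \<le> l" "l \<le> N"
  shows "rcount (Q k) x \<le> rcount (Q l) x" "rcount (Q l) x \<le> l - k + rcount (Q k) x"
proof -
  have "rcount (Q k) x \<le> rcount (Q l) x \<and> rcount (Q l) x \<le> l - k + rcount (Q k) x"
    using assms(2,1,3)
  proof (induction l rule: dec_induct)
    case (step n)
    have "rcount (Q n) x \<le> rcount (Q (Suc n)) x" "rcount (Q (Suc n)) x \<le> Suc (rcount (Q n) x)"
      using step degree_Q[of "Suc n"] by (auto intro!: Q_step(3,4))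
    with step show ?case by auto
  qed simp
  thus "rcount (Q k) x \<le> rcount (Q l) x" "rcount (Q l) x \<le> l - k + rcount (Q k) x" by auto
qed

section \<open>Growth of \<open>lam\<close> and the slope of the sum law\<close>

lemma top_below_M: "k < M \<Longrightarrow> top_coeff k = 0"
  by (simp add: top_coeff_def Q_below_M)

text \<open>Multiplication by \<open>top_coeff N\<close> normalises the sign: every summand becomes
  nonnegative.\<close>

lemma top_N_lam: "top_coeff N * lam m = (\<Sum>k\<le>N. top_coeff N * top_coeff k * real (fact k * (m choose k)))"
  by (simp add: lam_def sum_distrib_left mult.assoc)

lemma top_sign_nonneg: "k \<le> N \<Longrightarrow> top_coeff N * top_coeff k \<ge> 0"
  using top_sign[of k] top_below_M[of k] by (cases "M \<le> k") auto

lemma lam_nonneg: "top_coeff N * lam m \<ge> 0"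
  unfolding top_N_lam by (intro sum_nonneg mult_nonneg_nonneg[OF top_sign_nonneg]) auto

lemma lam_strict_mono:
  assumes "M \<le> Suc m"
  shows "top_coeff N * lam m < top_coeff N * lam (Suc m)"
  unfolding top_N_lam
proof (rule sum_strict_mono_ex1)
  show "\<forall>k\<in>{..N}. top_coeff N * top_coeff k * real (fact k * (m choose k)) \<le> top_coeff N * top_coeff k * real (fact k * (Suc m choose k))"
    using top_sign_nonneg by (auto intro!: mult_left_mono binomial_right_mono)
  \<comment> \<open>The term with index 0 does not depend on \<open>m\<close>, and the terms below
    \<open>M\<close> vanish; \<open>max M 1\<close> is the first index whose term can grow.\<close>
  define k where "k = max M 1"
  have k: "k \<le> N" "k \<ge> 1" "M \<le> k" "k \<le> Suc m" using M_le_N N_pos assms by (auto simp: k_def)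
  then obtain j where j: "k = Suc j" by (cases k) auto
  have "(m choose k) < (Suc m choose k)" using k j by simp
  thus "\<exists>k\<in>{..N}. top_coeff N * top_coeff k * real (fact k * (m choose k)) < top_coeff N * top_coeff k * real (fact k * (Suc m choose k))"
    using top_sign[of k] k by (intro bexI[of _ k] mult_strict_left_mono) auto
qed simp

lemma lam_pos: "M \<le> m \<Longrightarrow> top_coeff N * lam m > 0"
proof (cases m)
  case 0
  assume "M \<le> m"
  with 0 have "M = 0" by simp
  have "top_coeff N * top_coeff 0 * real (fact 0 * (0 choose 0)) \<le> top_coeff N * lam 0"
    unfolding top_N_lam by (intro member_le_sum mult_nonneg_nonneg[OF top_sign_nonneg]) auto
  with top_sign[of 0] \<open>M = 0\<close> 0 show ?thesis by simp
next
  case (Suc j)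
  assume "M \<le> m"
  with Suc lam_strict_mono[of j] lam_nonneg[of j] show ?thesis by simp
qed

lemma lam_nonzero: "M \<le> m \<Longrightarrow> lam m \<noteq> 0"
  using lam_pos[of m] by auto

text \<open>The numerator vanishes when \<open>Suc m = M\<close>, hence only a weak lower bound; the
  denominator is nonzero.\<close>

lemma lam_ratio:
  assumes "M \<le> Suc m"
  shows "0 \<le> lam m / lam (Suc m)" "lam m / lam (Suc m) < 1"
proof -
  have eq: "lam m / lam (Suc m) = (top_coeff N * lam m) / (top_coeff N * lam (Suc m))" using top_N_nonzero by simp
  show "0 \<le> lam m / lam (Suc m)"
    unfolding eq by (rule divide_nonneg_pos[OF lam_nonneg lam_pos[OF assms]])
  show "lam m / lam (Suc m) < 1"
    unfolding eq pos_divide_less_eq[OF lam_pos[OF assms]] using lam_strict_mono[OF assms] by simp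
qed

text \<open>So a nonzero \<open>v\<close> determines the degree of its solutions through its leading
  coefficient.\<close>

lemma lam_inj:
  assumes "M \<le> m" "M \<le> n" "lam m = lam n"
  shows "m = n"
proof -
  have "top_coeff N * lam i < top_coeff N * lam j" if "i < j" "M \<le> i" for i j
    using that
  proof (induction j)
    case (Suc j)
    show ?case
    proof (cases "i = j")
      case True
      with Suc show ?thesis by (intro lam_strict_mono[THEN less_le_trans]) auto
    next
      case False
      with Suc have "top_coeff N * lam i < top_coeff N * lam j" by auto
      also have "\<dots> < top_coeff N * lam (Suc j)" using Suc by (intro lam_strict_mono) auto
      finally show ?thesis .
    qed
  qed auto
  with assms show ?thesis by (metis nat_neq_iff less_irrefl)
qed

end

section \<open>The contraction on zero sets\<close>

text \<open>Banach's argument for a pseudo-metric that sees only the first \<open>n\<close>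
  coordinates: the iterates converge coordinatewise, and the fixed point equation is obtained for
  these coordinates.\<close>

lemma l1_contraction_fixpoint:
  fixes F :: "(nat \<Rightarrow> real) \<Rightarrow> nat \<Rightarrow> real"
  assumes c: "0 \<le> c" "c < 1"
    and F: "\<And>a b. (\<Sum>i<n. \<bar>F a i - F b i\<bar>) \<le> c * (\<Sum>i<n. \<bar>a i - b i\<bar>)"
  obtains a where "\<And>i. i < n \<Longrightarrow> F a i = a i"
proof -
  define d where "d a b = (\<Sum>i<n. \<bar>a i - b i\<bar>)" for a b :: "nat \<Rightarrow> real"
  define x where "x k = (F ^^ k) (\<lambda>_. 0)" for k
  have step: "d (x (Suc k)) (x k) \<le> c ^ k * d (x 1) (x 0)" for k
  proof (induction k)
    case (Suc k)
    have "d (x (Suc (Suc k))) (x (Suc k)) \<le> c * d (x (Suc k)) (x k)"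
      using F[of "x (Suc k)" "x k"] by (simp add: d_def x_def)
    also have "\<dots> \<le> c * (c ^ k * d (x 1) (x 0))" using Suc c by (intro mult_left_mono)
    finally show ?case by simp
  qed simp
  have conv: "convergent (\<lambda>k. x k i)" if i: "i < n" for i
  proof -
    have bd: "\<bar>x (Suc k) i - x k i\<bar> \<le> c ^ k * d (x 1) (x 0)" for k
    proof -
      have "\<bar>x (Suc k) i - x k i\<bar> \<le> d (x (Suc k)) (x k)"
        unfolding d_def using i by (intro member_le_sum) auto
      with step[of k] show ?thesis by linarith
    qed
    have sm: "summable (\<lambda>k. c ^ k * d (x 1) (x 0))"
      by (rule summable_mult2, rule summable_geometric) (use c in simp)
    have "summable (\<lambda>k. x (Suc k) i - x k i)"
      by (rule summable_comparison_test'[OF sm, of 0]) (use bd in simp)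
    hence "convergent (\<lambda>k. (\<Sum>j<k. x (Suc j) i - x j i))" by (simp add: summable_iff_convergent)
    hence "convergent (\<lambda>k. x k i - x 0 i)" by (simp only: sum_lessThan_telescope[of "\<lambda>k. x k i"])
    thus ?thesis by (simp only: convergent_diff_const_right_iff)
  qed
  define a where "a i = lim (\<lambda>k. x k i)" for i
  have lim: "(\<lambda>k. d a (x k)) \<longlonglongrightarrow> (\<Sum>i<n. \<bar>a i - a i\<bar>)"
    unfolding d_def a_def using conv by (intro tendsto_intros) (auto simp: convergent_LIMSEQ_iff)
  have "d (F a) a \<le> c * d a (x k) + d a (x (Suc k))" for k
  proof -
    have "d (F a) a \<le> d (F a) (F (x k)) + d a (F (x k))"
      unfolding d_def sum.distrib[symmetric] by (intro sum_mono) auto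
    also have "d (F a) (F (x k)) \<le> c * d a (x k)" unfolding d_def by (rule F)
    finally show ?thesis by (simp add: x_def)
  qed
  moreover have "(\<lambda>k. c * d a (x k) + d a (x (Suc k))) \<longlonglongrightarrow> c * (\<Sum>i<n. \<bar>a i - a i\<bar>) + (\<Sum>i<n. \<bar>a i - a i\<bar>)"
    by (intro tendsto_intros lim LIMSEQ_Suc[OF lim])
  ultimately have "d (F a) a \<le> c * (\<Sum>i<n. \<bar>a i - a i\<bar>) + (\<Sum>i<n. \<bar>a i - a i\<bar>)"
    by (intro LIMSEQ_le_const) auto
  hence "d (F a) a \<le> 0" by simp
  moreover have "\<bar>F a i - a i\<bar> \<le> d (F a) a" if "i < n" for i
    unfolding d_def using that by (intro member_le_sum) auto
  ultimately have "F a i = a i" if "i < n" for i using that by (smt (verit))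
  thus ?thesis by (rule that)
qed

definition fpoly :: "nat \<Rightarrow> (nat \<Rightarrow> real) \<Rightarrow> real poly" where
  "fpoly n a = (\<Prod>i<n. [:- a i, 1:])"

lemma fpoly_mset: "fpoly n a = (\<Prod>x\<in>#image_mset a (mset_set {..<n}). [:- x, 1:])"
  by (simp add: fpoly_def prod_unfold_prod_mset image_mset.compositionality o_def)

lemma fpoly_simps [simp]:
  "degree (fpoly n a) = n" "lead_coeff (fpoly n a) = 1" "hyperbolic (fpoly n a)"
  "proots (fpoly n a) = image_mset a (mset_set {..<n})"
proof -
  show "degree (fpoly n a) = n" unfolding fpoly_mset degree_prod_linear by simp
  show "lead_coeff (fpoly n a) = 1" unfolding fpoly_mset lead_coeff_prod_linear by simp
  show "hyperbolic (fpoly n a)" unfolding fpoly_mset by (rule hyperbolic_prod_mset)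
  show "proots (fpoly n a) = image_mset a (mset_set {..<n})" unfolding fpoly_mset proots_prod_linear ..
qed

lemma coeff_fpoly [simp]: "coeff (fpoly n a) n = 1"
  using fpoly_simps(2)[of n a] by (simp only: fpoly_simps(1))

lemma fpoly_cong: "(\<And>i. i < n \<Longrightarrow> a i = b i) \<Longrightarrow> fpoly n a = fpoly n b"
  by (simp add: fpoly_def)

lemma fpoly_remove:
  assumes "k < n"
  shows "fpoly n a = [:- a k, 1:] * (\<Prod>i\<in>{..<n} - {k}. [:- a i, 1:])"
  unfolding fpoly_def using assms by (subst prod.remove[of _ k]) auto

lemma hyperbolic_linear_mult:
  assumes "hyperbolic h"
  shows "hyperbolic ([:c, d:] * h) \<or> [:c, d:] * h = 0"
proof (cases "d = 0")
  case True
  thus ?thesis using assms by (cases "c = 0") (auto simp: hyperbolic_smult)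
next
  case False
  hence eq: "[:c, d:] = smult d [:- (- c / d), 1:]" by simp
  show ?thesis unfolding eq mult_smult_left hyperbolic_smult[OF False] hyperbolic_mult_iff
    using assms hyperbolic_linear by blast
qed

context hyperbolic_operator
begin

lemma T_hyperbolic_degree:
  assumes "hyperbolic f" "M \<le> degree f"
  shows "hyperbolic (T f)" "degree (T f) = degree f + r" "lead_coeff (T f) = lam (degree f) * lead_coeff f"
  using assms T_hyperbolic[of f] T_nonzero[of f] degree_T[of f] lead_coeff_T[of f] lam_nonzero[of "degree f"]
    hyperbolic_nonzero[of f] by auto

text \<open>The pencil spanned by the images of \<open>(x - s) h\<close> and \<open>(x - t) h\<close> consists of hyperbolic
  polynomials and zero, so their quotient is never real off the real axis.\<close>

lemma T_pencil:
  assumes h: "hyperbolic h" "M \<le> Suc (degree h)"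
    and neq: "T ([:-s, 1:] * h) \<noteq> T ([:-t, 1:] * h)" and z: "Im z > 0"
  shows "Im (poly (cpoly (T ([:-t, 1:] * h))) z * cnj (poly (cpoly (T ([:-s, 1:] * h))) z)) \<noteq> 0"
proof
  define p q where "p = T ([:-s, 1:] * h)" and "q = T ([:-t, 1:] * h)"
  assume "Im (poly (cpoly (T ([:-t, 1:] * h))) z * cnj (poly (cpoly (T ([:-s, 1:] * h))) z)) = 0"
  hence im: "Im (poly (cpoly q) z * cnj (poly (cpoly p) z)) = 0" by (simp only: p_def q_def)
  have h0: "h \<noteq> 0" using h hyperbolic_nonzero by blast
  have deg: "degree ([:-u, 1:] * h) = Suc (degree h)" "hyperbolic ([:-u, 1:] * h)"
    "lead_coeff ([:-u, 1:] * h) = lead_coeff h" for u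
    using h h0 unfolding lead_coeff_mult
    by (simp_all add: degree_mult_eq hyperbolic_mult_iff del: mult_pCons_left)
  have p: "hyperbolic p" "degree p = Suc (degree h) + r" "lead_coeff p = lam (Suc (degree h)) * lead_coeff h"
    unfolding p_def by (rule T_hyperbolic_degree(1,2)[OF deg(2)[of s], unfolded deg(1), OF h(2)]
        T_hyperbolic_degree(3)[OF deg(2)[of s], unfolded deg(3), unfolded deg(1), OF h(2)])+
  have q: "hyperbolic q" "degree q = Suc (degree h) + r" "lead_coeff q = lam (Suc (degree h)) * lead_coeff h"
    unfolding q_def by (rule T_hyperbolic_degree(1,2)[OF deg(2)[of t], unfolded deg(1), OF h(2)]
        T_hyperbolic_degree(3)[OF deg(2)[of t], unfolded deg(3), unfolded deg(1), OF h(2)])+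
  have pz: "poly (cpoly p) z \<noteq> 0" using hyperbolic_rootD[OF p(1), of z] z by auto
  define w where "w = poly (cpoly q) z / poly (cpoly p) z"
  define \<tau> where "\<tau> = Re w"
  have "poly (cpoly q) z * cnj (poly (cpoly p) z) = w * of_real ((cmod (poly (cpoly p) z))\<^sup>2)"
    unfolding complex_norm_square w_def using pz by simp
  hence "Im w = 0" using im pz by simp
  hence "w = of_real \<tau>" by (simp add: \<tau>_def complex_eq_iff)
  hence root: "poly (cpoly (q - smult \<tau> p)) z = 0"
    using pz by (simp add: cpoly_diff cpoly_smult w_def field_simps)
  \<comment> \<open>Each member of the pencil is the image of \<open>h\<close> times a factor of
    degree at most one.\<close>
  have eq: "q - smult \<tau> p = T ([:- t + \<tau> * s, 1 - \<tau>:] * h)"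
    unfolding p_def q_def diff_op_smult[symmetric] diff_op_diff[symmetric]
    by (rule arg_cong[of _ _ T]) (simp add: poly_eq_iff coeff_pCons algebra_simps split: nat.splits)
  have "q - smult \<tau> p = 0"
  proof (rule ccontr)
    assume neq: "q - smult \<tau> p \<noteq> 0"
    hence "hyperbolic (q - smult \<tau> p)"
      using hyperbolic_linear_mult[OF h(1), of "- t + \<tau> * s" "1 - \<tau>"] unfolding eq
      by (metis T_hyperbolic diff_op_0)
    with root z hyperbolic_rootD show False by fastforce
  qed
  \<comment> \<open>Both images have the same nonzero leading coefficient, so proportional images
    coincide.\<close>
  hence qp: "q = smult \<tau> p" by simp
  hence "lead_coeff q = \<tau> * lead_coeff p" by simp
  hence "\<tau> * lead_coeff p = lead_coeff p" by (simp only: p(3) q(3))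
  moreover have "lead_coeff p \<noteq> 0" using hyperbolic_nonzero[OF p(1)] by simp
  ultimately have "\<tau> = 1" by simp
  with qp neq show False by (simp add: p_def q_def)
qed

text \<open>Distinct images interlace because of the pencil. This makes it possible to follow
  multiplicities while a zero of the argument is moved.\<close>

lemma order_T_move:
  assumes h: "hyperbolic h" "M \<le> Suc (degree h)"
  shows "order x (T ([:-s, 1:] * h)) \<le> order x (T ([:-t, 1:] * h)) + 1"
proof (cases "T ([:-s, 1:] * h) = T ([:-t, 1:] * h)")
  case False
  have h0: "h \<noteq> 0" using h hyperbolic_nonzero by blast
  have "hyperbolic (T ([:-u, 1:] * h))" for u
    using h h0 by (intro T_hyperbolic_degree) (simp_all add: degree_mult_eq hyperbolic_mult_iff del: mult_pCons_left)
  thus ?thesis using T_pencil[OF h False] by (intro order_interlace)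
qed simp

definition Trts :: "nat \<Rightarrow> (nat \<Rightarrow> real) \<Rightarrow> real list" where
  "Trts n a = rts (T (fpoly n a))"

lemma length_Trts: "M \<le> n \<Longrightarrow> length (Trts n a) = n + r"
  unfolding Trts_def using T_hyperbolic_degree[of "fpoly n a"] by (simp add: length_rts)

definition ratio :: "nat \<Rightarrow> real" where
  "ratio n = (case n of 0 \<Rightarrow> 0 | Suc m \<Rightarrow> lam m / lam n)"

lemma ratio_bounds: "M \<le> n \<Longrightarrow> 0 \<le> ratio n" "M \<le> n \<Longrightarrow> ratio n < 1"
  using lam_ratio by (auto simp: ratio_def split: nat.splits)

lemma sum_Trts:
  assumes "M \<le> n"
  shows "\<exists>d. \<forall>a. sum_list (Trts n a) = ratio n * (\<Sum>i<n. a i) + d"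
proof (cases n)
  case 0
  thus ?thesis by (auto simp: Trts_def fpoly_def ratio_def)
next
  case (Suc m)
  have "sum_list (Trts n a) = ratio n * (\<Sum>i<n. a i) + shift m" for a
    unfolding Trts_def sum_list_rts
    by (subst sum_proots_T[of "fpoly n a" m]) (use Suc lam_nonzero assms in \<open>auto simp: ratio_def sum_unfold_sum_mset\<close>)
  thus ?thesis by blast
qed

text \<open>The coordinates are changed one at a time, \<open>c k\<close> having the first
  \<open>k\<close> entries of \<open>b\<close>. In each step the two images interlace or coincide,
  and the sum law with its nonnegative slope shows that the zeros do not move to the left.\<close>

lemma Trts_mono:
  assumes M: "M \<le> n" and le: "\<And>i. i < n \<Longrightarrow> a i \<le> b i" and j: "j < n + r"
  shows "Trts n a ! j \<le> Trts n b ! j"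
proof -
  define c where "c k i = (if i < k then b i else a i)" for k i :: nat
  have "Trts n a ! j \<le> Trts n (c k) ! j" if "k \<le> n" for k
    using that
  proof (induction k)
    case 0
    thus ?case by (simp add: c_def)
  next
    case (Suc k)
    define h where "h = (\<Prod>i\<in>{..<n} - {k}. [:- c k i, 1:])"
    have k: "k < n" using Suc.prems by simp
    have h: "hyperbolic h" unfolding h_def by (rule hyperbolic_prod) simp
    have eq1: "fpoly n (c k) = [:- a k, 1:] * h"
      unfolding h_def using fpoly_remove[OF k, of "c k"] by (simp add: c_def)
    have "(\<Prod>i\<in>{..<n} - {k}. [:- c (Suc k) i, 1:]) = h"
      unfolding h_def by (intro prod.cong) (auto simp: c_def)
    hence eq2: "fpoly n (c (Suc k)) = [:- b k, 1:] * h"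
      using fpoly_remove[OF k, of "c (Suc k)"] by (simp add: c_def)
    have "n = degree ([:- a k, 1:] * h)" by (simp only: eq1[symmetric] fpoly_simps)
    hence dh: "n = Suc (degree h)" using hyperbolic_nonzero[OF h] by (simp add: degree_mult_eq del: mult_pCons_left)
    obtain d where d: "\<And>a. sum_list (Trts n a) = ratio n * (\<Sum>i<n. a i) + d" using sum_Trts[OF M] by blast
    have "(\<Sum>i<n. c k i) \<le> (\<Sum>i<n. c (Suc k) i)"
      using le by (intro sum_mono) (auto simp: c_def less_Suc_eq)
    hence sum: "sum_list (Trts n (c k)) \<le> sum_list (Trts n (c (Suc k)))"
      unfolding d using ratio_bounds[OF M] by (simp add: mult_left_mono)
    have hyp: "hyperbolic (T (fpoly n e))" "degree (T (fpoly n e)) = n + r" for e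
      using T_hyperbolic_degree[of "fpoly n e"] M by simp_all
    have "Trts n (c k) ! j \<le> Trts n (c (Suc k)) ! j"
    proof (cases "T (fpoly n (c k)) = T (fpoly n (c (Suc k)))")
      case True
      thus ?thesis by (simp add: Trts_def)
    next
      case False
      have "Im (poly (cpoly (T (fpoly n (c (Suc k))))) z * cnj (poly (cpoly (T (fpoly n (c k)))) z)) \<noteq> 0"
        if "Im z > 0" for z
        using T_pencil[OF h _ _ that] False M dh unfolding eq1 eq2 by simp
      thus ?thesis using rts_compare[of "T (fpoly n (c k))" "T (fpoly n (c (Suc k)))"] hyp sum j
        by (simp add: Trts_def)
    qed
    with Suc show ?case by simp
  qed
  from this[of n] have "Trts n a ! j \<le> Trts n (c n) ! j" by simp
  also have "fpoly n (c n) = fpoly n b" by (rule fpoly_cong) (simp add: c_def)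
  hence "Trts n (c n) = Trts n b" by (simp add: Trts_def)
  finally show ?thesis .
qed

lemma sum_Trts_diff:
  assumes "M \<le> n"
  shows "(\<Sum>j<n + r. Trts n b ! j - Trts n a ! j) = ratio n * (\<Sum>i<n. b i - a i)"
proof -
  obtain d where d: "\<And>a. sum_list (Trts n a) = ratio n * (\<Sum>i<n. a i) + d" using sum_Trts[OF assms] by blast
  have "(\<Sum>j<n + r. Trts n b ! j - Trts n a ! j) = sum_list (Trts n b) - sum_list (Trts n a)"
    by (simp add: sum_subtractf sum_list_sum_nth length_Trts[OF assms] atLeast0LessThan)
  thus ?thesis by (simp add: d sum_subtractf algebra_simps)
qed

text \<open>The dropped positions contribute nonnegative differences by monotonicity, and the sum
  over all positions is known exactly.\<close>

lemma Trts_select: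
  assumes M: "M \<le> n" and \<sigma>: "inj_on \<sigma> {..<n}" "\<sigma> ` {..<n} \<subseteq> {..<n + r}"
    and le: "\<And>i. i < n \<Longrightarrow> a i \<le> b i"
  shows "(\<Sum>i<n. Trts n b ! \<sigma> i - Trts n a ! \<sigma> i) \<le> ratio n * (\<Sum>i<n. b i - a i)"
proof -
  have "(\<Sum>i<n. Trts n b ! \<sigma> i - Trts n a ! \<sigma> i) = (\<Sum>j\<in>\<sigma> ` {..<n}. Trts n b ! j - Trts n a ! j)"
    using \<sigma>(1) by (simp add: sum.reindex)
  also have "\<dots> \<le> (\<Sum>j<n + r. Trts n b ! j - Trts n a ! j)"
    using \<sigma>(2) Trts_mono[OF M le] by (intro sum_mono2) auto
  finally show ?thesis unfolding sum_Trts_diff[OF M] .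
qed

text \<open>For arbitrary \<open>a\<close> and \<open>b\<close> compare with the pointwise minimum and maximum.\<close>

lemma Trts_contraction:
  assumes M: "M \<le> n" and \<sigma>: "inj_on \<sigma> {..<n}" "\<sigma> ` {..<n} \<subseteq> {..<n + r}"
  shows "(\<Sum>i<n. \<bar>Trts n a ! \<sigma> i - Trts n b ! \<sigma> i\<bar>) \<le> ratio n * (\<Sum>i<n. \<bar>a i - b i\<bar>)"
proof -
  define u l where "u i = max (a i) (b i)" and "l i = min (a i) (b i)" for i
  have "(\<Sum>i<n. \<bar>Trts n a ! \<sigma> i - Trts n b ! \<sigma> i\<bar>) \<le> (\<Sum>i<n. Trts n u ! \<sigma> i - Trts n l ! \<sigma> i)"
  proof (rule sum_mono)
    fix i assume "i \<in> {..<n}"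
    hence i: "\<sigma> i < n + r" using \<sigma>(2) by auto
    have "Trts n a ! \<sigma> i \<le> Trts n u ! \<sigma> i" "Trts n b ! \<sigma> i \<le> Trts n u ! \<sigma> i"
      "Trts n l ! \<sigma> i \<le> Trts n a ! \<sigma> i" "Trts n l ! \<sigma> i \<le> Trts n b ! \<sigma> i"
      by (intro Trts_mono M i; simp add: u_def l_def)+
    thus "\<bar>Trts n a ! \<sigma> i - Trts n b ! \<sigma> i\<bar> \<le> Trts n u ! \<sigma> i - Trts n l ! \<sigma> i" by linarith
  qed
  also have "\<dots> \<le> ratio n * (\<Sum>i<n. u i - l i)"
    by (rule Trts_select[OF M \<sigma>]) (simp add: u_def l_def)
  also have "(\<Sum>i<n. u i - l i) = (\<Sum>i<n. \<bar>a i - b i\<bar>)"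
    by (intro sum.cong) (auto simp: u_def l_def)
  finally show ?thesis .
qed

lemma Trts_fixpoint_unique:
  assumes M: "M \<le> n" and \<sigma>: "inj_on \<sigma> {..<n}" "\<sigma> ` {..<n} \<subseteq> {..<n + r}"
    and a: "\<And>i. i < n \<Longrightarrow> Trts n a ! \<sigma> i = a i" and b: "\<And>i. i < n \<Longrightarrow> Trts n b ! \<sigma> i = b i"
    and i: "i < n"
  shows "a i = b i"
proof -
  let ?d = "\<Sum>i<n. \<bar>a i - b i\<bar>"
  have "?d \<le> ratio n * ?d" using Trts_contraction[OF M \<sigma>, of a b] a b by simp
  moreover have "?d \<ge> 0" by (intro sum_nonneg) auto
  ultimately have "?d = 0"
    using ratio_bounds[OF M] by (metis mult_le_cancel_right1 order_antisym_conv not_le)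
  hence "\<forall>i\<in>{..<n}. \<bar>a i - b i\<bar> = 0" by (subst (asm) sum_nonneg_eq_0_iff) auto
  with i show ?thesis by auto
qed

text \<open>Cut \<open>a\<close> off at \<open>B\<close>. The map does not raise the cut vector
  \<open>l\<close> at the selected positions, so the nonnegative total of \<open>a - l\<close> is at
  most \<open>ratio n\<close> times itself and vanishes. Hence \<open>a\<close> is bounded by
  \<open>B\<close>, and monotonicity compares its image with that of the constant vector.\<close>

lemma Trts_fixpoint_le:
  assumes M: "M \<le> n" and \<sigma>: "inj_on \<sigma> {..<n}" "\<sigma> ` {..<n} \<subseteq> {..<n + r}"
    and a: "\<And>i. i < n \<Longrightarrow> Trts n a ! \<sigma> i = a i"
    and B: "\<And>j. j < n + r \<Longrightarrow> Trts n (\<lambda>_. B) ! j \<le> B" and j: "j < n + r"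
  shows "Trts n a ! j \<le> B"
proof -
  define l where "l i = min (a i) B" for i
  have le: "Trts n l ! \<sigma> i \<le> l i" if i: "i < n" for i
  proof -
    have si: "\<sigma> i < n + r" using \<sigma>(2) i by auto
    have "Trts n l ! \<sigma> i \<le> Trts n a ! \<sigma> i" "Trts n l ! \<sigma> i \<le> Trts n (\<lambda>_. B) ! \<sigma> i"
      by (intro Trts_mono M si; simp add: l_def)+
    with a[OF i] B[OF si] show ?thesis by (simp add: l_def)
  qed
  let ?d = "\<Sum>i<n. a i - l i"
  have "?d \<le> (\<Sum>i<n. Trts n a ! \<sigma> i - Trts n l ! \<sigma> i)" using a le by (intro sum_mono) fastforce
  also have "\<dots> \<le> ratio n * ?d" by (rule Trts_select[OF M \<sigma>]) (simp add: l_def)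
  finally have "?d \<le> ratio n * ?d" .
  moreover have "?d \<ge> 0" by (intro sum_nonneg) (auto simp: l_def)
  ultimately have "?d = 0"
    using ratio_bounds[OF M] by (metis mult_le_cancel_right1 order_antisym_conv not_le)
  hence "\<forall>i\<in>{..<n}. a i - l i = 0" by (subst (asm) sum_nonneg_eq_0_iff) (auto simp: l_def)
  hence "Trts n a ! j \<le> Trts n (\<lambda>_. B) ! j" by (intro Trts_mono M j) (auto simp: l_def min_def split: if_splits)
  with B[OF j] show ?thesis by linarith
qed

lemma Trts_fixpoint_ge:
  assumes M: "M \<le> n" and \<sigma>: "inj_on \<sigma> {..<n}" "\<sigma> ` {..<n} \<subseteq> {..<n + r}"
    and a: "\<And>i. i < n \<Longrightarrow> Trts n a ! \<sigma> i = a i"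
    and B: "\<And>j. j < n + r \<Longrightarrow> B \<le> Trts n (\<lambda>_. B) ! j" and j: "j < n + r"
  shows "B \<le> Trts n a ! j"
proof -
  define l where "l i = max (a i) B" for i
  have le: "l i \<le> Trts n l ! \<sigma> i" if i: "i < n" for i
  proof -
    have si: "\<sigma> i < n + r" using \<sigma>(2) i by auto
    have "Trts n a ! \<sigma> i \<le> Trts n l ! \<sigma> i" "Trts n (\<lambda>_. B) ! \<sigma> i \<le> Trts n l ! \<sigma> i"
      by (intro Trts_mono M si; simp add: l_def)+
    with a[OF i] B[OF si] show ?thesis by (simp add: l_def)
  qed
  let ?d = "\<Sum>i<n. l i - a i"
  have "?d \<le> (\<Sum>i<n. Trts n l ! \<sigma> i - Trts n a ! \<sigma> i)" using a le by (intro sum_mono) fastforce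
  also have "\<dots> \<le> ratio n * ?d" by (rule Trts_select[OF M \<sigma>]) (simp add: l_def)
  finally have "?d \<le> ratio n * ?d" .
  moreover have "?d \<ge> 0" by (intro sum_nonneg) (auto simp: l_def)
  ultimately have "?d = 0"
    using ratio_bounds[OF M] by (metis mult_le_cancel_right1 order_antisym_conv not_le)
  hence "\<forall>i\<in>{..<n}. l i - a i = 0" by (subst (asm) sum_nonneg_eq_0_iff) (auto simp: l_def)
  hence "B \<le> a i" if "i < n" for i
    using that by (metis l_def max.cobounded2 eq_iff_diff_eq_0 lessThan_iff)
  hence "Trts n (\<lambda>_. B) ! j \<le> Trts n a ! j" by (intro Trts_mono M j)
  with B[OF j] show ?thesis by linarith
qed

end

section \<open>Constant coefficient operators and multiplicities\<close>

text \<open>The operator p(D). Freezing the coefficients of \<open>T\<close> at a point gives such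
  an operator with the same value at that point (\<open>poly_cT_Dop\<close>,
  \<open>poly_T_Dop\<close>).\<close>

definition Dop :: "'a :: idom poly \<Rightarrow> 'a poly \<Rightarrow> 'a poly" where
  "Dop p g = (\<Sum>k\<le>degree p. smult (coeff p k) ((pderiv ^^ k) g))"

lemma Dop_altdef: "degree p \<le> n \<Longrightarrow> Dop p g = (\<Sum>k\<le>n. smult (coeff p k) ((pderiv ^^ k) g))"
  unfolding Dop_def by (intro sum.mono_neutral_left) (auto simp: coeff_eq_0)

lemma Dop_0 [simp]: "Dop 0 g = 0"
  by (simp add: Dop_def)

lemma pderiv_sum_eq: "pderiv (\<Sum>x\<in>A. f x) = (\<Sum>x\<in>A. pderiv (f x))"
  using higher_pderiv_sum[of 1 f A] by simp

lemma Dop_pCons: "Dop (pCons a p) g = smult a g + pderiv (Dop p g)"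
proof -
  have "Dop (pCons a p) g = (\<Sum>k\<le>Suc (degree p). smult (coeff (pCons a p) k) ((pderiv ^^ k) g))"
    by (rule Dop_altdef) simp
  thus ?thesis by (simp add: sum.atMost_Suc_shift Dop_def pderiv_sum_eq pderiv_smult del: sum.atMost_Suc)
qed

lemma Dop_add_left: "Dop (p + q) g = Dop p g + Dop q g"
proof -
  define n where "n = max (degree p) (degree q)"
  have "degree p \<le> n" "degree q \<le> n" "degree (p + q) \<le> n"
    by (auto simp: n_def intro: degree_add_le)
  thus ?thesis by (simp add: Dop_altdef[of _ n] smult_add_left sum.distrib)
qed

lemma Dop_smult_left: "Dop (smult c p) g = smult c (Dop p g)"
  by (induction p) (simp_all add: Dop_pCons smult_add_right pderiv_smult)

lemma Dop_add_right: "Dop p (g + h) = Dop p g + Dop p h"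
  by (induction p) (simp_all add: Dop_pCons smult_add_right pderiv_add)

lemma Dop_smult_right: "Dop p (smult c g) = smult c (Dop p g)"
  by (induction p) (simp_all add: Dop_pCons smult_add_right pderiv_smult mult.commute)

lemma pderiv_Dop: "pderiv (Dop p g) = Dop p (pderiv g)"
  by (induction p) (simp_all add: Dop_pCons pderiv_add pderiv_smult)

lemma Dop_linear_factor: "Dop ([:- w, 1:] * p) g = pderiv (Dop p g) - smult w (Dop p g)"
proof -
  have "[:- w, 1:] * p = smult (- w) p + pCons 0 p" by simp
  thus ?thesis by (simp only: Dop_add_left Dop_smult_left Dop_pCons) simp
qed

text \<open>The commutator of p(D) with multiplication by x is p'(D).\<close>

lemma Dop_mult_linear: "Dop p ([:- t, 1:] * g) = [:- t, 1:] * Dop p g + Dop (pderiv p) g"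
proof (induction p)
  case (pCons a p)
  define l where "l = [:- t, 1:]"
  have pd: "pderiv (l * x) = x + l * pderiv x" for x
    unfolding pderiv_mult by (simp add: l_def pderiv_pCons)
  show ?case
    unfolding Dop_pCons pderiv_pCons Dop_add_left l_def[symmetric] pCons.IH[folded l_def] pderiv_add pd
    by (simp add: algebra_simps)
qed simp

lemma cpoly_Dop: "cpoly (Dop p g) = Dop (cpoly p) (cpoly g)"
  by (simp add: Dop_def cpoly_sum cpoly_smult cpoly_higher_pderiv)

lemma Dop_eq_0: "(\<And>k. k \<le> degree g \<Longrightarrow> coeff p k = 0) \<Longrightarrow> Dop p g = 0"
  unfolding Dop_def by (intro sum.neutral) (metis higher_pderiv_eq_0 not_le smult_0_left smult_0_right)

text \<open>With \<open>m\<close> the least index of a nonzero coefficient of \<open>p\<close>, only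
  the m-th derivative contributes to the coefficient at \<open>degree g - m\<close>.\<close>

lemma Dop_nonzero:
  fixes p g :: "'a :: {idom, ring_char_0} poly"
  assumes g: "g \<noteq> 0" and k: "k \<le> degree g" "coeff p k \<noteq> 0"
  shows "Dop p g \<noteq> 0"
proof -
  define m where "m = (LEAST k. coeff p k \<noteq> 0)"
  have m: "coeff p m \<noteq> 0" "m \<le> k" unfolding m_def
    by (rule LeastI[of "\<lambda>k. coeff p k \<noteq> 0", OF k(2)], rule Least_le[of "\<lambda>k. coeff p k \<noteq> 0", OF k(2)])
  have below: "coeff p j = 0" if "j < m" for j
    using not_less_Least[of j "\<lambda>k. coeff p k \<noteq> 0"] that by (auto simp: m_def)
  have "coeff (Dop p g) (degree g - m) = (\<Sum>j\<le>degree p. coeff p j * coeff ((pderiv ^^ j) g) (degree g - m))"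
    by (simp add: Dop_def coeff_sum)
  also have "\<dots> = (\<Sum>j\<in>{m}. coeff p j * coeff ((pderiv ^^ j) g) (degree g - m))"
  proof (rule sum.mono_neutral_right)
    show "\<forall>j\<in>{..degree p} - {m}. coeff p j * coeff ((pderiv ^^ j) g) (degree g - m) = 0"
    proof
      fix j assume "j \<in> {..degree p} - {m}"
      hence "j < m \<or> degree g < degree g - m + j" using m k by auto
      thus "coeff p j * coeff ((pderiv ^^ j) g) (degree g - m) = 0"
        using below[of j] by (auto simp: coeff_higher_pderiv_binomial coeff_eq_0)
    qed
  qed (use m le_degree in auto)
  also have "\<dots> = coeff p m * (of_nat (fact m * (degree g choose m)) * lead_coeff g)"
    using m k by (simp add: coeff_higher_pderiv_binomial)
  also have "\<dots> \<noteq> 0" using m k g by (simp add: binomial_eq_0_iff)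
  finally show ?thesis by auto
qed

text \<open>With L = p'/p one has p''/p = L^2 + L', and L' is minus the sum of the squares of the
  terms of L.\<close>

lemma logderiv2:
  fixes p :: "complex poly"
  assumes "poly p z \<noteq> 0"
  shows "poly (pderiv (pderiv p)) z =
    poly p z * ((\<Sum>a\<in>#proots p. 1 / (z - a))\<^sup>2 - (\<Sum>a\<in>#proots p. (1 / (z - a))\<^sup>2))"
proof -
  have *: "poly (pderiv (pderiv (\<Prod>a\<in>#A. [:-a, 1:]))) z =
    poly (\<Prod>a\<in>#A. [:-a, 1:]) z * ((\<Sum>a\<in>#A. 1 / (z - a))\<^sup>2 - (\<Sum>a\<in>#A. (1 / (z - a))\<^sup>2))"
    if "z \<notin># A" for A
    using that
  proof (induction A)
    case (add a A)
    hence nz: "z - a \<noteq> 0" by auto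
    define P where "P = (\<Prod>a\<in>#A. [:-a, 1:])"
    define s where "s = (\<Sum>a\<in>#A. 1 / (z - a))"
    define t where "t = (\<Sum>a\<in>#A. (1 / (z - a))\<^sup>2)"
    have IH: "poly (pderiv (pderiv P)) z = poly P z * (s\<^sup>2 - t)" using add by (simp add: P_def s_def t_def)
    have "poly P z \<noteq> 0" using add.prems by (auto simp: P_def poly_prod_linear prod_mset_zero_iff)
    from logderiv[OF this] have 1: "poly (pderiv P) z = poly P z * s"
      by (simp add: P_def s_def)
    have "poly (pderiv (pderiv ([:-a, 1:] * P))) z = (z - a) * poly (pderiv (pderiv P)) z + 2 * poly (pderiv P) z"
      unfolding pderiv_mult pderiv_add by (simp add: pderiv_pCons algebra_simps)
    also have "\<dots> = (z - a) * poly P z * ((1 / (z - a) + s)\<^sup>2 - ((1 / (z - a))\<^sup>2 + t))"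
    proof -
      have "(1 / (z - a) + s)\<^sup>2 - ((1 / (z - a))\<^sup>2 + t) = 1 / (z - a) * (2 * s) + (s\<^sup>2 - t)"
        by (simp add: power2_sum)
      moreover have "(z - a) * poly P z * (1 / (z - a) * (2 * s) + (s\<^sup>2 - t)) =
          (z - a) * (poly P z * (s\<^sup>2 - t)) + 2 * (poly P z * s)"
        using nz by (simp add: distrib_left)
      ultimately show ?thesis by (simp only: IH 1)
    qed
    also have "\<dots> = poly ([:-a, 1:] * P) z * ((1 / (z - a) + s)\<^sup>2 - ((1 / (z - a))\<^sup>2 + t))"
      by (simp add: algebra_simps)
    finally show ?case
      by (simp only: P_def s_def t_def image_mset_add_mset prod_mset.add_mset sum_mset.add_mset)
  qed simp
  have "z \<notin># proots p" using assms by (cases "p = 0") auto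
  from *[OF this] have "poly (pderiv (pderiv (smult (lead_coeff p) (\<Prod>a\<in>#proots p. [:-a, 1:])))) z =
    poly (smult (lead_coeff p) (\<Prod>a\<in>#proots p. [:-a, 1:])) z *
      ((\<Sum>a\<in>#proots p. 1 / (z - a))\<^sup>2 - (\<Sum>a\<in>#proots p. (1 / (z - a))\<^sup>2))"
    by (simp add: pderiv_smult)
  thus ?thesis by (simp only: complex_poly_decompose_multiset)
qed

lemma order_ge_2:
  fixes p :: "'a :: {idom, ring_char_0} poly"
  assumes "p \<noteq> 0" "poly p x = 0" "poly (pderiv p) x = 0"
  shows "order x p \<ge> 2"
proof -
  have "pderiv p \<noteq> 0"
  proof
    assume "pderiv p = 0"
    then obtain c where "p = [:c:]" by (auto simp: pderiv_eq_0_iff elim: degree_eq_zeroE)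
    with assms show False by simp
  qed
  have o: "order x p \<noteq> 0" "order x (pderiv p) \<noteq> 0"
    using assms \<open>pderiv p \<noteq> 0\<close> by (auto simp: order_root)
  obtain q where q: "p = [:- x, 1:] ^ order x p * q" "\<not> [:- x, 1:] dvd q"
    using order_decomp[OF assms(1)] by blast
  show ?thesis
  proof (rule ccontr)
    assume "\<not> ?thesis"
    with o have "order x p = 1" by linarith
    with q have "p = [:- x, 1:] * q" by simp
    hence "poly (pderiv p) x = poly q x" by (simp add: pderiv_mult pderiv_pCons del: mult_pCons_left)
    with q(2) assms show False by (simp add: poly_eq_0_iff_dvd)
  qed
qed

lemma order_ge_2D:
  fixes p :: "'a :: {idom, ring_char_0} poly"
  assumes "order x p \<ge> 2"
  shows "poly p x = 0" "poly (pderiv p) x = 0"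
proof -
  have "[:- x, 1:] ^ 2 dvd p" using assms by (simp add: order_divides)
  then obtain q where "p = [:- x, 1:] ^ 2 * q" by (rule dvdE)
  hence "p = [:- x, 1:] * ([:- x, 1:] * q)" by (simp only: power2_eq_square mult.assoc)
  thus "poly p x = 0" "poly (pderiv p) x = 0"
    by (simp_all add: pderiv_mult pderiv_pCons del: mult_pCons_left)
qed

lemma sum_mset_negf: "(\<Sum>a\<in>#A. - f a) = - (\<Sum>a\<in>#A. f a :: 'b :: ab_group_add)"
  by (induction A) auto

lemma sum_mset_Im_nonpos: "(\<And>a. a \<in># A \<Longrightarrow> Im (f a) \<le> 0) \<Longrightarrow> Im (\<Sum>a\<in>#A. f a) \<le> 0"
  using sum_mset_Im_nonneg[of A "\<lambda>a. - f a"] by (simp add: sum_mset_negf)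

lemma sum_mset_real_squares:
  assumes "\<And>a. a \<in># A \<Longrightarrow> Im (f a) = 0 \<and> f a \<noteq> 0" "(\<Sum>a\<in>#A. (f a)\<^sup>2) = 0"
  shows "A = {#}"
proof (rule ccontr)
  assume "A \<noteq> {#}"
  have pos: "Re ((f a)\<^sup>2) > 0" if "a \<in># A" for a
  proof -
    have "Im (f a) = 0" "Re (f a) \<noteq> 0" using assms(1)[OF that] by (auto simp: complex_eq_iff)
    moreover from this have "Re (f a) * Re (f a) > 0" using not_real_square_gt_zero by blast
    ultimately show ?thesis by (simp add: power2_eq_square)
  qed
  have nn: "(\<And>a. a \<in># B \<Longrightarrow> Re ((f a)\<^sup>2) \<ge> 0) \<Longrightarrow> Re (\<Sum>a\<in>#B. (f a)\<^sup>2) \<ge> 0" for B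
    by (induction B) auto
  obtain a B where "A = add_mset a B" using \<open>A \<noteq> {#}\<close> by (cases A) auto
  moreover have "Re (\<Sum>a\<in>#B. (f a)\<^sup>2) \<ge> 0"
    using pos \<open>A = add_mset a B\<close> by (intro nn) (simp add: less_imp_le)
  moreover have "Re (\<Sum>a\<in>#A. (f a)\<^sup>2) = 0" using assms(2) by simp
  ultimately show False using pos[of a] by simp
qed

section \<open>The operator D - w on polynomials with zeros in a closed half-plane\<close>

context
  fixes g :: "complex poly" and s :: real and w :: complex
  assumes g: "\<And>z. poly g z = 0 \<Longrightarrow> Im z \<le> s" and w: "Im w \<ge> 0"
    and nz: "pderiv g - smult w g \<noteq> 0"
begin

lemma D_minus_logderiv:
  assumes "poly (pderiv g - smult w g) z = 0" "poly g z \<noteq> 0"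
  shows "(\<Sum>a\<in>#proots g. 1 / (z - a)) = w" "proots g \<noteq> {#}"
proof -
  show eq: "(\<Sum>a\<in>#proots g. 1 / (z - a)) = w"
    using assms logderiv[OF assms(2)] by simp
  show "proots g \<noteq> {#}"
  proof
    assume "proots g = {#}"
    hence "w = 0" "degree g = 0" using eq size_proots_complex[of g] by auto
    with nz show False by (simp add: pderiv_eq_0_iff)
  qed
qed

lemma proots_Im_le: "poly g z \<noteq> 0 \<Longrightarrow> a \<in># proots g \<Longrightarrow> Im a \<le> s"
  using g by (cases "g = 0") auto

text \<open>Above the line all terms 1/(z - a) have negative imaginary part, but at a zero their sum
  is \<open>w\<close>.\<close>

lemma D_minus_zeros:
  assumes "poly (pderiv g - smult w g) z = 0"
  shows "Im z \<le> s"
proof (rule ccontr)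
  assume neg: "\<not> ?thesis"
  hence gz: "poly g z \<noteq> 0" using g by auto
  have "Im (\<Sum>a\<in>#proots g. - (1 / (z - a))) > 0"
  proof (rule sum_mset_Im_pos)
    show "proots g \<noteq> {#}" by (rule D_minus_logderiv(2)[OF assms gz])
    fix a assume "a \<in># proots g"
    hence "Im a \<le> s" by (rule proots_Im_le[OF gz])
    with neg have "Im (1 / (z - a)) < 0" unfolding Im_inverse_diff
      by (intro divide_neg_pos) (auto simp: complex_eq_iff)
    thus "Im (- (1 / (z - a))) > 0" by simp
  qed
  hence "Im (\<Sum>a\<in>#proots g. 1 / (z - a)) < 0" by (simp add: sum_mset_negf)
  with D_minus_logderiv(1)[OF assms gz] w show False by simp
qed

text \<open>Otherwise the full power of the linear factor dividing \<open>g\<close> would also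
  divide the derivative of \<open>g\<close>.\<close>

lemma D_minus_order_pos:
  assumes "poly g \<xi> = 0"
  shows "order \<xi> (pderiv g - smult w g) \<le> order \<xi> g - 1"
proof (rule ccontr)
  assume "\<not> ?thesis"
  hence le: "order \<xi> g \<le> order \<xi> (pderiv g - smult w g)" by simp
  have g0: "g \<noteq> 0" using nz by auto
  hence o: "order \<xi> g \<noteq> 0" using assms by (simp add: order_root)
  have "[:- \<xi>, 1:] ^ order \<xi> g dvd pderiv g - smult w g" using le by (simp add: order_divides)
  moreover have "[:- \<xi>, 1:] ^ order \<xi> g dvd smult w g" by (intro dvd_smult order_1)
  ultimately have "[:- \<xi>, 1:] ^ order \<xi> g dvd pderiv g"
    by (metis diff_add_cancel dvd_add)
  moreover have "pderiv g \<noteq> 0"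
  proof
    assume "pderiv g = 0"
    then obtain c where "g = [:c:]" by (auto simp: pderiv_eq_0_iff elim: degree_eq_zeroE)
    with assms g0 show False by simp
  qed
  ultimately have "order \<xi> g \<le> order \<xi> (pderiv g)" by (simp add: order_divides)
  with order_pderiv[OF g0 assms] show False by simp
qed

text \<open>On the boundary line all terms 1/(\<xi> - a) have nonpositive imaginary part, so their
  sum cannot be \<open>w\<close> if \<open>Im w > 0\<close>. At a double zero the squares of the
  terms sum to 0 as well; the terms are then real and nonzero, so there are none.\<close>

lemma D_minus_order_zero:
  assumes \<xi>: "Im \<xi> = s" and g\<xi>: "poly g \<xi> \<noteq> 0"
  shows "order \<xi> (pderiv g - smult w g) \<le> 1"
    and "Im w > 0 \<Longrightarrow> poly (pderiv g - smult w g) \<xi> \<noteq> 0"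
proof -
  have nonpos: "Im (1 / (\<xi> - a)) \<le> 0" if "a \<in># proots g" for a
    using proots_Im_le[OF g\<xi> that] \<xi> unfolding Im_inverse_diff by (intro divide_nonpos_nonneg) auto
  show "poly (pderiv g - smult w g) \<xi> \<noteq> 0" if "Im w > 0"
    using sum_mset_Im_nonpos[of "proots g" "\<lambda>a. 1 / (\<xi> - a)", OF nonpos] D_minus_logderiv(1)[OF _ g\<xi>] that
    by fastforce
  show "order \<xi> (pderiv g - smult w g) \<le> 1"
  proof (rule ccontr)
    assume "\<not> ?thesis"
    hence "order \<xi> (pderiv g - smult w g) \<ge> 2" by simp
    from order_ge_2D[OF this] have q: "poly (pderiv g - smult w g) \<xi> = 0"
      "poly (pderiv (pderiv g)) \<xi> = w * poly (pderiv g) \<xi>"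
      by (simp_all add: pderiv_diff pderiv_smult)
    note S = D_minus_logderiv[OF q(1) g\<xi>]
    have "Im (\<Sum>a\<in>#proots g. - (1 / (\<xi> - a))) = - Im w"
      using S(1) by (simp add: sum_mset_negf)
    moreover have "Im (\<Sum>a\<in>#proots g. - (1 / (\<xi> - a))) \<ge> 0"
      using nonpos by (intro sum_mset_Im_nonneg) auto
    ultimately have "Im (\<Sum>a\<in>#proots g. - (1 / (\<xi> - a))) = 0" using w by linarith
    hence im: "Im (1 / (\<xi> - a)) = 0" if "a \<in># proots g" for a
      using sum_mset_Im_nonneg_eq_0[of "proots g" "\<lambda>a. - (1 / (\<xi> - a))" a] nonpos that by auto
    have "poly (pderiv g) \<xi> = poly g \<xi> * w" using logderiv[OF g\<xi>] S(1) by simp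
    hence "(\<Sum>a\<in>#proots g. (1 / (\<xi> - a))\<^sup>2) = 0"
      using q(2) g\<xi> unfolding logderiv2[OF g\<xi>] S(1) by (simp add: power2_eq_square algebra_simps)
    hence "proots g = {#}"
    proof (rule sum_mset_real_squares[rotated])
      fix a assume a: "a \<in># proots g"
      have "\<xi> \<noteq> a" using a g\<xi> by (cases "g = 0") auto
      with im[OF a] show "Im (1 / (\<xi> - a)) = 0 \<and> 1 / (\<xi> - a) \<noteq> 0" by simp
    qed
    with S(2) show False by simp
  qed
qed

end

lemma pderiv_hyperbolic: "hyperbolic p \<Longrightarrow> pderiv p \<noteq> 0 \<Longrightarrow> hyperbolic (pderiv p)"
proof (rule hyperbolicI)
  fix z assume p: "hyperbolic p" "pderiv p \<noteq> 0" and z: "Im z > 0"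
  have "pderiv (cpoly p) - smult 0 (cpoly p) \<noteq> 0" using p by (simp flip: cpoly_pderiv)
  from D_minus_zeros[OF _ _ this, of 0 z] hyperbolic_rootD[OF p(1)] z
  show "poly (cpoly (pderiv p)) z \<noteq> 0" by (auto simp: cpoly_pderiv)
qed

text \<open>The zeros of \<open>U\<close> are split off one by one. Each factor D - w lowers the
  multiplicity at \<open>\<xi>\<close> if there is a zero, and otherwise creates at most a simple
  one.\<close>

lemma Dop_upper:
  fixes U g :: "complex poly"
  assumes "\<And>z. poly U z = 0 \<Longrightarrow> Im z \<ge> 0" "\<And>z. poly g z = 0 \<Longrightarrow> Im z \<le> s" "Dop U g \<noteq> 0" "Im \<xi> = s"
  shows "(\<forall>z. poly (Dop U g) z = 0 \<longrightarrow> Im z \<le> s) \<and> order \<xi> (Dop U g) \<le> max (order \<xi> g - degree U) 1"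
  using assms(1,3)
proof (induction "degree U" arbitrary: U)
  case 0
  then obtain c where c: "U = [:c:]" by (metis degree_eq_zeroE)
  with 0 have "c \<noteq> 0" "Dop U g = smult c g" by (auto simp: Dop_pCons)
  with assms(2) c show ?case by (auto simp: order_smult)
next
  case (Suc n)
  then obtain w where "poly U w = 0"
    using alg_closed_imp_poly_has_root[of U] by auto
  then obtain V where V: "U = [:- w, 1:] * V" by (auto simp: poly_eq_0_iff_dvd elim: dvdE)
  have "V \<noteq> 0" using Suc.hyps(2) V by auto
  hence dV: "n = degree V" using Suc.hyps(2) V by (simp add: degree_mult_eq del: mult_pCons_left)
  have U: "Dop U g = pderiv (Dop V g) - smult w (Dop V g)" unfolding V Dop_linear_factor ..
  hence V0: "Dop V g \<noteq> 0" using Suc.prems(2) by auto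
  have IH: "\<And>z. poly (Dop V g) z = 0 \<Longrightarrow> Im z \<le> s" "order \<xi> (Dop V g) \<le> max (order \<xi> g - n) 1"
    using Suc.hyps(1)[OF dV _ V0] Suc.prems(1) dV unfolding V by auto
  have w: "Im w \<ge> 0" using Suc.prems(1)[of w] V by simp
  note nz = Suc.prems(2)[unfolded U]
  have "order \<xi> (Dop U g) \<le> max (order \<xi> (Dop V g) - 1) 1"
    using D_minus_order_pos[OF IH(1) w nz, of \<xi>] D_minus_order_zero(1)[OF IH(1) w nz assms(4)] unfolding U
    by (cases "poly (Dop V g) \<xi> = 0") auto
  with IH(2) D_minus_zeros[OF IH(1) w nz] Suc.hyps(2) show ?case unfolding U[symmetric] by auto
qed

lemma order_Dop_hyperbolic:
  assumes "hyperbolic U" "hyperbolic g" "Dop U g \<noteq> 0" "order \<theta> g \<le> 1"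
  shows "order \<theta> (Dop U g) \<le> 1"
proof -
  have "order (of_real \<theta>) (Dop (cpoly U) (cpoly g)) \<le> max (order (of_real \<theta>) (cpoly g) - degree (cpoly U)) 1"
    using assms(3) hyperbolic_rootD[OF assms(1)] hyperbolic_rootD[OF assms(2)]
    by (intro conjunct2[OF Dop_upper[where s = 0]]) (auto simp flip: cpoly_Dop)
  thus ?thesis using assms(3,4) hyperbolic_nonzero[OF assms(2)]
    by (simp add: order_cpoly flip: cpoly_Dop)
qed

text \<open>If every member vanished at \<open>\<theta>\<close>, so would \<open>A\<close> and
  \<open>B\<close>, and a suitable \<open>t\<close> would cancel the derivative too. The resulting
  double zero contradicts \<open>order_Dop_hyperbolic\<close>, since \<open>\<theta>\<close> is at
  most a simple zero of (x - t) h.\<close>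

lemma Dop_pencil_nonvanishing:
  assumes U: "hyperbolic U" "k \<le> Suc (degree h)" "coeff U k \<noteq> 0" and h: "hyperbolic h" "poly h \<theta> \<noteq> 0"
  shows "\<exists>t. poly (Dop U ([:- t, 1:] * h)) \<theta> \<noteq> 0"
proof (rule ccontr)
  assume "\<not> ?thesis"
  hence zero: "poly (Dop U ([:- t, 1:] * h)) \<theta> = 0" for t by blast
  define A B where "A = Dop U ([:0, 1:] * h)" and "B = Dop U h"
  have h0: "h \<noteq> 0" using h by auto
  have lin: "Dop U ([:- t, 1:] * h) = A - smult t B" for t
  proof -
    have "[:- t, 1:] * h = [:0, 1:] * h + smult (- t) h" by simp
    thus ?thesis by (simp only: Dop_add_right Dop_smult_right A_def B_def) simp
  qed
  have A0: "poly A \<theta> = 0" using zero[of 0] by (simp add: A_def)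
  have B0: "poly B \<theta> = 0" using zero[of 1] A0 unfolding lin by simp
  have deg: "degree ([:- t, 1:] * h) = Suc (degree h)" "[:- t, 1:] * h \<noteq> 0" for t
    using h0 by (simp_all add: degree_mult_eq del: mult_pCons_left)
  have pencil: "A - smult t B \<noteq> 0" for t
    unfolding lin[symmetric] using U(2,3) deg[of t] by (intro Dop_nonzero[of _ k]) auto
  show False
  proof (cases "B = 0")
    \<comment> \<open>The coefficients of \<open>U\<close> up to \<open>degree h\<close> then
      vanish, so \<open>A\<close> is constant; vanishing at \<open>\<theta>\<close>, it is
      zero.\<close>
    case True
    have low: "coeff U j = 0" if "j \<le> degree h" for j
      using Dop_nonzero[OF h0 that, of U] True by (auto simp: B_def)
    have "pderiv A = Dop U (pderiv ([:- 0, 1:] * h))" by (simp add: A_def pderiv_Dop)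
    also have "\<dots> = 0"
    proof (rule Dop_eq_0)
      fix j assume "j \<le> degree (pderiv ([:- 0, 1:] * h))"
      thus "coeff U j = 0" by (intro low) (simp only: degree_pderiv deg diff_Suc_1)
    qed
    finally obtain c where "A = [:c:]" by (auto simp: pderiv_eq_0_iff elim: degree_eq_zeroE)
    with A0 pencil[of 0] show False by simp
  next
    case False
    have "order \<theta> B \<le> 1"
      unfolding B_def using False h by (intro order_Dop_hyperbolic[OF U(1) h(1)]) (auto simp: B_def order_0I)
    hence B1: "poly (pderiv B) \<theta> \<noteq> 0" using order_ge_2[OF False B0] by linarith
    define t where "t = poly (pderiv A) \<theta> / poly (pderiv B) \<theta>"
    have "order \<theta> (A - smult t B) \<ge> 2"
      using A0 B0 B1 pencil[of t] by (intro order_ge_2) (auto simp: pderiv_diff pderiv_smult t_def)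
    moreover have "order \<theta> (A - smult t B) \<le> 1"
      unfolding lin[symmetric]
    proof (rule order_Dop_hyperbolic[OF U(1)])
      show "hyperbolic ([:- t, 1:] * h)" using h by (simp only: hyperbolic_mult_iff hyperbolic_linear simp_thms)
      show "Dop U ([:- t, 1:] * h) \<noteq> 0" using pencil[of t] by (simp only: lin simp_thms)
      have "order \<theta> ([:- t, 1:] * h) = order \<theta> [:- t, 1:] + order \<theta> h"
        by (rule order_mult[OF deg(2)])
      moreover have "order \<theta> [:- t, 1:] \<le> degree [:- t, 1:]" by (rule order_degree) simp
      ultimately show "order \<theta> ([:- t, 1:] * h) \<le> 1" using h by (simp add: order_0I)
    qed
    ultimately show False by linarith
  qed
qed

section \<open>Solutions are real, coprime and simple\<close>

lemma order_higher_pderiv: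
  fixes f :: "'a :: {idom, semiring_char_0} poly"
  assumes "f \<noteq> 0" "k \<le> order x f"
  shows "(pderiv ^^ k) f \<noteq> 0" "order x ((pderiv ^^ k) f) = order x f - k"
proof -
  have "(pderiv ^^ k) f \<noteq> 0 \<and> order x ((pderiv ^^ k) f) = order x f - k"
    using assms(2)
  proof (induction k)
    case (Suc k)
    hence IH: "(pderiv ^^ k) f \<noteq> 0" "order x ((pderiv ^^ k) f) = order x f - k" by auto
    hence root: "poly ((pderiv ^^ k) f) x = 0" using Suc.prems by (simp add: order_root)
    have "degree ((pderiv ^^ k) f) \<noteq> 0"
    proof
      assume "degree ((pderiv ^^ k) f) = 0"
      then obtain c where "(pderiv ^^ k) f = [:c:]" by (rule degree_eq_zeroE)
      with root IH show False by simp
    qed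
    hence "pderiv ((pderiv ^^ k) f) \<noteq> 0" by (simp add: pderiv_eq_0_iff)
    with order_pderiv[OF IH(1) root] IH(2) show ?case by simp
  qed (use assms in simp)
  thus "(pderiv ^^ k) f \<noteq> 0" "order x ((pderiv ^^ k) f) = order x f - k" by auto
qed

lemma map_cnj_mult: "map_poly cnj (p * q) = map_poly cnj p * map_poly cnj q"
  by (simp add: poly_eq_iff coeff_map_poly coeff_mult)

lemma map_cnj_sum: "map_poly cnj (\<Sum>x\<in>A. f x) = (\<Sum>x\<in>A. map_poly cnj (f x))"
  by (simp add: poly_eq_iff coeff_map_poly coeff_sum)

lemma map_cnj_higher_pderiv: "map_poly cnj ((pderiv ^^ k) p) = (pderiv ^^ k) (map_poly cnj p)"
  by (simp add: poly_eq_iff coeff_map_poly coeff_higher_pderiv_binomial)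

lemma map_cnj_cdiff_op: "map_poly cnj (cdiff_op N Q f) = cdiff_op N Q (map_poly cnj f)"
proof -
  have "map_poly cnj (cpoly q) = cpoly q" for q by (simp add: poly_eq_iff coeff_map_poly)
  thus ?thesis by (simp add: cdiff_op_def diff_op_def map_cnj_sum map_cnj_mult map_cnj_higher_pderiv)
qed

lemma hyperbolic_root_exists:
  assumes "hyperbolic p" "degree p > 0"
  obtains x where "poly p x = 0"
proof -
  have "proots p \<noteq> {#}" using size_proots_hyperbolic[OF assms(1)] assms(2) by auto
  then obtain x where "x \<in># proots p" by blast
  with hyperbolic_nonzero[OF assms(1)] that show ?thesis by auto
qed

context hyperbolic_operator
begin

lemma poly_cT_Dop: "poly (cT f) \<xi> = poly (Dop (symb \<xi>) f) \<xi>"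
  by (simp add: Dop_altdef[OF degree_symb_le] poly_sum coeff_symb cdiff_op_def diff_op_def)

lemma poly_T_Dop: "poly (T f) \<theta> = poly (Dop (rsymb \<theta>) f) \<theta>"
proof -
  have "degree (rsymb \<theta>) \<le> N" by (rule degree_le) (simp add: coeff_rsymb)
  thus ?thesis by (simp add: Dop_altdef[of _ N] poly_sum coeff_rsymb diff_op_def)
qed

text \<open>At a highest nonreal zero of \<open>f\<close> of multiplicity \<open>m\<close> the image \<open>T f\<close> vanishes to an
  order smaller than \<open>m\<close>.\<close>

lemma solution_zeros_lower:
  assumes MN: "M < N" and f: "f \<noteq> 0" "M \<le> degree f" and eq: "cT f = v * f" and z: "poly f z = 0"
  shows "Im z \<le> 0"
proof (rule ccontr)
  assume neg: "\<not> Im z \<le> 0"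
  define s where "s = Max (Im ` {z. poly f z = 0})"
  have fin: "finite (Im ` {z. poly f z = 0})" using f by (intro finite_imageI poly_roots_finite)
  have "s \<in> Im ` {z. poly f z = 0}" unfolding s_def using fin z by (intro Max_in) auto
  then obtain \<xi> where \<xi>: "Im \<xi> = s" "poly f \<xi> = 0" by auto
  have le_s: "Im w \<le> s" if "poly f w = 0" for w
    unfolding s_def using fin that by (intro Max_ge) auto
  with z neg \<xi> have pos: "Im \<xi> > 0" by fastforce
  define m where "m = order \<xi> f"
  have m: "m \<ge> 1" using f \<xi> by (simp add: m_def order_root Suc_le_eq)
  show False
  proof (cases "m \<le> N")
    case False
    \<comment> \<open>All terms below \<open>N\<close>, and also \<open>v * f\<close>, vanish to
      order at least \<open>m - N + 1\<close>. The term with \<open>Q N\<close> has order exactly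
      \<open>m - N\<close>, because \<open>Q N\<close> has no zero in the upper half-plane.\<close>
    let ?d = "[:- \<xi>, 1:] ^ (m - N + 1)"
    have "?d dvd cpoly (Q k) * (pderiv ^^ k) f" if "k < N" for k
    proof -
      have "m - N + 1 \<le> order \<xi> ((pderiv ^^ k) f)"
        using that False order_higher_pderiv(2)[OF f(1), of k \<xi>] by (simp add: m_def)
      hence "?d dvd (pderiv ^^ k) f" by (simp add: order_divides del: power_Suc)
      thus ?thesis by simp
    qed
    hence "?d dvd (\<Sum>k<N. cpoly (Q k) * (pderiv ^^ k) f)" by (intro dvd_sum) auto
    moreover have "m - N + 1 \<le> order \<xi> f" using False N_pos unfolding m_def by linarith
    hence "?d dvd f" unfolding order_divides by blast
    hence "?d dvd cT f" unfolding eq by simp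
    moreover have "cT f = (\<Sum>k<N. cpoly (Q k) * (pderiv ^^ k) f) + cpoly (Q N) * (pderiv ^^ N) f"
      by (simp add: cdiff_op_def diff_op_def flip: lessThan_Suc_atMost)
    ultimately have dvd: "?d dvd cpoly (Q N) * (pderiv ^^ N) f" by (simp only: dvd_add_right_iff)
    have nz: "cpoly (Q N) * (pderiv ^^ N) f \<noteq> 0"
      using Q_N_nonzero order_higher_pderiv(1)[OF f(1), of N \<xi>] False by (simp add: m_def)
    have "order \<xi> (cpoly (Q N)) = 0" using Q_N_upper_nonzero[OF pos] by (rule order_0I)
    hence "order \<xi> (cpoly (Q N) * (pderiv ^^ N) f) = m - N"
      using order_mult[OF nz] order_higher_pderiv(2)[OF f(1), of N \<xi>] False by (simp add: m_def)
    moreover have "m - N + 1 \<le> order \<xi> (cpoly (Q N) * (pderiv ^^ N) f)"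
      using dvd nz unfolding order_divides by blast
    ultimately show False by simp
  next
    case True
    define U where "U = symb \<xi>"
    have degU: "degree U = N" unfolding U_def
      using Q_N_upper_nonzero[OF pos] degree_symb_le by (intro antisym le_degree) (auto simp: coeff_symb)
    have cM: "coeff U M \<noteq> 0" using Q_ratio_upper(1)[OF pos order_refl] M_le_N by (simp add: U_def coeff_symb)
    have U0: "U \<noteq> 0" using cM by auto
    \<comment> \<open>Since \<open>M < N\<close> and coefficient \<open>M\<close> is nonzero,
      \<open>U\<close> is not a multiple of a power, so it has a nonzero zero \<open>w\<close>,
      strictly in the upper half-plane. Its factor is kept for last: the others reduce the
      multiplicity at \<open>\<xi>\<close> to at most 1, and D - w removes what is left.\<close>
    have "\<exists>w. w \<noteq> 0 \<and> poly U w = 0"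
    proof (rule ccontr)
      assume "\<not> ?thesis"
      hence "set_mset (proots U) \<subseteq> {0}" using U0 by auto
      hence "proots U = replicate_mset N 0"
        by (metis set_mset_subset_singletonD size_proots_complex degU)
      hence "U = smult (lead_coeff U) (\<Prod>x\<in>#replicate_mset N 0. [:- x, 1:])"
        using complex_poly_decompose_multiset[of U] by simp
      also have "(\<Prod>x\<in>#replicate_mset N 0. [:- x, 1:]) = monom (1 :: complex) N"
        by (simp add: monom_altdef)
      finally have "coeff U M = lead_coeff U * coeff (monom 1 N) M" by (metis coeff_smult)
      with cM MN show False by simp
    qed
    then obtain w where w: "w \<noteq> 0" "poly U w = 0" by blast
    hence Imw: "Im w > 0" using symb_root_upper[OF pos w(1)] by (force simp: U_def)
    obtain V where V: "U = [:- w, 1:] * V" using w(2) by (auto simp: poly_eq_0_iff_dvd elim: dvdE)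
    have "V \<noteq> 0" using U0 V by auto
    hence dV: "N = Suc (degree V)" using degU V by (simp add: degree_mult_eq del: mult_pCons_left)
    have U: "Dop U f = pderiv (Dop V f) - smult w (Dop V f)" unfolding V Dop_linear_factor ..
    have nzU: "Dop U f \<noteq> 0" using f cM by (intro Dop_nonzero) auto
    hence nzV: "Dop V f \<noteq> 0" using U by auto
    have "Im u \<ge> 0" if "poly V u = 0" for u
    proof (rule ccontr)
      assume neg: "\<not> Im u \<ge> 0"
      have "poly U u = 0" using V that by simp
      moreover have "poly U u \<noteq> 0" unfolding U_def using neg by (intro symb_root_upper[OF pos]) auto
      ultimately show False by contradiction
    qed
    from Dop_upper[OF this le_s nzV \<xi>(1)]
    have V: "\<And>z. poly (Dop V f) z = 0 \<Longrightarrow> Im z \<le> s" "order \<xi> (Dop V f) \<le> 1"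
      using True dV by (auto simp: m_def)
    have "poly (Dop U f) \<xi> \<noteq> 0"
    proof (cases "poly (Dop V f) \<xi> = 0")
      case True
      have "order \<xi> (Dop U f) \<le> order \<xi> (Dop V f) - 1"
        unfolding U by (rule D_minus_order_pos[OF V(1)]) (use Imw nzU U True in auto)
      with V(2) nzU show ?thesis by (simp add: order_root)
    next
      case False
      show ?thesis unfolding U
        by (rule D_minus_order_zero(2)[OF V(1)]) (use Imw nzU U \<xi> False in auto)
    qed
    hence "poly (cT f) \<xi> \<noteq> 0" by (simp add: poly_cT_Dop U_def)
    with eq \<xi> show False by simp
  qed
qed

text \<open>Complex conjugation turns a solution into a solution, so the zeros of \<open>f\<close>
  lie in both closed half-planes. The zeros of \<open>v\<close> are zeros of the image of a
  hyperbolic polynomial, and its leading coefficient is a value of \<open>lam\<close>.\<close>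

lemma solution_real:
  assumes MN: "M < N" and f: "lead_coeff f = 1" "M \<le> degree f" and eq: "cT f = v * f"
  obtains v' f' where "v = cpoly v'" "f = cpoly f'" "hyperbolic v'" "hyperbolic f'" "T f' = v' * f'"
    "degree v' = r" "lead_coeff f' = 1"
proof -
  have f0: "f \<noteq> 0" using f by auto
  have "Im z = 0" if z: "poly f z = 0" for z
  proof -
    have eq': "cT (map_poly cnj f) = map_poly cnj v * map_poly cnj f"
      by (simp only: eq map_cnj_mult flip: map_cnj_cdiff_op)
    have deg: "degree (map_poly cnj f) = degree f" by (simp add: degree_map_poly)
    have "map_poly cnj f \<noteq> 0" using f0 by (simp add: poly_eq_iff coeff_map_poly)
    hence "Im (cnj z) \<le> 0" using solution_zeros_lower[OF MN _ _ eq', of "cnj z"] f(2) deg z by simp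
    moreover have "Im z \<le> 0" by (rule solution_zeros_lower[OF MN f0 f(2) eq z])
    ultimately show ?thesis by simp
  qed
  then obtain f' where f': "f = cpoly f'" using real_rooted_complex_poly[of f] f by auto
  have "f' \<noteq> 0" using f0 f' by auto
  hence hf: "hyperbolic f'" using \<open>\<And>z. poly f z = 0 \<Longrightarrow> Im z = 0\<close> f' by (auto simp: hyperbolic_def complex_is_Real_iff)
  have M: "M \<le> degree f'" using f(2) f' by simp
  have lf: "lead_coeff f' = 1" using f(1) f' by simp
  note Tf = T_hyperbolic_degree[OF hf M]
  have cTf: "cpoly (T f') = v * cpoly f'" using eq f' by (simp add: cdiff_op_cpoly)
  have "lead_coeff v * lead_coeff (cpoly f') = lead_coeff (cpoly (T f'))"
    by (simp only: cTf lead_coeff_mult)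
  hence "lead_coeff v = of_real (lam (degree f'))" using Tf(3) lf by simp
  moreover have "Im z = 0" if "poly v z = 0" for z
    using hyperbolic_rootD[OF Tf(1), of z] cTf that by simp
  ultimately obtain v' where v': "v = cpoly v'" using real_rooted_complex_poly[of v] by auto
  have Tv: "T f' = v' * f'" using cTf unfolding v' by (simp flip: cpoly_mult)
  hence hv: "hyperbolic v'" using Tf(1) hyperbolic_mult_iff by metis
  have "degree v' = r"
    using Tf(2) hf hv by (simp add: Tv degree_mult_eq hyperbolic_nonzero)
  thus ?thesis using that v' f' hv hf Tv lf by blast
qed

text \<open>The zeros are moved away from \<open>\<theta>\<close> one at a time, each move costing
  at most one in multiplicity. The target \<open>\<theta> + 1\<close> is merely some other
  point.\<close>

lemma order_T_shift:
  assumes g: "hyperbolic g" and M: "M \<le> a + b + degree g"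
  shows "order \<theta> (T ([:- \<theta>, 1:] ^ (a + b) * g)) \<le> order \<theta> (T ([:- \<theta>, 1:] ^ a * ([:- (\<theta> + 1), 1:] ^ b * g))) + b"
  using M g
proof (induction b arbitrary: g)
  case (Suc b)
  define g' where "g' = [:- (\<theta> + 1), 1:] * g"
  have g0: "g \<noteq> 0" using Suc.prems hyperbolic_nonzero by blast
  have g': "hyperbolic g'" "degree g' = Suc (degree g)"
    unfolding g'_def using Suc.prems g0 hyperbolic_linear[of "\<theta> + 1"]
    by (simp_all add: hyperbolic_mult_iff degree_mult_eq del: mult_pCons_left hyperbolic_linear)
  define h where "h = [:- \<theta>, 1:] ^ (a + b) * g"
  have h: "hyperbolic h" "degree h = a + b + degree g"
    unfolding h_def using Suc.prems g0
    by (simp_all add: hyperbolic_mult_iff hyperbolic_power degree_mult_eq degree_power_eq)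
  have "order \<theta> (T ([:- \<theta>, 1:] ^ (a + Suc b) * g)) = order \<theta> (T ([:- \<theta>, 1:] * h))"
    by (simp only: h_def add_Suc_right power_Suc mult.assoc)
  also have "\<dots> \<le> order \<theta> (T ([:- (\<theta> + 1), 1:] * h)) + 1"
    using Suc.prems h by (intro order_T_move) auto
  also have "[:- (\<theta> + 1), 1:] * h = [:- \<theta>, 1:] ^ (a + b) * g'"
    by (simp only: h_def g'_def mult.left_commute)
  also have "order \<theta> (T ([:- \<theta>, 1:] ^ (a + b) * g')) \<le> order \<theta> (T ([:- \<theta>, 1:] ^ a * ([:- (\<theta> + 1), 1:] ^ b * g'))) + b"
    using Suc.prems g' by (intro Suc.IH) auto
  also have "[:- (\<theta> + 1), 1:] ^ b * g' = [:- (\<theta> + 1), 1:] ^ Suc b * g"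
    by (simp only: g'_def power_Suc mult.left_commute mult.assoc)
  finally show ?case by simp
qed simp

text \<open>A double zero of one image leaves a zero at \<open>\<theta>\<close> wherever the moved
  zero is put. With coefficients frozen at \<open>\<theta>\<close> this is a pencil excluded by
  \<open>Dop_pencil_nonvanishing\<close>.\<close>

lemma T_double_root_False:
  assumes h: "hyperbolic h" "poly h \<theta> \<noteq> 0" "M \<le> Suc (degree h)"
    and k: "k \<le> N" "k \<le> Suc (degree h)" "poly (Q k) \<theta> \<noteq> 0"
    and ord: "order \<theta> (T ([:- s, 1:] * h)) \<ge> 2"
  shows False
proof -
  have "rsymb \<theta> \<noteq> 0" using k by (metis coeff_rsymb coeff_0)
  hence U: "hyperbolic (rsymb \<theta>)" by (rule hyperbolic_rsymb)
  have "poly (Dop (rsymb \<theta>) ([:- t, 1:] * h)) \<theta> = 0" for t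
  proof -
    have "order \<theta> (T ([:- t, 1:] * h)) \<noteq> 0" using order_T_move[OF h(1,3), of \<theta> s t] ord by linarith
    hence "poly (T ([:- t, 1:] * h)) \<theta> = 0" by (simp add: order_root)
    thus ?thesis by (simp only: poly_T_Dop)
  qed
  with Dop_pencil_nonvanishing[OF U k(2) _ h(1,2)] k show False by (simp add: coeff_rsymb del: mult_pCons_left)
qed

lemma order_power_factor:
  assumes "hyperbolic f" "poly f \<theta> = 0"
  obtains g where "f = [:- \<theta>, 1:] ^ order \<theta> f * g" "hyperbolic g" "poly g \<theta> \<noteq> 0"
    "degree f = order \<theta> f + degree g" "order \<theta> f \<ge> 1"
proof -
  have f0: "f \<noteq> 0" using assms hyperbolic_nonzero by blast
  obtain g where g: "f = [:- \<theta>, 1:] ^ order \<theta> f * g" "\<not> [:- \<theta>, 1:] dvd g"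
    using order_decomp[OF f0] by blast
  have "hyperbolic g" using assms(1) g(1) hyperbolic_mult_iff by metis
  moreover have "g \<noteq> 0" using g by auto
  hence "degree f = order \<theta> f + degree g" by (subst g(1)) (simp add: degree_mult_eq degree_power_eq)
  moreover have "order \<theta> f \<ge> 1" using assms f0 by (simp add: order_root Suc_le_eq)
  ultimately show ?thesis using that g by (metis poly_eq_0_iff_dvd)
qed

context
  fixes n :: nat
  assumes no_common: "\<And>\<theta>. \<exists>k\<le>n. k \<le> N \<and> poly (Q k) \<theta> \<noteq> 0"
begin

lemma M_le_n: "M \<le> n"
proof -
  obtain k where "k \<le> n" "poly (Q k) 0 \<noteq> 0" using no_common by blast
  with Q_below_M[of k] show ?thesis by (cases "k < M") auto
qed

text \<open>Otherwise \<open>Q N\<close> would be the only nonzero coefficient, and its degree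
  \<open>N + r\<close> is positive, so it has a real zero.\<close>

lemma M_less_N: "M < N"
proof (rule ccontr)
  assume "\<not> ?thesis"
  hence "M = N" using M_le_N by simp
  have "hyperbolic (Q N)" "degree (Q N) > 0" using hyperbolic_Q[of N] M_le_N degree_Q_N N_pos by auto
  then obtain \<theta> where \<theta>: "poly (Q N) \<theta> = 0" by (rule hyperbolic_root_exists)
  obtain k where "k \<le> N" "poly (Q k) \<theta> \<noteq> 0" using no_common by blast
  with \<theta> \<open>M = N\<close> Q_below_M[of k] show False by (cases "k = N") auto
qed

text \<open>At a common zero the image has a higher multiplicity than \<open>f\<close>. Moving all
  but one copy of \<open>\<theta>\<close> away leaves a double zero of the image over a simple zero
  of the argument.\<close>

lemma solution_no_common_zero:
  assumes f: "hyperbolic f" "degree f = n" and eq: "T f = v * f" and root: "poly f \<theta> = 0"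
  shows "poly v \<theta> \<noteq> 0"
proof
  assume v: "poly v \<theta> = 0"
  obtain g where g: "f = [:- \<theta>, 1:] ^ order \<theta> f * g" "hyperbolic g" "poly g \<theta> \<noteq> 0"
    "degree f = order \<theta> f + degree g" "order \<theta> f \<ge> 1" using order_power_factor[OF f(1) root] by blast
  obtain b where b: "order \<theta> f = 1 + b" using g(5) by (metis le_Suc_ex plus_1_eq_Suc)
  have "hyperbolic (T f)" using T_hyperbolic_degree f M_le_n by simp
  hence nz: "v * f \<noteq> 0" using eq hyperbolic_nonzero by metis
  hence "order \<theta> v \<ge> 1" using v by (auto simp: order_root Suc_le_eq)
  hence "2 + b \<le> order \<theta> (T f)" unfolding eq order_mult[OF nz] b by simp
  also have "\<dots> \<le> order \<theta> (T ([:- \<theta>, 1:] ^ 1 * ([:- (\<theta> + 1), 1:] ^ b * g))) + b"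
    using order_T_shift[OF g(2), of 1 b \<theta>] g(4) M_le_n f(2) unfolding g(1)[unfolded b, symmetric] b by simp
  finally have ord: "2 \<le> order \<theta> (T ([:- \<theta>, 1:] * ([:- (\<theta> + 1), 1:] ^ b * g)))" by simp
  define h where "h = [:- (\<theta> + 1), 1:] ^ b * g"
  have "degree h = b + degree g" "hyperbolic h" "poly h \<theta> \<noteq> 0"
    using g hyperbolic_linear[of "\<theta> + 1"] unfolding h_def
    by (auto simp: degree_mult_eq degree_power_eq hyperbolic_mult_iff hyperbolic_power dest: hyperbolic_nonzero simp del: hyperbolic_linear)
  moreover obtain k where "k \<le> n" "k \<le> N" "poly (Q k) \<theta> \<noteq> 0" using no_common by blast
  ultimately show False
    using T_double_root_False[of h \<theta> k \<theta>] ord g(4) b f(2) M_le_n by (simp add: h_def)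
qed

text \<open>At a double zero of \<open>v\<close> the polynomial \<open>f\<close> does not vanish, so
  any zero \<open>b\<close> of \<open>f\<close> can serve as the moving one.\<close>

lemma solution_v_simple:
  assumes f: "hyperbolic f" "degree f = n" and n: "n \<ge> 1" and eq: "T f = v * f"
  shows "order \<theta> v \<le> 1"
proof (rule ccontr)
  assume neg: "\<not> ?thesis"
  have "hyperbolic (T f)" using T_hyperbolic_degree f M_le_n by simp
  hence nz: "v * f \<noteq> 0" using eq hyperbolic_nonzero by metis
  hence v0: "poly v \<theta> = 0" using neg by (simp add: order_root)
  obtain b where b: "poly f b = 0" using hyperbolic_root_exists[OF f(1)] f(2) n by auto
  then obtain h where h: "f = [:- b, 1:] * h" by (auto simp: poly_eq_0_iff_dvd elim: dvdE)
  have "hyperbolic h" using f(1) unfolding h hyperbolic_mult_iff by simp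
  moreover have "h \<noteq> 0" using nz h by auto
  hence "n = Suc (degree h)" using f(2) h by (simp add: degree_mult_eq del: mult_pCons_left)
  moreover have "poly f \<theta> \<noteq> 0" using solution_no_common_zero[OF f eq, of \<theta>] v0 by auto
  hence "poly h \<theta> \<noteq> 0" using h by auto
  moreover have "2 \<le> order \<theta> (T ([:- b, 1:] * h))"
    using neg unfolding h[symmetric] eq order_mult[OF nz] by simp
  moreover obtain k where "k \<le> n" "k \<le> N" "poly (Q k) \<theta> \<noteq> 0" using no_common by blast
  ultimately show False using T_double_root_False[of h \<theta> k b] M_le_n by simp
qed

lemma solution_f_simple:
  assumes f: "hyperbolic f" "degree f = n" and eq: "T f = v * f"
    and k: "1 \<le> k" "k \<le> n" "k \<le> N" "poly (Q k) \<theta> \<noteq> 0"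
  shows "order \<theta> f \<le> 1"
proof (rule ccontr)
  assume neg: "\<not> ?thesis"
  hence root: "poly f \<theta> = 0" using hyperbolic_nonzero[OF f(1)] by (simp add: order_root)
  obtain g where g: "f = [:- \<theta>, 1:] ^ order \<theta> f * g" "hyperbolic g" "poly g \<theta> \<noteq> 0"
    "degree f = order \<theta> f + degree g" "order \<theta> f \<ge> 1" using order_power_factor[OF f(1) root] by blast
  obtain b where b: "order \<theta> f = 2 + b" using neg by (metis le_Suc_ex not_less_eq_eq numeral_2_eq_2 One_nat_def)
  have "hyperbolic (T f)" using T_hyperbolic_degree f M_le_n by simp
  hence nz: "v * f \<noteq> 0" using eq hyperbolic_nonzero by metis
  hence "2 + b \<le> order \<theta> (T f)" unfolding eq order_mult[OF nz] b by simp
  also have "\<dots> \<le> order \<theta> (T ([:- \<theta>, 1:] ^ 2 * ([:- (\<theta> + 1), 1:] ^ b * g))) + b"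
    using order_T_shift[OF g(2), of 2 b \<theta>] g(4) M_le_n f(2) unfolding g(1)[unfolded b, symmetric] b by simp
  finally have ord: "2 \<le> order \<theta> (T ([:- \<theta>, 1:] ^ 2 * ([:- (\<theta> + 1), 1:] ^ b * g)))" by simp
  define h where "h = [:- (\<theta> + 1), 1:] ^ b * g"
  have h: "degree h = b + degree g" "hyperbolic h" "poly h \<theta> \<noteq> 0"
    using g hyperbolic_linear[of "\<theta> + 1"] unfolding h_def
    by (auto simp: degree_mult_eq degree_power_eq hyperbolic_mult_iff hyperbolic_power dest: hyperbolic_nonzero simp del: hyperbolic_linear)
  have h0: "h \<noteq> 0" using h by auto
  have ord': "2 \<le> order \<theta> (T ([:- \<theta>, 1:] * ([:- \<theta>, 1:] * h)))"
    using ord by (simp only: h_def power2_eq_square mult.assoc)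
  define h2 where "h2 = [:- \<theta>, 1:] * h"
  have h2: "hyperbolic h2" "degree h2 = Suc (degree h)"
    unfolding h2_def using h h0 by (simp_all add: hyperbolic_mult_iff degree_mult_eq del: mult_pCons_left)
  have M2: "M \<le> Suc (degree h2)" using M_le_n f(2) g(4) b h(1) h2(2) by simp
  have zero: "poly (Dop (pderiv (rsymb \<theta>)) ([:- t, 1:] * h)) \<theta> = 0" for t
  proof -
    have "order \<theta> (T ([:- t, 1:] * h2)) \<noteq> 0"
      using order_T_move[OF h2(1) M2, of \<theta> \<theta> t] ord' unfolding h2_def by linarith
    hence "poly (T ([:- t, 1:] * h2)) \<theta> = 0" by (simp add: order_root)
    hence "poly (Dop (rsymb \<theta>) ([:- t, 1:] * h2)) \<theta> = 0" by (simp only: poly_T_Dop)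
    also have "[:- t, 1:] * h2 = [:- \<theta>, 1:] * ([:- t, 1:] * h)" by (simp only: h2_def mult.left_commute)
    finally show ?thesis unfolding Dop_mult_linear[of _ \<theta>] by simp
  qed
  have "rsymb \<theta> \<noteq> 0" using k by (metis coeff_rsymb coeff_0)
  hence U: "hyperbolic (rsymb \<theta>)" by (rule hyperbolic_rsymb)
  have c: "coeff (pderiv (rsymb \<theta>)) (k - 1) \<noteq> 0"
    using k by (cases k) (auto simp: coeff_pderiv coeff_rsymb)
  hence "pderiv (rsymb \<theta>) \<noteq> 0" by auto
  hence "hyperbolic (pderiv (rsymb \<theta>))" by (rule pderiv_hyperbolic[OF U])
  moreover have "k - 1 \<le> Suc (degree h)" using k(2) f(2) g(4) b h(1) by simp
  ultimately show False using Dop_pencil_nonvanishing[OF _ _ c h(2,3)] zero by blast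
qed

end

end

section \<open>Location of the zeros\<close>

lemma higher_pderiv_linear_mult:
  "(pderiv ^^ Suc k) ([:- a, 1:] * h) = [:- a, 1:] * (pderiv ^^ Suc k) h + smult (of_nat (Suc k)) ((pderiv ^^ k) h)"
proof (induction k)
  case 0
  show ?case by (simp add: pderiv_mult pderiv_pCons del: mult_pCons_left)
next
  case (Suc k)
  have "(pderiv ^^ Suc (Suc k)) ([:- a, 1:] * h) = pderiv ((pderiv ^^ Suc k) ([:- a, 1:] * h))" by simp
  also have "\<dots> = pderiv ([:- a, 1:] * (pderiv ^^ Suc k) h) + smult (of_nat (Suc k)) ((pderiv ^^ Suc k) h)"
    unfolding Suc.IH pderiv_add pderiv_smult by simp
  also have "pderiv ([:- a, 1:] * (pderiv ^^ Suc k) h) =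
      [:- a, 1:] * (pderiv ^^ Suc (Suc k)) h + (pderiv ^^ Suc k) h"
    unfolding pderiv_mult by (simp add: pderiv_pCons del: mult_pCons_left)
  finally show ?case by (simp add: smult_add_left add.assoc del: funpow.simps mult_pCons_left)
qed

text \<open>The sign \<open>\<epsilon>\<close> selects the side of \<open>x\<close> on which the zeros lie.\<close>

lemma prod_linear_sign_weak:
  fixes \<epsilon> x :: real
  assumes "\<epsilon> = 1 \<or> \<epsilon> = -1" "\<And>a. a \<in># A \<Longrightarrow> \<epsilon> * (x - a) \<ge> 0"
  shows "\<epsilon> ^ (size A + k) * poly ((pderiv ^^ k) (\<Prod>a\<in>#A. [:- a, 1:])) x \<ge> 0"
  using assms(2)
proof (induction A arbitrary: k)
  case empty
  show ?case by (cases k) (auto simp: higher_pderiv_eq_0 simp del: funpow.simps)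
next
  case (add a A)
  define h where "h = (\<Prod>a\<in>#A. [:- a, 1:])"
  have IH: "\<epsilon> ^ (size A + k) * poly ((pderiv ^^ k) h) x \<ge> 0" for k using add by (simp add: h_def)
  have a: "\<epsilon> * (x - a) \<ge> 0" using add.prems by simp
  show ?case
  proof (cases k)
    case 0
    thus ?thesis using mult_nonneg_nonneg[OF a IH[of 0]] by (simp add: h_def algebra_simps)
  next
    case (Suc j)
    \<comment> \<open>In the second term the size and the order of the derivative both drop by one,
      which removes two sign factors.\<close>
    have "\<epsilon> * \<epsilon> = 1" using assms(1) by auto
    hence "\<epsilon> ^ (size (add_mset a A) + k) * poly ((pderiv ^^ k) ([:- a, 1:] * h)) x =
      (\<epsilon> * (x - a)) * (\<epsilon> ^ (size A + k) * poly ((pderiv ^^ k) h) x) +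
      real (Suc j) * (\<epsilon> ^ (size A + j) * poly ((pderiv ^^ j) h) x)"
      unfolding Suc higher_pderiv_linear_mult
      by (simp add: algebra_simps del: funpow.simps of_nat_Suc)
    moreover have "\<dots> \<ge> 0" by (intro add_nonneg_nonneg mult_nonneg_nonneg[OF a IH] mult_nonneg_nonneg[OF _ IH]) simp
    ultimately show ?thesis by (simp add: h_def del: mult_pCons_left)
  qed
qed

text \<open>For positive \<open>k\<close> strictness comes from the Leibniz term with the lower
  derivative; the other one vanishes in the extreme case.\<close>

lemma prod_linear_sign:
  fixes \<epsilon> x :: real
  assumes \<epsilon>: "\<epsilon> = 1 \<or> \<epsilon> = -1" and "\<And>a. a \<in># A \<Longrightarrow> \<epsilon> * (x - a) > 0" "k \<le> size A"
  shows "\<epsilon> ^ (size A + k) * poly ((pderiv ^^ k) (\<Prod>a\<in>#A. [:- a, 1:])) x > 0"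
  using assms(2,3)
proof (induction A arbitrary: k)
  case empty
  thus ?case by simp
next
  case (add a A)
  define h where "h = (\<Prod>a\<in>#A. [:- a, 1:])"
  have IH: "\<epsilon> ^ (size A + k) * poly ((pderiv ^^ k) h) x > 0" if "k \<le> size A" for k
    using add that by (simp add: h_def)
  have IHw: "\<epsilon> ^ (size A + k) * poly ((pderiv ^^ k) h) x \<ge> 0" for k
    unfolding h_def by (rule prod_linear_sign_weak[OF \<epsilon>]) (use add.prems in \<open>auto intro: less_imp_le\<close>)
  have a: "\<epsilon> * (x - a) > 0" using add.prems by simp
  show ?case
  proof (cases k)
    case 0
    thus ?thesis using mult_pos_pos[OF a IH[of 0]] by (simp add: h_def algebra_simps)
  next
    case (Suc j)
    have "\<epsilon> * \<epsilon> = 1" using \<epsilon> by auto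
    hence eq: "\<epsilon> ^ (size (add_mset a A) + k) * poly ((pderiv ^^ k) ([:- a, 1:] * h)) x =
      (\<epsilon> * (x - a)) * (\<epsilon> ^ (size A + k) * poly ((pderiv ^^ k) h) x) +
      real (Suc j) * (\<epsilon> ^ (size A + j) * poly ((pderiv ^^ j) h) x)"
      unfolding Suc higher_pderiv_linear_mult
      by (simp add: algebra_simps del: funpow.simps of_nat_Suc)
    have "j \<le> size A" using add.prems(2) Suc by simp
    hence "real (Suc j) * (\<epsilon> ^ (size A + j) * poly ((pderiv ^^ j) h) x) > 0" by (intro mult_pos_pos IH) auto
    moreover have "(\<epsilon> * (x - a)) * (\<epsilon> ^ (size A + k) * poly ((pderiv ^^ k) h) x) \<ge> 0"
      by (intro mult_nonneg_nonneg[OF less_imp_le[OF a] IHw])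
    ultimately show ?thesis using eq by (simp add: h_def del: mult_pCons_left)
  qed
qed

section \<open>Zero patterns as sets of positions in a sorted list\<close>

lemma mset_set_nth:
  fixes B :: "'a :: linorder set"
  assumes "finite B"
  shows "mset_set B = image_mset (\<lambda>i. sorted_list_of_set B ! i) (mset_set {..<card B})"
proof -
  have "mset_set B = mset (map (\<lambda>i. sorted_list_of_set B ! i) [0..<length (sorted_list_of_set B)])"
    unfolding map_nth using assms by (metis mset_sorted_list_of_multiset sorted_list_of_mset_set)
  also have "\<dots> = image_mset (\<lambda>i. sorted_list_of_set B ! i) (mset_set {..<card B})"
    by (simp add: atLeast0LessThan)
  finally show ?thesis .
qed

text \<open>The last entry is peeled off and given to a part that contains it. With repeated entries
  the choice need not be unique.\<close>

lemma split_list_positions: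
  assumes "mset xs = V + F"
  shows "\<exists>I\<subseteq>{..<length xs}. image_mset (nth xs) (mset_set I) = V \<and>
    image_mset (nth xs) (mset_set ({..<length xs} - I)) = F"
  using assms
proof (induction xs arbitrary: V F rule: rev_induct)
  case (snoc x xs)
  have ext: "image_mset (nth (xs @ [x])) (mset_set I) = image_mset (nth xs) (mset_set I)"
    if "I \<subseteq> {..<length xs}" for I
    using that finite_subset[OF that] by (intro image_mset_cong) (auto simp: nth_append)
  from snoc.prems have "x \<in># V + F" by (metis mset_append union_iff union_single_eq_member mset_single_iff_right)
  then consider V' where "V = add_mset x V'" | F' where "F = add_mset x F'"
    by (metis insert_DiffM union_iff)
  thus ?case
  proof cases
    case 1
    with snoc.prems have "mset xs = V' + F" by simp
    from snoc.IH[OF this] obtain I where I: "I \<subseteq> {..<length xs}" "image_mset (nth xs) (mset_set I) = V'"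
      "image_mset (nth xs) (mset_set ({..<length xs} - I)) = F" by blast
    have "finite I" "length xs \<notin> I" using I(1) finite_subset by auto
    moreover have "{..<length (xs @ [x])} - insert (length xs) I = {..<length xs} - I" by auto
    ultimately show ?thesis using I ext[of I] ext[of "{..<length xs} - I"] 1
      by (intro exI[of _ "insert (length xs) I"]) auto
  next
    case 2
    with snoc.prems have "mset xs = V + F'" by simp
    from snoc.IH[OF this] obtain I where I: "I \<subseteq> {..<length xs}" "image_mset (nth xs) (mset_set I) = V"
      "image_mset (nth xs) (mset_set ({..<length xs} - I)) = F'" by blast
    have "{..<length (xs @ [x])} - I = insert (length xs) ({..<length xs} - I)" using I(1) by auto
    thus ?thesis using I ext[of I] ext[of "{..<length xs} - I"] 2
      by (intro exI[of _ I]) auto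
  qed
qed simp

lemma image_mset_Suc_shift:
  "image_mset (\<lambda>i. xs ! (i - 1)) (mset_set (Suc ` I)) = image_mset (nth xs) (mset_set I)"
proof -
  have "mset_set (Suc ` I) = image_mset Suc (mset_set I)" by (simp add: image_mset_mset_set)
  thus ?thesis by (simp add: image_mset.compositionality o_def)
qed

lemma zero_pattern_exists:
  assumes "hyperbolic v" "hyperbolic f"
  shows "\<exists>S\<subseteq>{1..degree f + degree v}. card S = degree v \<and>
    zero_pattern v f S ({1..degree f + degree v} - S)"
proof -
  define xs where "xs = sorted_list_of_multiset (proots (v * f))"
  have nz: "v \<noteq> 0" "f \<noteq> 0" using assms hyperbolic_nonzero by auto
  have len: "length xs = degree f + degree v"
    using length_rts[of "v * f"] assms nz by (simp add: xs_def rts_def hyperbolic_mult_iff degree_mult_eq)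
  have "mset xs = proots v + proots f" by (simp add: xs_def proots_mult nz)
  from split_list_positions[OF this] obtain I where I: "I \<subseteq> {..<length xs}"
    "image_mset (nth xs) (mset_set I) = proots v"
    "image_mset (nth xs) (mset_set ({..<length xs} - I)) = proots f" by blast
  define S where "S = Suc ` I"
  have fin: "finite I" using I(1) finite_subset by blast
  have compl: "{1..degree f + degree v} - S = Suc ` ({..<length xs} - I)"
    unfolding S_def len by (simp add: image_set_diff image_Suc_lessThan)
  have "size (image_mset (nth xs) (mset_set I)) = degree v" "size (image_mset (nth xs) (mset_set ({..<length xs} - I))) = degree f"
    unfolding I using assms by (auto simp: size_proots_hyperbolic)
  hence card: "card S = degree v" "card ({1..degree f + degree v} - S) = degree f"
    unfolding compl by (simp_all add: S_def card_image)
  have "S \<subseteq> {1..degree f + degree v}" using I(1) len by (auto simp: S_def)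
  moreover have "proots v = image_mset (\<lambda>i. xs ! (i - 1)) (mset_set S)"
    "proots f = image_mset (\<lambda>i. xs ! (i - 1)) (mset_set ({1..degree f + degree v} - S))"
    unfolding compl unfolding S_def image_mset_Suc_shift I by auto
  ultimately have "zero_pattern v f S ({1..degree f + degree v} - S)"
    unfolding zero_pattern_def xs_def[symmetric] Let_def using assms card by blast
  with \<open>S \<subseteq> {1..degree f + degree v}\<close> show ?thesis using card by blast
qed

text \<open>A position in only one of the two sets would carry a common zero of \<open>v\<close> and
  \<open>f\<close>.\<close>

lemma zero_pattern_inj:
  assumes S: "zero_pattern v f S ({1..m} - S)" "S \<subseteq> {1..m}" and S': "zero_pattern v f S' ({1..m} - S')" "S' \<subseteq> {1..m}"
    and co: "\<And>\<theta>. poly f \<theta> = 0 \<Longrightarrow> poly v \<theta> \<noteq> 0"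
  shows "S = S'"
proof -
  have *: "A \<subseteq> A'" if A: "zero_pattern v f A ({1..m} - A)" "A \<subseteq> {1..m}" and A': "zero_pattern v f A' ({1..m} - A')" for A A'
  proof
    fix i assume i: "i \<in> A"
    show "i \<in> A'"
    proof (rule ccontr)
      assume "i \<notin> A'"
      define x where "x = sorted_list_of_multiset (proots (v * f)) ! (i - 1)"
      have fin: "finite A" using A(2) finite_subset by blast
      have nz: "v \<noteq> 0" "f \<noteq> 0" using A(1) by (auto simp: zero_pattern_def hyperbolic_nonzero)
      have "x \<in># proots v" using A(1) i fin by (auto simp: zero_pattern_def Let_def x_def)
      moreover have "x \<in># proots f" using A' i A(2) \<open>i \<notin> A'\<close> by (auto simp: zero_pattern_def Let_def x_def)
      ultimately show False using co[of x] nz by simp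
    qed
  qed
  show ?thesis using *[OF S S'(1)] *[OF S' S(1)] by blast
qed

context hyperbolic_operator
begin

lemma cT_eq_0_below_M: "degree f < M \<Longrightarrow> cT f = 0"
  unfolding cdiff_op_def diff_op_def
proof (intro sum.neutral ballI)
  fix k assume "degree f < M"
  thus "cpoly (Q k) * (pderiv ^^ k) f = 0"
    by (cases "k < M") (auto simp: Q_below_M higher_pderiv_eq_0)
qed

lemma eigenvalue_lead_coeff:
  assumes "cT f = v * f" "v \<noteq> 0" "f \<noteq> 0"
  shows "M \<le> degree f" "lead_coeff v = of_real (lam (degree f))"
proof -
  show M: "M \<le> degree f" using cT_eq_0_below_M[of f] assms by (cases "degree f < M") auto
  have "lead_coeff v * lead_coeff f = of_real (lam (degree f)) * lead_coeff f"
    using lead_coeff_cT[OF assms(3) lam_nonzero[OF M]] by (simp only: assms(1) lead_coeff_mult)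
  thus "lead_coeff v = of_real (lam (degree f))" using assms(3) by simp
qed

text \<open>The difference solves the same equation, so \<open>lam_inj\<close> gives it the degree
  of \<open>f1\<close>, although the leading terms cancel. For \<open>v = 0\<close> every nonzero
  polynomial of degree below \<open>M\<close> would be a solution.\<close>

lemma eigen_unique:
  assumes v: "v \<noteq> 0" and f1: "cT f1 = v * f1" "lead_coeff f1 = 1" and f2: "cT f2 = v * f2" "lead_coeff f2 = 1"
  shows "f1 = f2"
proof (rule ccontr)
  assume neq: "f1 \<noteq> f2"
  have nz: "f1 \<noteq> 0" "f2 \<noteq> 0" using f1 f2 by auto
  note e1 = eigenvalue_lead_coeff[OF f1(1) v nz(1)] and e2 = eigenvalue_lead_coeff[OF f2(1) v nz(2)]
  have deg: "degree f1 = degree f2" using e1 e2 by (intro lam_inj) simp_all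
  have g: "f1 - f2 \<noteq> 0" "cT (f1 - f2) = v * (f1 - f2)"
    using neq f1(1) f2(1) by (simp_all add: cdiff_op_def diff_op_diff algebra_simps)
  note e3 = eigenvalue_lead_coeff[OF g(2) v g(1)]
  have "degree (f1 - f2) = degree f1" using e1 e3 by (intro lam_inj) simp_all
  moreover have "coeff (f1 - f2) (degree f1) = 0" using f1(2) f2(2) deg by simp
  ultimately have "lead_coeff (f1 - f2) = 0" by (simp only:)
  with g(1) show False by (simp only: leading_coeff_0_iff)
qed

context
  fixes n :: nat
  assumes no_common: "\<And>\<theta>. \<exists>k\<le>n. k \<le> N \<and> poly (Q k) \<theta> \<noteq> 0"
begin

context
  fixes \<epsilon> B :: real
  assumes \<epsilon>: "\<epsilon> = 1 \<or> \<epsilon> = -1" and B: "\<And>a. poly (Q (min n N)) a = 0 \<Longrightarrow> \<epsilon> * (B - a) \<ge> 0"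
begin

text \<open>On the right a count of 0 passes from \<open>Q e\<close> down to \<open>Q k\<close>. On
  the left all \<open>e + r\<close> zeros of \<open>Q e\<close> lie beyond \<open>x\<close>; the
  count drops by at most \<open>e - k\<close>, so all \<open>k + r\<close> zeros of
  \<open>Q k\<close> lie there too.\<close>

lemma Q_zeros_side:
  assumes k: "M \<le> k" "k \<le> min n N" and c: "poly (Q k) c = 0"
  shows "\<epsilon> * (B - c) \<ge> 0"
  using \<epsilon>
proof
  define e where "e = min n N"
  have e: "M \<le> e" "e \<le> N" using k by (auto simp: e_def)
  have hyp: "hyperbolic (Q k)" "hyperbolic (Q e)" using k e by (auto intro: hyperbolic_Q simp: e_def)
  hence nz: "Q k \<noteq> 0" "Q e \<noteq> 0" by (auto dest: hyperbolic_nonzero)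
  {
    assume 1: "\<epsilon> = 1"
    hence "rcount (Q e) B = 0" using B nz by (auto simp: rcount_eq_0_iff e_def)
    hence "rcount (Q k) B = 0" using rcount_Q_mono(1)[of k e B] k by (simp add: e_def)
    thus ?thesis using c 1 nz by (simp add: rcount_eq_0_iff)
  next
    assume 1: "\<epsilon> = -1"
    have "x < c" if "x < B" for x
    proof -
      have "rcount (Q e) x = e + r"
        using B 1 that rcount_eq_degree_iff[OF hyp(2), of x] degree_Q[OF e] by (force simp: e_def)
      moreover have "k \<le> e" using k by (simp add: e_def)
      ultimately have "k + r \<le> rcount (Q k) x" using rcount_Q_mono(2)[of k e x] k(1) e(2) by linarith
      moreover have dk: "degree (Q k) = k + r" using k by (intro degree_Q) auto
      ultimately have "rcount (Q k) x = degree (Q k)" using rcount_le_degree[of "Q k" x] by simp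
      thus ?thesis using c hyp by (simp add: rcount_eq_degree_iff)
    qed
    hence "B \<le> c" using dense_le[of B c] less_imp_le by blast
    thus ?thesis using 1 by simp
  }
qed

lemma Q_sign_weak:
  assumes k: "k \<le> min n N" and x: "\<epsilon> * (x - B) \<ge> 0"
  shows "\<epsilon> ^ (k + r) * (top_coeff N * poly (Q k) x) \<ge> 0"
proof (cases "M \<le> k")
  case True
  hence hyp: "hyperbolic (Q k)" using k by (auto intro: hyperbolic_Q)
  have dk: "degree (Q k) = k + r" using True k by (intro degree_Q) auto
  have "\<epsilon> ^ (size (proots (Q k)) + 0) * poly ((pderiv ^^ 0) (\<Prod>a\<in>#proots (Q k). [:- a, 1:])) x \<ge> 0"
  proof (rule prod_linear_sign_weak[OF \<epsilon>])
    fix a assume "a \<in># proots (Q k)"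
    hence "\<epsilon> * (B - a) \<ge> 0" using Q_zeros_side[OF True k] hyp by (auto simp: hyperbolic_nonzero)
    with x show "\<epsilon> * (x - a) \<ge> 0" using \<epsilon> by auto
  qed
  hence "(top_coeff N * top_coeff k) * (\<epsilon> ^ (k + r) * poly (\<Prod>a\<in>#proots (Q k). [:- a, 1:]) x) \<ge> 0"
    using top_sign_nonneg[of k] k hyp dk by (simp add: size_proots_hyperbolic)
  also have "(top_coeff N * top_coeff k) * (\<epsilon> ^ (k + r) * poly (\<Prod>a\<in>#proots (Q k). [:- a, 1:]) x) =
      \<epsilon> ^ (k + r) * (top_coeff N * poly (Q k) x)"
    using True k by (subst (2) hyperbolic_decompose[OF hyp]) (simp add: top_eq)
  finally show ?thesis .
qed (simp add: Q_below_M)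

lemma Q_M_nonzero_outside:
  assumes x: "\<epsilon> * (x - B) > 0" and M: "M \<le> min n N"
  shows "poly (Q M) x \<noteq> 0"
proof
  assume "poly (Q M) x = 0"
  hence "\<epsilon> * (B - x) \<ge> 0" using Q_zeros_side[OF order_refl M] by simp
  with x \<epsilon> show False by auto
qed

lemma f_sign_weak:
  assumes f: "hyperbolic f" "lead_coeff f = 1" and roots: "\<And>a. poly f a = 0 \<Longrightarrow> \<epsilon> * (B - a) \<ge> 0"
    and x: "\<epsilon> * (x - B) \<ge> 0"
  shows "\<epsilon> ^ (degree f + k) * poly ((pderiv ^^ k) f) x \<ge> 0"
proof -
  have "\<epsilon> ^ (size (proots f) + k) * poly ((pderiv ^^ k) (\<Prod>a\<in>#proots f. [:- a, 1:])) x \<ge> 0"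
  proof (rule prod_linear_sign_weak[OF \<epsilon>])
    fix a assume "a \<in># proots f"
    hence "\<epsilon> * (B - a) \<ge> 0" using roots f by (auto simp: hyperbolic_nonzero)
    with x show "\<epsilon> * (x - a) \<ge> 0" using \<epsilon> by auto
  qed
  thus ?thesis using hyperbolic_decompose[OF f(1)] f by (simp add: size_proots_hyperbolic)
qed

lemma f_sign:
  assumes f: "hyperbolic f" "lead_coeff f = 1" and roots: "\<And>a. poly f a = 0 \<Longrightarrow> \<epsilon> * (x - a) > 0"
    and k: "k \<le> degree f"
  shows "poly ((pderiv ^^ k) f) x \<noteq> 0"
proof -
  have "\<epsilon> ^ (size (proots f) + k) * poly ((pderiv ^^ k) (\<Prod>a\<in>#proots f. [:- a, 1:])) x > 0"
    using roots f k by (intro prod_linear_sign[OF \<epsilon>]) (auto simp: hyperbolic_nonzero size_proots_hyperbolic)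
  thus ?thesis using hyperbolic_decompose[OF f(1)] f by auto
qed

text \<open>Up to the sign of \<open>top_coeff N\<close>, the factor from \<open>Q k\<close> has
  sign \<open>\<epsilon> ^ (k + r)\<close> and the derivative has sign
  \<open>\<epsilon> ^ (n + k)\<close>. The product has a sign independent of \<open>k\<close>, so no
  cancellation occurs in \<open>T f\<close>.\<close>

lemma T_terms:
  assumes f: "hyperbolic f" "lead_coeff f = 1" "degree f = n"
    and roots: "\<And>a. poly f a = 0 \<Longrightarrow> \<epsilon> * (B - a) \<ge> 0" and x: "\<epsilon> * (x - B) \<ge> 0"
  shows "\<epsilon> ^ (n + r) * top_coeff N * poly (T f) x = (\<Sum>k\<le>N. \<epsilon> ^ (n + r) * top_coeff N * (poly (Q k) x * poly ((pderiv ^^ k) f) x))"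
    and "k \<le> N \<Longrightarrow> \<epsilon> ^ (n + r) * top_coeff N * (poly (Q k) x * poly ((pderiv ^^ k) f) x) \<ge> 0"
proof -
  show "\<epsilon> ^ (n + r) * top_coeff N * poly (T f) x = (\<Sum>k\<le>N. \<epsilon> ^ (n + r) * top_coeff N * (poly (Q k) x * poly ((pderiv ^^ k) f) x))"
    by (simp add: diff_op_def poly_sum sum_distrib_left)
  assume kN: "k \<le> N"
  show "\<epsilon> ^ (n + r) * top_coeff N * (poly (Q k) x * poly ((pderiv ^^ k) f) x) \<ge> 0"
  proof (cases "k \<le> n")
    case True
    have "0 \<le> (\<epsilon> ^ (k + r) * (top_coeff N * poly (Q k) x)) * (\<epsilon> ^ (n + k) * poly ((pderiv ^^ k) f) x)"
      using mult_nonneg_nonneg[OF Q_sign_weak[of k x] f_sign_weak[OF f(1,2) roots x, of k]] True kN x f(3)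
      by simp
    also have "\<dots> = (\<epsilon> ^ k * \<epsilon> ^ k) * (\<epsilon> ^ (n + r) * top_coeff N * (poly (Q k) x * poly ((pderiv ^^ k) f) x))"
      by (simp add: power_add mult_ac)
    also have "\<epsilon> ^ k * \<epsilon> ^ k = 1" using \<epsilon> by (auto simp flip: power_mult_distrib)
    finally show ?thesis by simp
  next
    case False
    thus ?thesis using f(3) by (simp add: higher_pderiv_eq_0)
  qed
qed

text \<open>One nonzero term suffices, and index \<open>M\<close> provides it: \<open>Q M\<close>
  has no zero beyond \<open>B\<close>, and \<open>M \<le> n\<close> keeps the derivative of
  \<open>f\<close> from vanishing.\<close>

lemma T_nonzero_outside:
  assumes f: "hyperbolic f" "lead_coeff f = 1" "degree f = n"
    and roots: "\<And>a. poly f a = 0 \<Longrightarrow> \<epsilon> * (B - a) \<ge> 0" and x: "\<epsilon> * (x - B) > 0"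
  shows "poly (T f) x \<noteq> 0"
proof
  assume "poly (T f) x = 0"
  hence "(\<Sum>k\<le>N. \<epsilon> ^ (n + r) * top_coeff N * (poly (Q k) x * poly ((pderiv ^^ k) f) x)) = 0"
    using T_terms(1)[OF f roots less_imp_le[OF x]] by simp
  hence "\<epsilon> ^ (n + r) * top_coeff N * (poly (Q M) x * poly ((pderiv ^^ M) f) x) = 0"
    using T_terms(2)[OF f roots less_imp_le[OF x]] M_le_N by (subst (asm) sum_nonneg_eq_0_iff) auto
  moreover have "poly ((pderiv ^^ M) f) x \<noteq> 0"
  proof (rule f_sign[OF f(1,2)])
    fix a assume "poly f a = 0"
    from roots[OF this] x show "\<epsilon> * (x - a) > 0" using \<epsilon> by auto
  qed (use M_le_n[OF no_common] f(3) in simp)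
  moreover have "poly (Q M) x \<noteq> 0" using Q_M_nonzero_outside[OF x] M_le_n[OF no_common] M_le_N by simp
  ultimately show False using \<epsilon> top_N_nonzero by auto
qed

text \<open>At \<open>B\<close> itself \<open>f\<close> may vanish, but its derivatives of order 1
  to \<open>n\<close> do not, because the zero is at most simple. Hence the term with
  \<open>1 \<le> k\<close> is used.\<close>

lemma T_nonzero_boundary:
  assumes f: "hyperbolic f" "lead_coeff f = 1" "degree f = n"
    and roots: "\<And>a. poly f a = 0 \<Longrightarrow> \<epsilon> * (B - a) \<ge> 0" and simple: "order B f \<le> 1"
    and k: "1 \<le> k" "k \<le> n" "k \<le> N" "poly (Q k) B \<noteq> 0"
  shows "poly (T f) B \<noteq> 0"
proof
  assume "poly (T f) B = 0"
  hence "(\<Sum>k\<le>N. \<epsilon> ^ (n + r) * top_coeff N * (poly (Q k) B * poly ((pderiv ^^ k) f) B)) = 0"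
    using T_terms(1)[OF f roots, of B] by simp
  hence "\<epsilon> ^ (n + r) * top_coeff N * (poly (Q k) B * poly ((pderiv ^^ k) f) B) = 0"
    using T_terms(2)[OF f roots, of B] k by (subst (asm) sum_nonneg_eq_0_iff) auto
  hence zero: "poly ((pderiv ^^ k) f) B = 0" using k(4) \<epsilon> top_N_nonzero by auto
  have strict: "\<epsilon> * (B - a) > 0" if "poly f a = 0" "a \<noteq> B" for a
    using roots[OF that(1)] that(2) \<epsilon> by auto
  show False
  proof (cases "poly f B = 0")
    case False
    with strict have "poly ((pderiv ^^ k) f) B \<noteq> 0" using k f(3) by (intro f_sign[OF f(1,2)]) auto
    with zero show False by simp
  next
    case True
    obtain g where g: "f = [:- B, 1:] ^ order B f * g" "hyperbolic g" "poly g B \<noteq> 0"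
      "degree f = order B f + degree g" "order B f \<ge> 1" using order_power_factor[OF f(1) True] by blast
    have "order B f = 1" using g(5) simple by simp
    with g have fg: "f = [:- B, 1:] * g" "degree f = Suc (degree g)" by simp_all
    have "lead_coeff g = 1" using f(2) unfolding fg(1) lead_coeff_mult by simp
    obtain j where j: "k = Suc j" using k by (cases k) auto
    have "\<epsilon> * (B - a) > 0" if "poly g a = 0" for a
      using strict[of a] that g(3) fg(1) by auto
    hence "poly ((pderiv ^^ j) g) B \<noteq> 0"
      using k j fg f(3) by (intro f_sign[OF g(2) \<open>lead_coeff g = 1\<close>]) auto
    moreover have "poly ((pderiv ^^ k) f) B = real (Suc j) * poly ((pderiv ^^ j) g) B"
      unfolding fg(1) j higher_pderiv_linear_mult by (simp del: funpow.simps of_nat_Suc)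
    ultimately show False using zero by simp
  qed
qed

end

end

end

section \<open>Zero patterns and the main theorem\<close>

context hyperbolic_operator
begin

context
  fixes n :: nat
  assumes no_common: "\<And>\<theta>. \<exists>k\<le>n. k \<le> N \<and> poly (Q k) \<theta> \<noteq> 0"
begin

text \<open>The map \<sigma> of the contraction: zero-based indices, into the list of zeros of
  \<open>T f\<close>, of the entries that belong to \<open>f\<close>.\<close>

definition pos :: "nat set \<Rightarrow> nat \<Rightarrow> nat" where
  "pos S i = sorted_list_of_set ({1..n + r} - S) ! i - 1"

lemma pos_facts:
  assumes S: "S \<subseteq> {1..n + r}" "card S = r"
  shows "card ({1..n + r} - S) = n" "inj_on (pos S) {..<n}" "pos S ` {..<n} \<subseteq> {..<n + r}"
    "image_mset (\<lambda>i. g (i - 1)) (mset_set ({1..n + r} - S)) = image_mset (\<lambda>i. g (pos S i)) (mset_set {..<n})"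
proof -
  define B where "B = {1..n + r} - S"
  have fin: "finite B" by (simp add: B_def)
  show card: "card ({1..n + r} - S) = n"
    using card_Diff_subset[of S "{1..n + r}"] S finite_subset[OF S(1)] by simp
  have nth: "sorted_list_of_set B ! i \<in> {1..n + r}" if "i < n" for i
    using that card fin nth_mem[of i "sorted_list_of_set B"] by (auto simp: B_def)
  show "pos S ` {..<n} \<subseteq> {..<n + r}"
    using nth unfolding pos_def B_def[symmetric] by fastforce
  have Suc_pos: "sorted_list_of_set B ! i = Suc (pos S i)" if "i < n" for i
    using nth[OF that] unfolding pos_def B_def[symmetric] by simp
  show "inj_on (pos S) {..<n}"
  proof (rule inj_onI)
    fix i j assume ij: "i \<in> {..<n}" "j \<in> {..<n}" "pos S i = pos S j"
    with Suc_pos[of i] Suc_pos[of j] have "sorted_list_of_set B ! i = sorted_list_of_set B ! j" by simp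
    with ij card show "i = j" by (auto simp: nth_eq_iff_index_eq B_def)
  qed
  show "image_mset (\<lambda>i. g (i - 1)) (mset_set ({1..n + r} - S)) = image_mset (\<lambda>i. g (pos S i)) (mset_set {..<n})"
    unfolding B_def[symmetric]
    by (subst mset_set_nth[OF fin]) (use card in \<open>simp add: B_def pos_def image_mset.compositionality o_def\<close>)
qed

text \<open>As \<open>T f = v * f\<close>, the zero list in the pattern is that of
  \<open>T f\<close>, so \<open>f\<close> is determined by its entries outside
  \<open>S\<close>.\<close>

lemma pattern_fixpoint:
  assumes S: "S \<subseteq> {1..n + r}" "card S = r"
    and pat: "zero_pattern v f S ({1..n + r} - S)" and eq: "T f = v * f"
    and f: "lead_coeff f = 1"
  defines "a \<equiv> \<lambda>i. rts (T f) ! pos S i"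
  shows "f = fpoly n a" "\<And>i. i < n \<Longrightarrow> Trts n a ! pos S i = a i"
proof -
  have hf: "hyperbolic f" using pat by (simp add: zero_pattern_def)
  have "proots f = image_mset (\<lambda>i. rts (T f) ! (i - 1)) (mset_set ({1..n + r} - S))"
    using pat by (simp add: zero_pattern_def Let_def rts_def eq)
  also have "\<dots> = image_mset a (mset_set {..<n})"
    unfolding a_def by (rule pos_facts(4)[OF S])
  finally have "proots f = image_mset a (mset_set {..<n})" .
  thus fa: "f = fpoly n a" unfolding fpoly_mset using hyperbolic_decompose[OF hf] f by simp
  show "Trts n a ! pos S i = a i" if "i < n" for i
    unfolding Trts_def fa[symmetric] by (simp add: a_def)
qed

lemma pattern_solution_unique:
  assumes S: "S \<subseteq> {1..n + r}" "card S = r"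
    and 1: "zero_pattern v f S ({1..n + r} - S)" "T f = v * f" "lead_coeff f = 1"
    and 2: "zero_pattern v' f' S ({1..n + r} - S)" "T f' = v' * f'" "lead_coeff f' = 1"
  shows "v = v' \<and> f = f'"
proof -
  note p1 = pattern_fixpoint[OF S 1] and p2 = pattern_fixpoint[OF S 2]
  have "f = fpoly n (\<lambda>i. rts (T f) ! pos S i)" by (rule p1(1))
  also have "\<dots> = fpoly n (\<lambda>i. rts (T f') ! pos S i)"
    using Trts_fixpoint_unique[OF M_le_n[OF no_common] pos_facts(2,3)[OF S] p1(2) p2(2)]
    by (intro fpoly_cong) simp
  also have "\<dots> = f'" by (rule p2(1)[symmetric])
  finally have f: "f = f'" .
  moreover have "f \<noteq> 0" using 1(3) by auto
  ultimately show ?thesis using 1(2) 2(2) by simp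
qed

lemma pattern_solution_exists:
  assumes S: "S \<subseteq> {1..n + r}" "card S = r"
  shows "\<exists>v f. zero_pattern v f S ({1..n + r} - S) \<and> T f = v * f \<and> lead_coeff f = 1 \<and> degree f = n"
proof -
  have M: "M \<le> n" by (rule M_le_n[OF no_common])
  note pos = pos_facts[OF S]
  obtain a where a: "\<And>i. i < n \<Longrightarrow> Trts n a ! pos S i = a i"
    using l1_contraction_fixpoint[OF ratio_bounds[OF M] Trts_contraction[OF M pos(2,3)]] by blast
  define f where "f = fpoly n a"
  define \<alpha> where "\<alpha> = rts (T f)"
  define B where "B = {1..n + r} - S"
  have fin: "finite S" "finite B" using S(1) finite_subset by (auto simp: B_def)
  have Tf: "hyperbolic (T f)" "degree (T f) = n + r" "lead_coeff (T f) = lam n"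
    using T_hyperbolic_degree[of f] M unfolding f_def fpoly_simps by auto
  have len: "length \<alpha> = n + r" using Tf by (simp add: \<alpha>_def length_rts)
  define VM where "VM = image_mset (\<lambda>i. \<alpha> ! (i - 1)) (mset_set S)"
  define FM where "FM = image_mset (\<lambda>i. \<alpha> ! (i - 1)) (mset_set B)"
  \<comment> \<open>The zeros at the positions in \<open>S\<close> are left for \<open>v\<close>,
    and \<open>lam n\<close> is the leading coefficient of \<open>T f\<close>.\<close>
  define v where "v = smult (lam n) (\<Prod>x\<in>#VM. [:- x, 1:])"
  have "FM = image_mset (\<lambda>i. \<alpha> ! pos S i) (mset_set {..<n})"
    unfolding FM_def B_def by (rule pos(4))
  also have "\<dots> = image_mset a (mset_set {..<n})"
    by (rule image_mset_cong) (use a in \<open>simp add: \<alpha>_def Trts_def f_def\<close>)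
  finally have FM: "f = (\<Prod>x\<in>#FM. [:- x, 1:])" "proots f = FM" by (simp_all add: f_def fpoly_mset)
  have "{1..n + r} = S \<union> B" "S \<inter> B = {}" using S by (auto simp: B_def)
  hence "mset_set {1..n + r} = mset_set S + mset_set B" using fin by (simp add: mset_set_Union)
  hence "VM + FM = image_mset (\<lambda>i. \<alpha> ! (i - 1)) (mset_set {1..n + r})" by (simp add: VM_def FM_def)
  also have "{1..n + r} = Suc ` {..<n + r}" by (simp add: image_Suc_lessThan)
  also have "image_mset (\<lambda>i. \<alpha> ! (i - 1)) (mset_set (Suc ` {..<n + r})) = mset (map (nth \<alpha>) [0..<length \<alpha>])"
    unfolding image_mset_Suc_shift by (simp add: len atLeast0LessThan)
  finally have "VM + FM = proots (T f)" by (simp only: map_nth \<alpha>_def mset_rts)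
  hence eq: "T f = v * f"
    using hyperbolic_decompose[OF Tf(1)] Tf(3)
    by (simp only: v_def FM(1) mult_smult_left flip: prod_mset.union image_mset_union)
  have l0: "lam n \<noteq> 0" by (rule lam_nonzero[OF M])
  have v: "hyperbolic v" "proots v = VM" "degree v = r"
    using l0 S by (simp_all add: v_def hyperbolic_smult hyperbolic_prod_mset VM_def)
  have hf: "hyperbolic f" "degree f = n" by (simp_all add: f_def)
  have "zero_pattern v f S B"
    unfolding zero_pattern_def Let_def eq[symmetric] rts_def[symmetric] \<alpha>_def[symmetric]
    using v FM(2) S pos(1) hf by (auto simp: VM_def FM_def B_def)
  thus ?thesis using eq by (intro exI[of _ v] exI[of _ f]) (simp add: B_def f_def)
qed

text \<open>The test polynomial is (x - B)^n: its image has no zero beyond \<open>B\<close> by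
  \<open>T_nonzero_outside\<close>, and \<open>Trts_fixpoint_le\<close> or
  \<open>Trts_fixpoint_ge\<close> carries this bound over to the fixed point.\<close>

lemma solution_zeros_in_hull:
  assumes \<epsilon>: "\<epsilon> = 1 \<or> \<epsilon> = -1" and B: "\<And>a. poly (Q (min n N)) a = 0 \<Longrightarrow> \<epsilon> * (B - a) \<ge> 0"
    and sol: "hyperbolic v" "hyperbolic f" "T f = v * f" "lead_coeff f = 1" "degree f = n" "degree v = r"
    and c: "poly (T f) c = 0"
  shows "\<epsilon> * (B - c) \<ge> 0"
proof -
  have M: "M \<le> n" by (rule M_le_n[OF no_common])
  obtain S where S: "S \<subseteq> {1..n + r}" "card S = r" "zero_pattern v f S ({1..n + r} - S)"
    using zero_pattern_exists[OF sol(1,2)] sol(5,6) by metis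
  define a where "a i = rts (T f) ! pos S i" for i
  have fp: "f = fpoly n a" "\<And>i. i < n \<Longrightarrow> Trts n a ! pos S i = a i"
    using pattern_fixpoint[OF S sol(3,4)] by (auto simp: a_def[abs_def])
  have "c \<in> set (rts (T f))"
    using c T_hyperbolic_degree(1)[OF sol(2)] sol(5) M by (simp add: set_rts hyperbolic_nonzero)
  then obtain j where j: "j < n + r" "Trts n a ! j = c"
    using length_Trts[OF M, of a] unfolding Trts_def fp(1)[symmetric] by (metis in_set_conv_nth)
  have const: "\<epsilon> * (B - Trts n (\<lambda>_. B) ! i) \<ge> 0" if i: "i < n + r" for i
  proof (rule ccontr)
    define x where "x = Trts n (\<lambda>_. B) ! i"
    have fB: "hyperbolic (fpoly n (\<lambda>_. B))" "lead_coeff (fpoly n (\<lambda>_. B)) = 1" "degree (fpoly n (\<lambda>_. B)) = n"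
      by (simp_all)
    assume "\<not> ?thesis"
    hence x: "\<epsilon> * (x - B) > 0" by (simp add: x_def algebra_simps)
    have "poly (T (fpoly n (\<lambda>_. B))) x \<noteq> 0"
      by (rule T_nonzero_outside[OF no_common \<epsilon> B fB _ x]) (auto simp: fpoly_def poly_prod)
    moreover have "x \<in> set (Trts n (\<lambda>_. B))" unfolding x_def using i length_Trts[OF M] by simp
    hence "poly (T (fpoly n (\<lambda>_. B))) x = 0"
      using T_hyperbolic_degree(1)[OF fB(1)] fB(3) M by (simp add: Trts_def set_rts hyperbolic_nonzero)
    ultimately show False by contradiction
  qed
  note pf = pos_facts(2,3)[OF S(1,2)]
  show ?thesis using \<epsilon>
  proof
    assume 1: "\<epsilon> = 1"
    have "Trts n a ! j \<le> B"
      by (rule Trts_fixpoint_le[OF M pf fp(2) _ j(1)]) (use const 1 in auto)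
    thus ?thesis using j 1 by simp
  next
    assume 1: "\<epsilon> = -1"
    have "B \<le> Trts n a ! j"
      by (rule Trts_fixpoint_ge[OF M pf fp(2) _ j(1)]) (use const 1 in auto)
    thus ?thesis using j 1 by simp
  qed
qed

text \<open>The one-sided bound is used at the largest and the smallest zero of \<open>Q e\<close>.
  Since this also bounds the zeros of \<open>f\<close>, \<open>T_nonzero_boundary\<close> then
  excludes both ends.\<close>

lemma solution_zeros_hull:
  assumes sol: "hyperbolic v" "hyperbolic f" "T f = v * f" "lead_coeff f = 1" "degree f = n" "degree v = r"
    and c: "poly (T f) c = 0"
  shows "c \<in> convex hull (real_zeros (Q (min n N)))"
    and "(\<And>\<theta>. \<exists>k\<ge>1. k \<le> n \<and> k \<le> N \<and> poly (Q k) \<theta> \<noteq> 0) \<Longrightarrow>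
      c \<in> interior (convex hull (real_zeros (Q (min n N))))"
proof -
  define e where "e = min n N"
  define Z where "Z = real_zeros (Q e)"
  have M: "M \<le> e" "e \<le> N" using M_le_n[OF no_common] M_le_N by (auto simp: e_def)
  have hQ: "hyperbolic (Q e)" "degree (Q e) = e + r" using M by (auto intro: hyperbolic_Q degree_Q)
  have hT: "hyperbolic (T f)" "degree (T f) = n + r"
    using T_hyperbolic_degree[OF sol(2)] M_le_n[OF no_common] sol(5) by auto
  have "degree (T f) \<noteq> 0"
  proof
    assume "degree (T f) = 0"
    then obtain d where "T f = [:d:]" by (rule degree_eq_zeroE)
    with c hT(1) show False by (auto dest: hyperbolic_nonzero)
  qed
  hence "e + r > 0" using hT(2) N_pos by (auto simp: e_def)
  then obtain z where "poly (Q e) z = 0" using hyperbolic_root_exists[OF hQ(1)] hQ(2) by auto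
  hence ne: "Z \<noteq> {}" by (auto simp: Z_def real_zeros_def)
  have fin: "finite Z" unfolding Z_def real_zeros_def using hQ(1) by (intro poly_roots_finite) (auto dest: hyperbolic_nonzero)
  define b l where "b = Max Z" and "l = Min Z"
  have mem: "b \<in> Z" "l \<in> Z" using fin ne by (auto simp: b_def l_def)
  have Bb: "1 * (b - a) \<ge> 0" "-1 * (l - a) \<ge> 0" if "poly (Q (min n N)) a = 0" for a
    using that fin by (simp_all add: b_def l_def Z_def real_zeros_def e_def)
  have cb: "c \<le> b" using solution_zeros_in_hull[OF _ Bb(1) sol c] by simp
  have cl: "l \<le> c" using solution_zeros_in_hull[OF _ Bb(2) sol c] by simp
  have hull: "{l..b} \<subseteq> convex hull Z"
  proof -
    have "closed_segment l b \<subseteq> convex hull Z"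
      using mem by (intro closed_segment_subset_convex_hull hull_inc)
    moreover have "l \<le> b" using cb cl by simp
    ultimately show ?thesis by (simp add: closed_segment_eq_real_ivl)
  qed
  show "c \<in> convex hull (real_zeros (Q (min n N)))"
    using hull cb cl by (auto simp: Z_def e_def)
  assume strong: "\<And>\<theta>. \<exists>k\<ge>1. k \<le> n \<and> k \<le> N \<and> poly (Q k) \<theta> \<noteq> 0"
  have f_roots: "poly (T f) a = 0" if "poly f a = 0" for a using that by (simp add: sol(3))
  have simple: "order \<theta> f \<le> 1" for \<theta>
    using strong[of \<theta>] solution_f_simple[OF no_common sol(2,5,3)] by blast
  obtain k where k: "1 \<le> k" "k \<le> n" "k \<le> N" "poly (Q k) b \<noteq> 0" using strong by blast
  have fb: "1 * (b - a) \<ge> 0" if "poly f a = 0" for a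
    using solution_zeros_in_hull[OF _ Bb(1) sol f_roots[OF that]] by simp
  have "poly (T f) b \<noteq> 0"
    by (rule T_nonzero_boundary[OF no_common _ Bb(1) sol(2,4,5) fb simple k]) simp_all
  hence "c \<noteq> b" using c by auto
  obtain k where k: "1 \<le> k" "k \<le> n" "k \<le> N" "poly (Q k) l \<noteq> 0" using strong by blast
  have fl: "-1 * (l - a) \<ge> 0" if "poly f a = 0" for a
    using solution_zeros_in_hull[OF _ Bb(2) sol f_roots[OF that]] by simp
  have "poly (T f) l \<noteq> 0"
    by (rule T_nonzero_boundary[OF no_common _ Bb(2) sol(2,4,5) fl simple k]) simp_all
  hence "c \<noteq> l" using c by auto
  have "{l<..<b} \<subseteq> interior (convex hull Z)"
    using hull by (intro interior_maximal) auto
  with \<open>c \<noteq> b\<close> \<open>c \<noteq> l\<close> cb cl show "c \<in> interior (convex hull (real_zeros (Q (min n N))))"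
    by (auto simp: Z_def e_def)
qed

end

end

lemma coprime_no_common_zero:
  fixes p q :: "complex poly"
  assumes "p \<noteq> 0" "\<And>z. poly p z = 0 \<Longrightarrow> poly q z \<noteq> 0"
  shows "coprime p q"
proof (rule coprimeI)
  fix d assume d: "d dvd p" "d dvd q"
  hence d0: "d \<noteq> 0" using assms(1) by auto
  show "is_unit d"
  proof (cases "degree d = 0")
    case True
    with d0 show ?thesis by (simp add: is_unit_iff_degree)
  next
    case False
    then obtain z where "poly d z = 0" using alg_closed_imp_poly_has_root[of d] by auto
    with d assms(2)[of z] show ?thesis by (auto elim!: dvdE)
  qed
qed

lemma rsquarefree_cpoly:
  assumes p: "hyperbolic p" and "\<And>x. order x p \<le> 1"
  shows "rsquarefree (cpoly p)"
proof -
  have "order z (cpoly p) \<le> 1" for z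
  proof (cases "poly (cpoly p) z = 0")
    case True
    hence "z = of_real (Re z)" using hyperbolic_rootD[OF p] by (simp add: complex_eq_iff)
    with assms(2) order_cpoly[OF hyperbolic_nonzero[OF p]] show ?thesis by metis
  qed (simp add: order_0I)
  thus ?thesis using hyperbolic_nonzero[OF p] by (auto simp: rsquarefree_def le_Suc_eq)
qed

theorem theorem1p3:
  fixes N n r :: nat and Q :: "nat \<Rightarrow> real poly"
  assumes "N \<ge> 1"
    and "Q N \<noteq> 0"
    and "\<And>k. k > N \<Longrightarrow> Q k = 0"
    and "preserves_hyperbolicity (diff_op N Q)"
    and "fuchs_index N Q = int r"
    and "non_degenerate N Q"
    and "\<nexists>\<theta>::real. \<forall>k\<in>{0..n}. poly (Q k) \<theta> = 0"
  shows
    "(\<forall>v f1 f2. v \<noteq> 0 \<and> monic f1 \<and> monic f2 \<and>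
        eigenpair (cdiff_op N Q) v f1 \<and> eigenpair (cdiff_op N Q) v f2 \<longrightarrow> f1 = f2)
     \<and>
     ((\<forall>S. S \<subseteq> {1..n + r} \<and> card S = r \<longrightarrow>
        (\<exists>!(v, f). zero_pattern v f S ({1..n + r} - S) \<and>
           eigenpair (diff_op N Q) v f \<and> monic f \<and> degree f = n)) \<and>
      {(v, f). eigenpair (cdiff_op N Q) v f \<and> monic f \<and> degree f = n} =
      {(cpoly v, cpoly f) | v f. \<exists>S. S \<subseteq> {1..n + r} \<and> card S = r \<and>
           zero_pattern v f S ({1..n + r} - S) \<and>
           eigenpair (diff_op N Q) v f \<and> monic f \<and> degree f = n} \<and>
      card {(v, f). eigenpair (cdiff_op N Q) v f \<and> monic f \<and> degree f = n} = (n + r) choose r)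
     \<and>
     (\<forall>v f. eigenpair (cdiff_op N Q) v f \<and> monic f \<and> degree f = n \<longrightarrow>
        coprime v f \<and>
        complex_zeros v \<union> complex_zeros f \<subseteq>
          complex_of_real ` (convex hull (real_zeros (Q (min n N)))))
     \<and>
     ((\<nexists>\<theta>::real. \<forall>k\<in>{1..n}. poly (Q k) \<theta> = 0) \<longrightarrow>
      (\<forall>v f. eigenpair (cdiff_op N Q) v f \<and> monic f \<and> degree f = n \<longrightarrow>
        rsquarefree v \<and> rsquarefree f \<and>
        complex_zeros v \<union> complex_zeros f \<subseteq>
          complex_of_real ` interior (convex hull (real_zeros (Q (min n N))))))"
proof -
  have degN: "degree (Q N) = N + r" using assms(5,6) by (simp add: non_degenerate_def)
  have deg_le: "degree (Q k) \<le> k + r" if "k \<le> N" for k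
  proof (cases "Q k = 0")
    case False
    have "{int (degree (Q k)) - int k | k. k \<le> N \<and> Q k \<noteq> 0} \<subseteq> (\<lambda>k. int (degree (Q k)) - int k) ` {..N}" by auto
    hence "finite {int (degree (Q k)) - int k | k. k \<le> N \<and> Q k \<noteq> 0}" by (rule finite_subset) simp
    hence "int (degree (Q k)) - int k \<le> fuchs_index N Q"
      unfolding fuchs_index_def using that False by (intro Max_ge) auto
    with assms(5) show ?thesis by simp
  qed simp
  interpret hyperbolic_operator N r Q
    by unfold_locales (use assms deg_le degN in auto)
  have no_common: "\<exists>k\<le>n. k \<le> N \<and> poly (Q k) \<theta> \<noteq> 0" for \<theta>
  proof -
    have "\<exists>k\<in>{0..n}. poly (Q k) \<theta> \<noteq> 0" using assms(7) by blast
    then obtain k where k: "k \<le> n" "poly (Q k) \<theta> \<noteq> 0" by auto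
    moreover have "k \<le> N" using assms(3)[of k] k(2) by (metis not_le poly_0)
    ultimately show ?thesis by blast
  qed
  have M: "M \<le> n" by (rule M_le_n[OF no_common])
  have MN: "M < N" by (rule M_less_N[OF no_common])
  let ?X = "{(v, f). eigenpair cT v f \<and> monic f \<and> degree f = n}"
  let ?sol = "\<lambda>S v f. zero_pattern v f S ({1..n + r} - S) \<and> eigenpair T v f \<and> monic f \<and> degree f = n"
  let ?Y = "{(cpoly v, cpoly f) | v f. \<exists>S. S \<subseteq> {1..n + r} \<and> card S = r \<and>
           zero_pattern v f S ({1..n + r} - S) \<and> eigenpair T v f \<and> monic f \<and> degree f = n}"
  have real: "\<exists>v' f'. v = cpoly v' \<and> f = cpoly f' \<and> hyperbolic v' \<and> hyperbolic f' \<and> T f' = v' * f' \<and>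
      degree v' = r \<and> lead_coeff f' = 1 \<and> degree f' = n"
    if "eigenpair cT v f" "monic f" "degree f = n" for v f
  proof -
    have "lead_coeff f = 1" "M \<le> degree f" "cT f = v * f" using that M by (auto simp: monic_def eigenpair_def)
    from solution_real[OF MN this] that(3) show ?thesis by (metis degree_cpoly)
  qed
  have part1: "\<forall>v f1 f2. v \<noteq> 0 \<and> monic f1 \<and> monic f2 \<and> eigenpair cT v f1 \<and> eigenpair cT v f2 \<longrightarrow> f1 = f2"
    using eigen_unique by (auto simp: monic_def eigenpair_def)
  have ex1: "\<exists>!(v, f). ?sol S v f" if S: "S \<subseteq> {1..n + r}" "card S = r" for S
  proof -
    obtain v f where vf: "zero_pattern v f S ({1..n + r} - S)" "T f = v * f" "lead_coeff f = 1" "degree f = n"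
      using pattern_solution_exists[OF no_common S] by blast
    show ?thesis
    proof (rule ex1I[of _ "(v, f)"])
      show "case (v, f) of (v, f) \<Rightarrow> ?sol S v f" using vf by (auto simp: eigenpair_def monic_def)
      fix p assume p: "case p of (v, f) \<Rightarrow> ?sol S v f"
      obtain v' f' where [simp]: "p = (v', f')" by (cases p)
      show "p = (v, f)"
        using pattern_solution_unique[OF no_common S, of v' f' v f] vf p by (auto simp: eigenpair_def monic_def)
    qed
  qed
  have XY: "?X = ?Y"
  proof (intro equalityI subsetI)
    fix p assume "p \<in> ?X"
    then obtain v f where vf: "p = (v, f)" "eigenpair cT v f" "monic f" "degree f = n" by blast
    from real[OF vf(2-4)] obtain v' f' where *: "v = cpoly v'" "f = cpoly f'" "hyperbolic v'" "hyperbolic f'"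
      "T f' = v' * f'" "degree v' = r" "lead_coeff f' = 1" "degree f' = n" by blast
    from zero_pattern_exists[OF *(3,4)] obtain S where "S \<subseteq> {1..n + r}" "card S = r"
      "zero_pattern v' f' S ({1..n + r} - S)" unfolding *(6,8) by blast
    with * vf(1) show "p \<in> ?Y" by (auto simp: eigenpair_def monic_def hyperbolic_nonzero)
  next
    fix p assume "p \<in> ?Y"
    then obtain v f where "p = (cpoly v, cpoly f)" "eigenpair T v f" "monic f" "degree f = n" by blast
    thus "p \<in> ?X" by (auto simp: eigenpair_def monic_def cdiff_op_cpoly cpoly_mult)
  qed
  have no_common_zero: "poly v \<theta> \<noteq> 0" if "hyperbolic f" "T f = v * f" "degree f = n" "poly f \<theta> = 0" for v f \<theta>
    by (rule solution_no_common_zero[OF no_common that(1,3,2,4)])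
  have card: "card ?X = (n + r) choose r"
  proof -
    define D where "D = {S. S \<subseteq> {1..n + r} \<and> card S = r}"
    have "\<forall>S\<in>D. \<exists>p. case p of (v, f) \<Rightarrow> ?sol S v f" using ex1 unfolding D_def by (blast dest: ex1_implies_ex)
    from bchoice[OF this] obtain g where g: "\<forall>S\<in>D. case g S of (v, f) \<Rightarrow> ?sol S v f" by blast
    define h where "h = (\<lambda>S. (cpoly (fst (g S)), cpoly (snd (g S))))"
    have g': "?sol S (fst (g S)) (snd (g S))" if "S \<in> D" for S using bspec[OF g that] by (simp only: case_prod_beta)
    \<comment> \<open>Distinct position sets give distinct pairs because \<open>v\<close> and
      \<open>f\<close> have no common zero.\<close>
    have "inj_on h D"
    proof (rule inj_onI)
      fix S S' assume SS: "S \<in> D" "S' \<in> D" "h S = h S'"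
      hence eq: "fst (g S) = fst (g S')" "snd (g S) = snd (g S')" by (auto simp: h_def)
      have "hyperbolic (snd (g S))" "T (snd (g S)) = fst (g S) * snd (g S)" "degree (snd (g S)) = n"
        using g'[OF SS(1)] by (auto simp: zero_pattern_def eigenpair_def)
      note co = no_common_zero[OF this]
      show "S = S'"
        by (rule zero_pattern_inj[of "fst (g S)" "snd (g S)" S "n + r" S'])
          (use g'[OF SS(1)] g'[OF SS(2)] SS co eq in \<open>auto simp: D_def\<close>)
    qed
    moreover have "h ` D = ?Y"
    proof (intro equalityI subsetI)
      fix p assume "p \<in> h ` D"
      then obtain S where "S \<in> D" "p = h S" by blast
      with g'[of S] show "p \<in> ?Y" unfolding h_def D_def by blast
    next
      fix p assume "p \<in> ?Y"
      then obtain v f S where p: "p = (cpoly v, cpoly f)" "S \<subseteq> {1..n + r}" "card S = r" "?sol S v f" by blast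
      hence "S \<in> D" by (simp add: D_def)
      have "v = fst (g S) \<and> f = snd (g S)"
        by (rule pattern_solution_unique[OF no_common p(2,3)])
          (use g'[OF \<open>S \<in> D\<close>] p(4) in \<open>(unfold eigenpair_def monic_def, blast)+\<close>)
      hence "p = h S" by (simp add: p(1) h_def)
      with \<open>S \<in> D\<close> show "p \<in> h ` D" by blast
    qed
    ultimately have "card ?X = card D" unfolding XY by (metis card_image)
    also have "\<dots> = (n + r) choose r" unfolding D_def using n_subsets[of "{1..n + r}" r] by simp
    finally show ?thesis .
  qed
  have part3: "coprime v f \<and> complex_zeros v \<union> complex_zeros f \<subseteq>
      complex_of_real ` (convex hull (real_zeros (Q (min n N))))"
    and part4: "(\<nexists>\<theta>::real. \<forall>k\<in>{1..n}. poly (Q k) \<theta> = 0) \<Longrightarrow> rsquarefree v \<and> rsquarefree f \<and>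
      complex_zeros v \<union> complex_zeros f \<subseteq>
          complex_of_real ` interior (convex hull (real_zeros (Q (min n N))))"
    if vf: "eigenpair cT v f" "monic f" "degree f = n" for v f
  proof -
    from real[OF vf] obtain v' f' where *: "v = cpoly v'" "f = cpoly f'" and sol: "hyperbolic v'" "hyperbolic f'"
      "T f' = v' * f'" "lead_coeff f' = 1" "degree f' = n" "degree v' = r" by blast
    have zeros: "\<exists>c. z = of_real c \<and> poly (T f') c = 0" if "z \<in> complex_zeros v \<union> complex_zeros f" for z
    proof -
      have z: "poly (cpoly v') z = 0 \<or> poly (cpoly f') z = 0" using that * by (auto simp: complex_zeros_def)
      hence "Im z = 0" using hyperbolic_rootD sol by blast
      hence zr: "z = of_real (Re z)" by (simp add: complex_eq_iff)
      hence "poly v' (Re z) = 0 \<or> poly f' (Re z) = 0"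
        using z by (metis poly_cpoly_of_real of_real_eq_0_iff)
      hence "poly (T f') (Re z) = 0" by (auto simp: sol(3))
      with zr show ?thesis by blast
    qed
    have "poly v z \<noteq> 0" if "poly f z = 0" for z
    proof -
      have "Im z = 0" using hyperbolic_rootD[OF sol(2)] that * by simp
      hence zr: "z = of_real (Re z)" by (simp add: complex_eq_iff)
      hence "poly f' (Re z) = 0" using that *(2) by (metis poly_cpoly_of_real of_real_eq_0_iff)
      hence "poly v' (Re z) \<noteq> 0" by (rule no_common_zero[OF sol(2,3,5)])
      thus ?thesis using *(1) zr by (metis poly_cpoly_of_real of_real_eq_0_iff)
    qed
    moreover have "f \<noteq> 0" using vf(1) by (simp add: eigenpair_def)
    ultimately have "coprime f v" by (intro coprime_no_common_zero)
    moreover have "complex_zeros v \<union> complex_zeros f \<subseteq> complex_of_real ` (convex hull (real_zeros (Q (min n N))))"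
      using zeros solution_zeros_hull(1)[OF no_common sol] by fastforce
    ultimately show "coprime v f \<and> complex_zeros v \<union> complex_zeros f \<subseteq>
      complex_of_real ` (convex hull (real_zeros (Q (min n N))))" by (simp add: coprime_commute)
    assume H: "\<nexists>\<theta>::real. \<forall>k\<in>{1..n}. poly (Q k) \<theta> = 0"
    have strong: "\<exists>k\<ge>1. k \<le> n \<and> k \<le> N \<and> poly (Q k) \<theta> \<noteq> 0" for \<theta>
    proof -
      have "\<exists>k\<in>{1..n}. poly (Q k) \<theta> \<noteq> 0" using H by blast
      then obtain k where k: "1 \<le> k" "k \<le> n" "poly (Q k) \<theta> \<noteq> 0" by auto
      moreover have "k \<le> N" using assms(3)[of k] k(3) by (metis not_le poly_0)
      ultimately show ?thesis by blast
    qed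
    \<comment> \<open>For \<open>n = 0\<close> the condition on \<theta> in \<open>H\<close> is
      empty, so \<open>H\<close> fails. Thus \<open>f\<close> has a zero that can be moved in
      \<open>solution_v_simple\<close>.\<close>
    have n: "n \<ge> 1" using strong[of 0] by auto
    have "order \<theta> v' \<le> 1" for \<theta> by (rule solution_v_simple[OF no_common sol(2,5) n sol(3)])
    hence "rsquarefree v" unfolding * by (rule rsquarefree_cpoly[OF sol(1)])
    moreover have "order \<theta> f' \<le> 1" for \<theta>
      using strong[of \<theta>] solution_f_simple[OF no_common sol(2,5,3)] by blast
    hence "rsquarefree f" unfolding * by (rule rsquarefree_cpoly[OF sol(2)])
    moreover have "complex_zeros v \<union> complex_zeros f \<subseteq> complex_of_real ` interior (convex hull (real_zeros (Q (min n N))))"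
      using zeros solution_zeros_hull(2)[OF no_common sol _ strong] by fastforce
    ultimately show "rsquarefree v \<and> rsquarefree f \<and> complex_zeros v \<union> complex_zeros f \<subseteq>
          complex_of_real ` interior (convex hull (real_zeros (Q (min n N))))" by blast
  qed
  show ?thesis
  proof (intro conjI part1 XY card)
    show "\<forall>S. S \<subseteq> {1..n + r} \<and> card S = r \<longrightarrow> (\<exists>!(v, f). ?sol S v f)"
      by (intro allI impI, elim conjE, rule ex1)
    show "\<forall>v f. eigenpair cT v f \<and> monic f \<and> degree f = n \<longrightarrow> coprime v f \<and>
        complex_zeros v \<union> complex_zeros f \<subseteq> complex_of_real ` (convex hull (real_zeros (Q (min n N))))"
      by (intro allI impI, elim conjE, rule part3)
    show "(\<nexists>\<theta>::real. \<forall>k\<in>{1..n}. poly (Q k) \<theta> = 0) \<longrightarrow>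
      (\<forall>v f. eigenpair cT v f \<and> monic f \<and> degree f = n \<longrightarrow> rsquarefree v \<and> rsquarefree f \<and>
        complex_zeros v \<union> complex_zeros f \<subseteq>
          complex_of_real ` interior (convex hull (real_zeros (Q (min n N)))))"
      by (intro allI impI, elim conjE, rule part4)
  qed
qed

end
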